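(* There are absolute constants $c, C \in \mathbb{N}$ such that the following holds. Let $D$ be a set, $\mu$ a measure on $D$ and $F$ a class of complex-valued square-integrable functions on $D$ that satisfy Assumption A. Let $Y \subset \mathbb{C}^D$ be a seminormed space that satisfies Assumption B, with $F \subset Y$. Let $(V_m)_{m\in\mathbb{N}}$ be a nested sequence of subspaces of $Y \cap L_2(D,\mu)$. Then, for all $m\in\mathbb{N}$, $$g_{cm}^{\mathrm{lin}}(F,Y) \;\leq\; C \cdot \sum_{k>m} \frac{d(F,V_k)_2}{\sqrt{k}} \cdot \max\left\{\frac{\Lambda_{4k}}{\sqrt{k}}, \frac{\Lambda_{4m}}{\sqrt{m}}\right\},$$ where $\Lambda_m := \sup_{f\in V_m,\, f\neq 0} \|f\|_Y/\|f\|_2$.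
   Context: $L_2=L_2(D,\mu)$ is considered as a space of functions with seminorm $\|\cdot\|_2$. A nested sequence of subspaces of $L_2$ is a sequence $(V_m)_{m\in\mathbb{N}}$ with $\dim V_m=m$ and $V_m\subset V_{m+1}$, given by an orthonormal system $\{b_k\}_{k\in\mathbb{N}_0}$ of $L_2$ via $V_m=\operatorname{span}\{b_k: 0\le k<m\}$. Assumption A (on $D,\mu,F$): there exists a topology on $F$ such that (i) $F$ is separable; (ii) for every $x\in D$, the function evaluation $f\mapsto f(x)$ is continuous on $F$; (iii) the identity mapping $F\to L_2(D,\mu)$, $f\mapsto f$, is continuous. Assumption B (on $Y$, a seminormed space of complex-valued functions on $D$): (i) $Y\cap L_2$ is complete with respect to the seminorm $\|\cdot\|_Y+\|\cdot\|_2$; (ii) if $f,g\in Y$ and $f=g$ holds $\mu$-almost everywhere, then $\|f\|_Y=\|g\|_Y$. $d(F,V_k)_2:=\sup_{f\in F}\inf_{g\in V_k}\|f-g\|_2$. Linear sampling numbers: $g_n^{\mathrm{lin}}(F,Y):=\inf_{x_1,\dots,x_n\in D,\ \varphi_1,\dots,\varphi_n\in Y}\ \sup_{f\in F}\big\|f-\sum_{i=1}^n f(x_i)\varphi_i\big\|_Y$.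
   Formalization: Added, since the claim fails without it: some Λ_k > 0 or d(F,V_k)_2 → 0 (else the right side can be 0 with g_n^lin ≥ 1). Constants c, C are stated for all D inside one ambient set; uniformity over all sets follows by uniting countably many counterexample domains. *)

theory Defs
  imports "HOL-Analysis.Analysis" "HOL-Library.Function_Algebras"
begin

text \<open>
  The domain is the carrier \<open>D = space M\<close> of the measure. A function on \<open>D\<close> is represented by
  its extension by zero to the ambient type, so that \<open>funs_on D\<close> is a canonical copy of the
  complex vector space of all functions from \<open>D\<close> to the complex numbers, with pointwise
  operations. Functions are not identified almost everywhere.
\<close>

definition funs_on :: "'a set \<Rightarrow> ('a \<Rightarrow> complex) set" where
  "funs_on D = {f. \<forall>x. x \<notin> D \<longrightarrow> f x = 0}"

definition cscale :: "complex \<Rightarrow> ('a \<Rightarrow> complex) \<Rightarrow> 'a \<Rightarrow> complex" where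
  "cscale c f = (\<lambda>x. c * f x)"

global_interpretation cfun: vector_space cscale
  by standard (auto simp: cscale_def fun_eq_iff algebra_simps)

subsection \<open>Square-integrable functions\<close>

definition L2 :: "'a measure \<Rightarrow> ('a \<Rightarrow> complex) set" where
  "L2 M = {f \<in> funs_on (space M).
             f \<in> borel_measurable M \<and> integrable M (\<lambda>x. (cmod (f x))\<^sup>2)}"

definition L2_inner :: "'a measure \<Rightarrow> ('a \<Rightarrow> complex) \<Rightarrow> ('a \<Rightarrow> complex) \<Rightarrow> complex" where
  "L2_inner M f g = (LINT x|M. f x * cnj (g x))"

definition L2_norm :: "'a measure \<Rightarrow> ('a \<Rightarrow> complex) \<Rightarrow> real" where
  "L2_norm M f = sqrt (LINT x|M. (cmod (f x))\<^sup>2)"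

definition L2_topology :: "'a measure \<Rightarrow> ('a \<Rightarrow> complex) topology" where
  "L2_topology M =
     topology_generated_by {{g \<in> L2 M. L2_norm M (g - f) < e} |f e. f \<in> L2 M \<and> 0 < e}"

definition orthonormal_system :: "'a measure \<Rightarrow> (nat \<Rightarrow> 'a \<Rightarrow> complex) \<Rightarrow> bool" where
  "orthonormal_system M b \<longleftrightarrow>
     (\<forall>k. b k \<in> L2 M) \<and> (\<forall>j k. L2_inner M (b j) (b k) = (if j = k then 1 else 0))"

text \<open>The index of the sequence ranges over the positive integers; \<open>V 0\<close> is irrelevant.\<close>

definition nested_subspaces :: "'a measure \<Rightarrow> (nat \<Rightarrow> ('a \<Rightarrow> complex) set) \<Rightarrow> bool" where
  "nested_subspaces M V \<longleftrightarrow>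
     (\<forall>m\<ge>1. cfun.dim (V m) = m \<and> V m \<subseteq> V (Suc m)) \<and>
     (\<exists>b. orthonormal_system M b \<and> (\<forall>m\<ge>1. V m = cfun.span (b ` {..<m})))"

subsection \<open>Seminormed function spaces and the standing assumptions\<close>

definition seminormed_fun_space ::
  "'a set \<Rightarrow> ('a \<Rightarrow> complex) set \<Rightarrow> (('a \<Rightarrow> complex) \<Rightarrow> real) \<Rightarrow> bool" where
  "seminormed_fun_space D Y nY \<longleftrightarrow>
     Y \<subseteq> funs_on D \<and> cfun.subspace Y \<and>
     (\<forall>f\<in>Y. 0 \<le> nY f) \<and>
     (\<forall>f\<in>Y. \<forall>g\<in>Y. nY (f + g) \<le> nY f + nY g) \<and>
     (\<forall>c. \<forall>f\<in>Y. nY (cscale c f) = cmod c * nY f)"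

definition seminorm_complete ::
  "('a \<Rightarrow> complex) set \<Rightarrow> (('a \<Rightarrow> complex) \<Rightarrow> real) \<Rightarrow> bool" where
  "seminorm_complete S p \<longleftrightarrow>
     (\<forall>u. (\<forall>n::nat. u n \<in> S) \<and> (\<forall>e>0. \<exists>N. \<forall>i\<ge>N. \<forall>j\<ge>N. p (u i - u j) < e)
        \<longrightarrow> (\<exists>f\<in>S. (\<lambda>n. p (u n - f)) \<longlonglongrightarrow> 0))"

definition assumption_A :: "'a measure \<Rightarrow> ('a \<Rightarrow> complex) set \<Rightarrow> bool" where
  "assumption_A M F \<longleftrightarrow>
     (\<exists>T. topspace T = F \<and>
          separable_space T \<and>
          (\<forall>x\<in>space M. continuous_map T euclidean (\<lambda>f. f x)) \<and>
          continuous_map T (L2_topology M) (\<lambda>f. f))"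

definition assumption_B ::
  "'a measure \<Rightarrow> ('a \<Rightarrow> complex) set \<Rightarrow> (('a \<Rightarrow> complex) \<Rightarrow> real) \<Rightarrow> bool" where
  "assumption_B M Y nY \<longleftrightarrow>
     seminorm_complete (Y \<inter> L2 M) (\<lambda>f. nY f + L2_norm M f) \<and>
     (\<forall>f\<in>Y. \<forall>g\<in>Y. (AE x in M. f x = g x) \<longrightarrow> nY f = nY g)"

subsection \<open>Approximation quantities\<close>

text \<open>These take values in \<open>[0, \<infinity>]\<close>, where \<open>0 * \<infinity> = 0\<close>.\<close>

definition L2_dist :: "'a measure \<Rightarrow> ('a \<Rightarrow> complex) set \<Rightarrow> ('a \<Rightarrow> complex) set \<Rightarrow> ennreal" where
  "L2_dist M F V = (SUP f\<in>F. INF g\<in>V. ennreal (L2_norm M (f - g)))"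

definition lin_sampling_number ::
  "'a set \<Rightarrow> nat \<Rightarrow> ('a \<Rightarrow> complex) set \<Rightarrow> ('a \<Rightarrow> complex) set \<Rightarrow> (('a \<Rightarrow> complex) \<Rightarrow> real) \<Rightarrow> ennreal"
  where
  "lin_sampling_number D n F Y nY =
     (INF x \<in> {..<n} \<rightarrow> D. INF \<phi> \<in> {..<n} \<rightarrow> Y.
        SUP f\<in>F. ennreal (nY (f - (\<Sum>i<n. cscale (f (x i)) (\<phi> i)))))"

definition Lambda ::
  "'a measure \<Rightarrow> (('a \<Rightarrow> complex) \<Rightarrow> real) \<Rightarrow> ('a \<Rightarrow> complex) set \<Rightarrow> ennreal" where
  "Lambda M nY V = (SUP f \<in> V - {0}. ennreal (nY f / L2_norm M f))"

end

theory Submission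
  imports Defs
begin

text \<open>
  Put \<open>n = 2 m\<close> and let \<open>\<delta>\<^sub>l\<close> be the distance of \<open>F\<close> from \<open>V\<close> at the index \<open>2 ^ l * n\<close>. Weighted least squares
  onto \<open>V n\<close> is stable as soon as the sampling form \<open>\<Sum>\<^sub>i s\<^sub>i \<bar>f (x\<^sub>i)\<bar>\<^sup>2\<close> is bounded below on \<open>V n\<close> and bounded
  above on the tails \<open>f - P f\<close>, where \<open>P\<close> is the orthogonal projection onto \<open>V n\<close>. Scaling \<open>b\<^sub>k\<close> in the block
  \<open>2 ^ l * n \<le> k < 2 ^ (l + 1) * n\<close> by the square root of \<open>\<delta>\<^sub>l / (2 ^ (l / 2) * S)\<close> with
  \<open>S = \<Sum>\<^sub>l 2 ^ (l / 2) * \<delta>\<^sub>l\<close> makes the covariance of the tail a contraction of trace at most \<open>n\<close>. The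
  two-barrier method of Batson, Spielman and Srivastava, run with integrals over the measure instead
  of averages over finitely many vectors, therefore yields \<open>3 n\<close> points with both bounds; no random
  sampling and no solution of the Kadison--Singer problem is needed. The remaining error \<open>f - P f\<close> is
  summed block by block in the seminorm of \<open>Y\<close>.
\<close>

text \<open>Two obstacles shape the argument. The barriers act on finite matrices, whereas the tail
  of \<open>f\<close> has infinitely many coordinates: only the indices below a large
  \<open>K\<close> enter the upper barrier, and the rest is charged to a scalar function of small
  integral. Moreover a member of \<open>F\<close> equals its orthogonal expansion only almost
  everywhere, off a null set depending on \<open>f\<close>, while samples are taken at single
  points. The points are therefore chosen for a countable dense subset of \<open>F\<close>, and the
  resulting inequality, with its finitely many evaluations and coefficients, passes to all of
  \<open>F\<close> by continuity. The doubling n = 2 m fits the blocks to the sum over k > m: for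
  2^l m < k <= 2^(l+1) m one has k <= 2^l n and 2^(l+1) n <= 4 k, so the quantities at 2^l n and
  2^(l+1) n are dominated by the distance at k and by \<open>Lambda\<close> at 4 k. The maximum has
  two entries because there are two errors: the first entry pays for f - P f in \<open>Y\<close>,
  the second for the least squares error, which is multiplied by \<open>Lambda\<close> at n <= 4
  m.\<close>

lemma cmod_sum_mult_squared_le:
  "(cmod (\<Sum>i\<in>A. x i * y i))\<^sup>2 \<le> (\<Sum>i\<in>A. (cmod (x i))\<^sup>2) * (\<Sum>i\<in>A. (cmod (y i))\<^sup>2)"
proof -
  have "cmod (\<Sum>i\<in>A. x i * y i) \<le> (\<Sum>i\<in>A. cmod (x i) * cmod (y i))"
    by (rule order_trans[OF norm_sum]) (simp add: norm_mult)
  then have "(cmod (\<Sum>i\<in>A. x i * y i))\<^sup>2 \<le> (\<Sum>i\<in>A. cmod (x i) * cmod (y i))\<^sup>2"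
    by (intro power_mono) auto
  also have "\<dots> \<le> (\<Sum>i\<in>A. (cmod (x i))\<^sup>2) * (\<Sum>i\<in>A. (cmod (y i))\<^sup>2)"
    by (rule Cauchy_Schwarz_ineq_sum)
  finally show ?thesis .
qed

lemma complex_of_real_Re_if_cnj: "cnj z = z \<Longrightarrow> z = of_real (Re z)"
  by (simp add: complex_eq_iff)

lemma sum_apply_fun: "(\<Sum>i\<in>A. f i) x = (\<Sum>i\<in>A. f i x)"
  by (induction A rule: infinite_finite_induct) auto

subsection \<open>Hermitian matrices over a finite index set\<close>

text \<open>Entries and coordinates outside \<open>I\<close> are ignored.\<close>

locale finite_index =
  fixes I :: "'i set"
  assumes fin: "finite I"
begin

definition ip :: "('i \<Rightarrow> complex) \<Rightarrow> ('i \<Rightarrow> complex) \<Rightarrow> complex" where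
  "ip x y = (\<Sum>i\<in>I. x i * cnj (y i))"

definition sq :: "('i \<Rightarrow> complex) \<Rightarrow> real" where
  "sq x = (\<Sum>i\<in>I. (cmod (x i))\<^sup>2)"

definition mv :: "('i \<Rightarrow> 'i \<Rightarrow> complex) \<Rightarrow> ('i \<Rightarrow> complex) \<Rightarrow> 'i \<Rightarrow> complex" where
  "mv A x = (\<lambda>i. \<Sum>j\<in>I. A i j * x j)"

definition unit :: "'i \<Rightarrow> 'i \<Rightarrow> complex" where
  "unit k = (\<lambda>i. if i = k then 1 else 0)"

definition herm :: "('i \<Rightarrow> 'i \<Rightarrow> complex) \<Rightarrow> bool" where
  "herm A \<longleftrightarrow> (\<forall>i\<in>I. \<forall>j\<in>I. A j i = cnj (A i j))"

definition pos_def :: "('i \<Rightarrow> 'i \<Rightarrow> complex) \<Rightarrow> bool" where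
  "pos_def A \<longleftrightarrow> herm A \<and> (\<forall>x. (\<exists>i\<in>I. x i \<noteq> 0) \<longrightarrow> 0 < Re (ip (mv A x) x))"

text \<open>One-sided, and only on the coordinates in \<open>I\<close>, since matrices are functions
  with arbitrary values elsewhere. For positive definite \<open>Q\<close> self-adjointness supplies
  the rest, as in \<open>ip_inv_herm\<close>.\<close>

definition is_inv :: "('i \<Rightarrow> 'i \<Rightarrow> complex) \<Rightarrow> ('i \<Rightarrow> 'i \<Rightarrow> complex) \<Rightarrow> bool" where
  "is_inv Q R \<longleftrightarrow> (\<forall>x. \<forall>i\<in>I. mv Q (mv R x) i = x i)"

definition shift :: "real \<Rightarrow> ('i \<Rightarrow> 'i \<Rightarrow> complex) \<Rightarrow> 'i \<Rightarrow> 'i \<Rightarrow> complex" where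
  "shift d Q = (\<lambda>i j. Q i j + (if i = j then of_real d else 0))"

definition rank1 :: "real \<Rightarrow> ('i \<Rightarrow> complex) \<Rightarrow> ('i \<Rightarrow> 'i \<Rightarrow> complex) \<Rightarrow> 'i \<Rightarrow> 'i \<Rightarrow> complex" where
  "rank1 s v Q = (\<lambda>i j. Q i j + of_real s * v i * cnj (v j))"

text \<open>The barrier potential. With \<open>g\<close> constantly 1 it is the trace; in general
  \<open>g\<close> is the diagonal of the covariance of the sampled vectors, and
  \<open>wtr g R\<close> is the mean of the quadratic form of \<open>R\<close>, see
  \<open>integral_ip_mv\<close>.\<close>

definition wtr :: "('i \<Rightarrow> real) \<Rightarrow> ('i \<Rightarrow> 'i \<Rightarrow> complex) \<Rightarrow> real" where
  "wtr g R = (\<Sum>k\<in>I. g k * Re (R k k))"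

lemma ip_add_left: "ip (\<lambda>i. x i + y i) z = ip x z + ip y z"
  by (simp add: ip_def sum.distrib algebra_simps)

lemma ip_diff_left: "ip (\<lambda>i. x i - y i) z = ip x z - ip y z"
  by (simp add: ip_def sum_subtractf algebra_simps)

lemma ip_add_right: "ip z (\<lambda>i. x i + y i) = ip z x + ip z y"
  by (simp add: ip_def sum.distrib algebra_simps)

lemma ip_diff_right: "ip z (\<lambda>i. x i - y i) = ip z x - ip z y"
  by (simp add: ip_def sum_subtractf algebra_simps)

lemma ip_scale_left: "ip (\<lambda>i. c * x i) z = c * ip x z"
  by (simp add: ip_def sum_distrib_left algebra_simps)

lemma ip_scale_right: "ip z (\<lambda>i. c * x i) = cnj c * ip z x"
  by (simp add: ip_def sum_distrib_left algebra_simps)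

lemmas ip_linear = ip_add_left ip_diff_left ip_add_right ip_diff_right
  ip_scale_left ip_scale_right

lemma ip_cong: "(\<And>i. i \<in> I \<Longrightarrow> x i = x' i) \<Longrightarrow> (\<And>i. i \<in> I \<Longrightarrow> y i = y' i) \<Longrightarrow> ip x y = ip x' y'"
  by (simp add: ip_def)

lemma cnj_ip: "cnj (ip x y) = ip y x"
  by (simp add: ip_def mult.commute)

lemma Re_ip_commute: "Re (ip x y) = Re (ip y x)"
  by (subst cnj_ip[symmetric]) simp

lemma ip_self: "ip x x = of_real (sq x)"
  by (simp add: ip_def sq_def complex_norm_square[symmetric])

lemma sq_pos: "\<exists>i\<in>I. x i \<noteq> 0 \<Longrightarrow> 0 < sq x"
  unfolding sq_def using fin by (auto intro: sum_pos2)

lemma ip_unit_right: "k \<in> I \<Longrightarrow> ip x (unit k) = x k"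
  using fin by (simp add: ip_def unit_def if_distrib cong: if_cong)

lemma ip_unit_left: "k \<in> I \<Longrightarrow> ip (unit k) x = cnj (x k)"
  using fin by (simp add: ip_def unit_def if_distrib[of "\<lambda>c. c * _"] cong: if_cong)

lemma mv_unit: "k \<in> I \<Longrightarrow> mv A (unit k) i = A i k"
  using fin by (simp add: mv_def unit_def if_distrib cong: if_cong)

lemma mv_add: "mv A (\<lambda>i. x i + y i) = (\<lambda>i. mv A x i + mv A y i)"
  by (simp add: mv_def sum.distrib algebra_simps)

lemma mv_diff: "mv A (\<lambda>i. x i - y i) = (\<lambda>i. mv A x i - mv A y i)"
  by (simp add: mv_def sum_subtractf algebra_simps)

lemma mv_scale: "mv A (\<lambda>i. c * x i) = (\<lambda>i. c * mv A x i)"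
  by (simp add: mv_def sum_distrib_left algebra_simps)

lemma mv_shift: "i \<in> I \<Longrightarrow> mv (shift d Q) x i = mv Q x i + of_real d * x i"
  using fin by (simp add: mv_def shift_def sum.distrib distrib_right if_distrib[of "\<lambda>c. c * _"] cong: if_cong)

lemma mv_rank1: "mv (rank1 s v Q) x = (\<lambda>i. mv Q x i + of_real s * ip x v * v i)"
  by (simp add: fun_eq_iff mv_def rank1_def ip_def sum.distrib algebra_simps sum_distrib_left)

lemma ip_mv_shift: "ip (mv (shift d Q) x) y = ip (mv Q x) y + of_real d * ip x y"
  by (subst ip_cong[where x' = "\<lambda>i. mv Q x i + of_real d * x i" and y' = y])
    (simp_all add: mv_shift ip_linear)

lemma ip_mv_rank1: "ip (mv (rank1 s v Q) x) y = ip (mv Q x) y + of_real s * ip x v * ip v y"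
  using ip_scale_left[of "of_real s * ip x v" v y] by (simp add: mv_rank1 ip_add_left)

lemma hermD: "herm A \<Longrightarrow> i \<in> I \<Longrightarrow> j \<in> I \<Longrightarrow> A j i = cnj (A i j)"
  unfolding herm_def by blast

lemma herm_shift:
  assumes "herm Q" shows "herm (shift d Q)"
  unfolding herm_def
proof (intro ballI)
  fix i j assume "i \<in> I" "j \<in> I"
  from hermD[OF assms this] show "shift d Q j i = cnj (shift d Q i j)"
    by (simp add: shift_def)
qed

lemma herm_rank1:
  assumes "herm Q" shows "herm (rank1 s v Q)"
  unfolding herm_def
proof (intro ballI)
  fix i j assume "i \<in> I" "j \<in> I"
  from hermD[OF assms this] show "rank1 s v Q j i = cnj (rank1 s v Q i j)"
    by (simp add: rank1_def mult.commute mult.left_commute)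
qed

lemma ip_mv_herm:
  assumes "herm A" shows "ip (mv A x) y = ip x (mv A y)"
proof -
  have "ip (mv A x) y = (\<Sum>i\<in>I. \<Sum>j\<in>I. A i j * x j * cnj (y i))"
    by (simp add: ip_def mv_def sum_distrib_right)
  also have "\<dots> = (\<Sum>j\<in>I. \<Sum>i\<in>I. A i j * x j * cnj (y i))"
    by (rule sum.swap)
  also have "\<dots> = (\<Sum>j\<in>I. \<Sum>i\<in>I. x j * cnj (A j i * y i))"
  proof (intro sum.cong refl)
    fix i j assume "j \<in> I" "i \<in> I"
    from hermD[OF assms this] show "A i j * x j * cnj (y i) = x j * cnj (A j i * y i)"
      by simp
  qed
  also have "\<dots> = ip x (mv A y)"
    by (simp add: ip_def mv_def sum_distrib_left)
  finally show ?thesis .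
qed

lemma pos_defD: "pos_def Q \<Longrightarrow> i \<in> I \<Longrightarrow> x i \<noteq> 0 \<Longrightarrow> 0 < Re (ip (mv Q x) x)"
  unfolding pos_def_def by blast

lemma pos_def_herm: "pos_def Q \<Longrightarrow> herm Q"
  unfolding pos_def_def by blast

lemma pos_def_nonneg:
  assumes "pos_def Q" shows "0 \<le> Re (ip (mv Q x) x)"
proof (cases "\<exists>i\<in>I. x i \<noteq> 0")
  case True
  then show ?thesis using pos_defD[OF assms] less_imp_le by blast
next
  case False
  then have "ip (mv Q x) x = 0" unfolding ip_def by (intro sum.neutral) simp
  then show ?thesis by simp
qed

lemma ip_mv_real: "herm Q \<Longrightarrow> ip (mv Q x) x = of_real (Re (ip (mv Q x) x))"
  by (rule complex_of_real_Re_if_cnj) (simp add: cnj_ip ip_mv_herm)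

lemma pos_def_eq_zero:
  assumes "pos_def Q" "\<And>i. i \<in> I \<Longrightarrow> mv Q x i = 0" "i \<in> I"
  shows "x i = 0"
proof (rule ccontr)
  assume "x i \<noteq> 0"
  then have "0 < Re (ip (mv Q x) x)" by (rule pos_defD[OF assms(1,3)])
  moreover have "ip (mv Q x) x = 0" using assms by (simp add: ip_def)
  ultimately show False by simp
qed

text \<open>The form of \<open>Q\<close> is nonnegative at \<open>x\<close> minus its projection
  onto \<open>y\<close>, taken in the inner product defined by \<open>Q\<close>.\<close>

lemma pos_def_Cauchy_Schwarz:
  assumes "pos_def Q"
  shows "(cmod (ip (mv Q x) y))\<^sup>2 \<le> Re (ip (mv Q x) x) * Re (ip (mv Q y) y)"
proof (cases "\<exists>i\<in>I. y i \<noteq> 0")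
  case False
  then have "ip (mv Q x) y = 0" unfolding ip_def by (intro sum.neutral) simp
  then show ?thesis using pos_def_nonneg[OF assms] by simp
next
  case True
  define b where "b = Re (ip (mv Q y) y)"
  have b: "b > 0" using True pos_defD[OF assms] by (auto simp: b_def)
  note h = pos_def_herm[OF assms(1)]
  define c where "c = ip (mv Q x) y / of_real b"
  have yy: "ip (mv Q y) y = of_real b" unfolding b_def by (rule ip_mv_real[OF h])
  have yx: "ip (mv Q y) x = cnj (ip (mv Q x) y)" by (simp add: cnj_ip ip_mv_herm[OF h])
  have "0 \<le> Re (ip (mv Q (\<lambda>i. x i - c * y i)) (\<lambda>i. x i - c * y i))"
    by (rule pos_def_nonneg[OF assms])
  also have "ip (mv Q (\<lambda>i. x i - c * y i)) (\<lambda>i. x i - c * y i)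
     = ip (mv Q x) x - cnj c * ip (mv Q x) y - c * cnj (ip (mv Q x) y) + c * cnj c * of_real b"
    unfolding mv_diff mv_scale ip_linear yy yx by (simp add: algebra_simps)
  also have "\<dots> = ip (mv Q x) x - of_real ((cmod (ip (mv Q x) y))\<^sup>2 / b)"
  proof -
    define z where "z = ip (mv Q x) y"
    have e1: "complex_of_real ((cmod z)\<^sup>2 / b) = z * cnj z / of_real b"
      unfolding of_real_divide complex_norm_square by simp
    have e2: "cnj c * z = z * cnj z / of_real b" "c * cnj z = z * cnj z / of_real b"
      "c * cnj c * of_real b = z * cnj z / of_real b"
      using b by (simp_all add: c_def z_def)
    show ?thesis unfolding z_def[symmetric] e1 e2 by simp
  qed
  finally have "(cmod (ip (mv Q x) y))\<^sup>2 / b \<le> Re (ip (mv Q x) x)" by simp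
  then show ?thesis using b by (simp add: b_def[symmetric] pos_divide_le_eq)
qed

section \<open>Inverses, rank-one updates and resolvents\<close>

lemma ip_inv_left: "is_inv Q R \<Longrightarrow> ip (mv Q (mv R x)) y = ip x y"
  by (rule ip_cong) (auto simp: is_inv_def)

lemma ip_inv_right: "is_inv Q R \<Longrightarrow> ip y (mv Q (mv R x)) = ip y x"
  by (rule ip_cong) (auto simp: is_inv_def)

lemma ip_inv_herm:
  assumes "pos_def Q" "is_inv Q R" shows "ip (mv R x) y = ip x (mv R y)"
proof -
  note h = pos_def_herm[OF assms(1)]
  have "ip (mv R x) y = ip (mv R x) (mv Q (mv R y))" by (simp add: ip_inv_right[OF assms(2)])
  also have "\<dots> = ip (mv Q (mv R x)) (mv R y)" by (simp add: ip_mv_herm[OF h])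
  finally show ?thesis by (simp add: ip_inv_left[OF assms(2)])
qed

lemma inv_real:
  assumes "pos_def Q" "is_inv Q R" shows "ip (mv R x) x = of_real (Re (ip (mv R x) x))"
  by (rule complex_of_real_Re_if_cnj) (simp add: cnj_ip ip_inv_herm[OF assms])

lemma inv_nonneg:
  assumes "pos_def Q" "is_inv Q R" shows "0 \<le> Re (ip (mv R x) x)"
proof -
  have "ip (mv R x) x = ip (mv Q (mv R x)) (mv R x)"
    by (simp add: ip_inv_left[OF assms(2)] ip_inv_herm[OF assms])
  then show ?thesis using pos_def_nonneg[OF assms(1)] by simp
qed

lemma mv_inv_pos:
  assumes "is_inv Q R" "\<exists>i\<in>I. x i \<noteq> 0" shows "0 < sq (mv R x)"
proof (rule ccontr)
  assume "\<not> 0 < sq (mv R x)"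
  then have "\<And>i. i \<in> I \<Longrightarrow> mv R x i = 0" using sq_pos by blast
  then have "mv Q (mv R x) i = 0" for i unfolding mv_def[of Q] by simp
  then show False using assms unfolding is_inv_def by metis
qed

text \<open>A dimension count: the columns are independent because the form is positive, there are
  \<open>card I\<close> of them, and they lie in the span of as many unit vectors, so they span
  every unit vector. Columns are cut off to zero outside \<open>I\<close>, which makes them
  determined by their entries in \<open>I\<close> and lets the linear algebra of \<open>cfun\<close>
  apply.\<close>

lemma pos_def_inverse_exists:
  assumes "pos_def Q" shows "\<exists>R. is_inv Q R"
proof -
  define col where "col j = (\<lambda>i. if i \<in> I then Q i j else 0)" for j
  have comb: "(\<Sum>j\<in>I. cscale (x j) (col j)) = (\<lambda>i. if i \<in> I then mv Q x i else 0)" for x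
    by (rule ext) (simp add: cscale_def col_def mv_def sum_apply_fun mult.commute)
  have zero: "\<forall>j\<in>I. x j = 0" if "(\<Sum>j\<in>I. cscale (x j) (col j)) = 0" for x
  proof -
    have "mv Q x i = 0" if "i \<in> I" for i
      using fun_cong[OF \<open>(\<Sum>j\<in>I. cscale (x j) (col j)) = 0\<close>, of i] that unfolding comb by simp
    then show ?thesis using pos_def_eq_zero[OF assms] by blast
  qed
  have inj: "inj_on col I"
  proof (rule inj_onI, rule ccontr)
    fix j k assume jk: "j \<in> I" "k \<in> I" "col j = col k" "j \<noteq> k"
    define x where "x = (\<lambda>i. if i = j then 1 else if i = k then - 1 else 0 :: complex)"
    have "(\<Sum>i\<in>I. cscale (x i) (col i)) = (\<Sum>i\<in>{j,k}. cscale (x i) (col i))"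
      using jk(1,2) fin by (intro sum.mono_neutral_right) (auto simp: x_def cscale_def fun_eq_iff)
    also have "\<dots> = 0" using jk(3,4) by (simp add: x_def cscale_def fun_eq_iff)
    finally have "x j = 0" using zero jk by blast
    then show False by (simp add: x_def)
  qed
  have indep: "\<not> cfun.dependent (col ` I)"
  proof
    assume "cfun.dependent (col ` I)"
    then obtain u v where uv: "v \<in> col ` I" "u v \<noteq> 0" "(\<Sum>v\<in>col ` I. cscale (u v) v) = 0"
      using fin by (auto simp: cfun.dependent_finite)
    then have "(\<Sum>j\<in>I. cscale (u (col j)) (col j)) = 0"
      using inj by (simp add: sum.reindex)
    from zero[OF this] uv show False by auto
  qed
  define Ub where "Ub = unit ` I"
  have Ubcard: "card Ub \<le> card I" "finite Ub" unfolding Ub_def using fin by (auto intro: card_image_le)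
  have inUb: "f \<in> cfun.span Ub" if "\<And>i. i \<notin> I \<Longrightarrow> f i = 0" for f
  proof -
    have "f = (\<Sum>j\<in>I. cscale (f j) (unit j))"
    proof
      fix i
      show "f i = (\<Sum>j\<in>I. cscale (f j) (unit j)) i"
        using that[of i] fin
        by (cases "i \<in> I") (simp_all add: sum_apply_fun cscale_def unit_def if_distrib[of "\<lambda>c. _ * c"] cong: if_cong)
    qed
    moreover have "(\<Sum>j\<in>I. cscale (f j) (unit j)) \<in> cfun.span Ub"
      by (intro cfun.span_sum cfun.span_scale cfun.span_base) (auto simp: Ub_def)
    ultimately show ?thesis by simp
  qed
  have sp: "unit k \<in> cfun.span (col ` I)" if "k \<in> I" for k
  proof (rule ccontr)
    assume n: "unit k \<notin> cfun.span (col ` I)"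
    then have "\<not> cfun.dependent (insert (unit k) (col ` I))"
      using indep by (simp add: cfun.independent_insert)
    moreover have "insert (unit k) (col ` I) \<subseteq> cfun.span Ub"
      using that by (auto intro!: inUb simp: col_def unit_def)
    ultimately have "card (insert (unit k) (col ` I)) \<le> card Ub"
      using cfun.independent_span_bound[OF Ubcard(2)] by blast
    moreover have "unit k \<notin> col ` I" using n cfun.span_base by blast
    ultimately show False using fin Ubcard(1) inj by (simp add: card_image)
  qed
  have "\<exists>r. \<forall>i\<in>I. mv Q r i = unit k i" if "k \<in> I" for k
  proof -
    have "unit k \<in> cfun.span (col ` I)" using sp that .
    then obtain u where "unit k = (\<Sum>v\<in>col ` I. cscale (u v) v)"
      using fin by (auto simp: cfun.span_finite)
    also have "\<dots> = (\<Sum>j\<in>I. cscale (u (col j)) (col j))" using inj by (simp add: sum.reindex)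
    finally have *: "unit k = (\<lambda>i. if i \<in> I then mv Q (\<lambda>j. u (col j)) i else 0)"
      unfolding comb[of "\<lambda>j. u (col j)"] .
    have "\<forall>i\<in>I. mv Q (\<lambda>j. u (col j)) i = unit k i" unfolding * by simp
    then show ?thesis by blast
  qed
  then have "\<forall>k\<in>I. \<exists>r. \<forall>i\<in>I. mv Q r i = unit k i" by blast
  from bchoice[OF this] obtain r where r: "\<And>k i. k \<in> I \<Longrightarrow> i \<in> I \<Longrightarrow> mv Q (r k) i = unit k i" by blast
  have "is_inv Q (\<lambda>i k. r k i)"
    unfolding is_inv_def
  proof (intro allI ballI)
    fix x i assume i: "i \<in> I"
    have "mv Q (mv (\<lambda>i k. r k i) x) i = (\<Sum>j\<in>I. \<Sum>k\<in>I. Q i j * (r k j * x k))"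
      by (simp add: mv_def sum_distrib_left)
    also have "\<dots> = (\<Sum>k\<in>I. \<Sum>j\<in>I. Q i j * (r k j * x k))" by (rule sum.swap)
    also have "\<dots> = (\<Sum>k\<in>I. mv Q (r k) i * x k)"
      by (simp add: mv_def sum_distrib_right mult.assoc)
    also have "\<dots> = (\<Sum>k\<in>I. unit k i * x k)" using r i by simp
    also have "\<dots> = x i" using i fin by (simp add: unit_def if_distrib[of "\<lambda>c. c * _"] cong: if_cong)
    finally show "mv Q (mv (\<lambda>i k. r k i) x) i = x i" .
  qed
  then show ?thesis by blast
qed


lemma is_inv_herm:
  assumes "pos_def Q" "is_inv Q R" shows "herm R"
  unfolding herm_def
proof (intro ballI)
  fix i j assume ij: "i \<in> I" "j \<in> I"
  have "R j i = ip (mv R (unit i)) (unit j)" using ij by (simp add: ip_unit_right mv_unit)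
  also have "\<dots> = ip (unit i) (mv R (unit j))" by (rule ip_inv_herm[OF assms])
  also have "\<dots> = cnj (R i j)" using ij by (simp add: ip_unit_left mv_unit)
  finally show "R j i = cnj (R i j)" .
qed

lemma wtr_rank1: "wtr g (rank1 c w R) = wtr g R + c * (\<Sum>k\<in>I. g k * (cmod (w k))\<^sup>2)"
proof -
  have "Re (rank1 c w R k k) = Re (R k k) + c * (cmod (w k))\<^sup>2" for k
    unfolding rank1_def cmod_power2 by (simp add: algebra_simps power2_eq_square)
  then show ?thesis
    by (simp add: wtr_def algebra_simps sum.distrib sum_distrib_left)
qed

lemma wtr_unit: "wtr g R = (\<Sum>k\<in>I. g k * Re (ip (mv R (unit k)) (unit k)))"
  unfolding wtr_def by (intro sum.cong refl) (simp add: ip_unit_right mv_unit)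

lemma Re_ip_mv_rank1: "Re (ip (mv (rank1 s v Q) x) x) = Re (ip (mv Q x) x) + s * (cmod (ip x v))\<^sup>2"
proof -
  have "complex_of_real s * ip x v * ip v x = of_real (s * (cmod (ip x v))\<^sup>2)"
    unfolding of_real_mult complex_norm_square cnj_ip by simp
  then show ?thesis by (simp only: ip_mv_rank1 plus_complex.sel Re_complex_of_real)
qed

text \<open>For negative \<open>s\<close> positivity is the point at issue. Cauchy-Schwarz for the
  form of \<open>Q\<close> at \<open>x\<close> and \<open>mv R v\<close> bounds the squared modulus
  of \<open>ip x v\<close> by the form at \<open>x\<close> times b, where b is the form of
  \<open>R\<close> at \<open>v\<close>; so the updated form is at least 1 + s b times the old
  one.\<close>

lemma Sherman_Morrison:
  assumes Q: "pos_def Q" "is_inv Q R" and s: "0 < 1 + s * Re (ip (mv R v) v)"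
  shows "pos_def (rank1 s v Q)"
    and "is_inv (rank1 s v Q) (rank1 (- (s / (1 + s * Re (ip (mv R v) v)))) (mv R v) R)"
proof -
  define b where "b = Re (ip (mv R v) v)"
  define w where "w = mv R v"
  have wv: "ip w v = of_real b" unfolding b_def w_def by (rule inv_real[OF Q])
  have ipxw: "ip (mv R x) v = ip x w" for x unfolding w_def by (rule ip_inv_herm[OF Q])
  show "pos_def (rank1 s v Q)"
    unfolding pos_def_def
  proof (intro conjI allI impI)
    show "herm (rank1 s v Q)" using Q(1) by (simp add: herm_rank1 pos_def_herm)
    fix x :: "'i \<Rightarrow> complex" assume "\<exists>i\<in>I. x i \<noteq> 0"
    then have pos: "0 < Re (ip (mv Q x) x)" using pos_defD[OF Q(1)] by blast
    have xv: "ip x v = ip (mv Q x) w"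
      unfolding w_def ip_mv_herm[OF pos_def_herm[OF Q(1)]] by (simp add: ip_inv_right[OF Q(2)])
    have "ip (mv Q w) w = cnj (ip w v)" unfolding w_def by (simp add: ip_inv_left[OF Q(2)] cnj_ip)
    then have "(cmod (ip x v))\<^sup>2 \<le> Re (ip (mv Q x) x) * b"
      using pos_def_Cauchy_Schwarz[OF Q(1), of x w] unfolding xv wv by simp
    moreover have "0 < Re (ip (mv Q x) x) + s * (cmod (ip x v))\<^sup>2"
    proof (cases "s \<ge> 0")
      case True then show ?thesis using pos by (intro add_pos_nonneg) auto
    next
      case False
      then have "s * (Re (ip (mv Q x) x) * b) \<le> s * (cmod (ip x v))\<^sup>2"
        using calculation(1) by (intro mult_left_mono_neg) auto
      moreover have "0 < Re (ip (mv Q x) x) * (1 + s * b)"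
        using pos s by (simp add: b_def)
      ultimately show ?thesis by (simp add: algebra_simps)
    qed
    ultimately show "0 < Re (ip (mv (rank1 s v Q) x) x)" unfolding Re_ip_mv_rank1 by simp
  qed
  \<comment> \<open>Solves c + s (1 + c b) = 0, the condition under which the multiples of
    \<open>v\<close> cancel in the product.\<close>
  define c where "c = - (s / (1 + s * b))"
  have c: "c + s * (1 + c * b) = 0"
    using s unfolding c_def b_def[symmetric] by (simp add: field_simps)
  have "is_inv (rank1 s v Q) (rank1 c w R)"
    unfolding is_inv_def
  proof (intro allI ballI)
    fix x i assume i: "i \<in> I"
    define z where "z = ip x w"
    have "mv (rank1 s v Q) (mv (rank1 c w R) x) i
       = mv Q (\<lambda>i. mv R x i + of_real c * z * w i) i
         + of_real s * ip (\<lambda>i. mv R x i + of_real c * z * w i) v * v i"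
      by (simp only: mv_rank1 z_def)
    also have "mv Q (\<lambda>i. mv R x i + of_real c * z * w i) i = x i + of_real c * z * v i"
      unfolding mv_add mv_scale using Q(2) i unfolding is_inv_def w_def by simp
    also have "ip (\<lambda>i. mv R x i + of_real c * z * w i) v = z + of_real c * z * of_real b"
      unfolding ip_linear ipxw wv z_def ..
    also have "x i + of_real c * z * v i + of_real s * (z + of_real c * z * of_real b) * v i
      = x i + of_real (c + s * (1 + c * b)) * (z * v i)"
      by (simp add: algebra_simps)
    finally show "mv (rank1 s v Q) (mv (rank1 c w R) x) i = x i" by (simp add: c)
  qed
  then show "is_inv (rank1 s v Q) (rank1 (- (s / (1 + s * Re (ip (mv R v) v)))) (mv R v) R)"
    unfolding c_def w_def b_def .
qed

text \<open>The shift is assumed as an identity of forms, not as an equation between matrices, so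
  that the two matrices can be used in either order: the upper barrier goes from \<open>Q\<close> to
  Q + d, the lower one is compared from Q - d back to \<open>Q\<close>.\<close>

lemma resolvent_identity:
  assumes Q: "pos_def Q" "is_inv Q R" and Q': "pos_def Q'" "is_inv Q' R'"
    and sh: "\<And>x y. ip (mv Q' x) y = ip (mv Q x) y + of_real d * ip x y"
  shows "ip (mv R x) y = ip (mv R' x) y + of_real d * ip (mv R' x) (mv R y)"
proof -
  have "ip (mv R' x) y = ip (mv R' x) (mv Q (mv R y))" by (simp add: ip_inv_right[OF Q(2)])
  also have "\<dots> = ip (mv Q (mv R' x)) (mv R y)" by (simp add: ip_mv_herm[OF pos_def_herm[OF Q(1)]])
  also have "\<dots> = ip (mv Q' (mv R' x)) (mv R y) - of_real d * ip (mv R' x) (mv R y)"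
    by (simp add: sh)
  also have "\<dots> = ip (mv R x) y - of_real d * ip (mv R' x) (mv R y)"
    by (simp add: ip_inv_left[OF Q'(2)] ip_inv_herm[OF Q])
  finally show ?thesis by simp
qed

text \<open>Using the resolvent identity twice gives R - R' = d R'^2 + d^2 R' R R'. The last summand
  is nonnegative, so the first one already bounds from below the effect of a positive shift on the
  potential.\<close>

lemma resolvent_difference:
  assumes Q: "pos_def Q" "is_inv Q R" and Q': "pos_def Q'" "is_inv Q' R'"
    and sh: "\<And>x y. ip (mv Q' x) y = ip (mv Q x) y + of_real d * ip x y"
  shows "Re (ip (mv R x) x) - Re (ip (mv R' x) x)
      = d * sq (mv R' x) + d\<^sup>2 * Re (ip (mv R (mv R' x)) (mv R' x))"
proof -
  define t where "t = Re (ip (mv R (mv R' x)) (mv R' x))"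
  have "ip (mv R x) (mv R' x) = of_real (sq (mv R' x)) + of_real d * ip (mv R' x) (mv R (mv R' x))"
    using resolvent_identity[OF assms, of x "mv R' x"] by (simp add: ip_self)
  also have "ip (mv R' x) (mv R (mv R' x)) = of_real t"
    unfolding t_def inv_real[OF Q, symmetric] by (rule ip_inv_herm[OF Q, symmetric])
  finally have "ip (mv R' x) (mv R x) = of_real (sq (mv R' x) + d * t)"
    by (subst cnj_ip[symmetric]) simp
  then have "ip (mv R x) x - ip (mv R' x) x = of_real (d * sq (mv R' x) + d\<^sup>2 * t)"
    using resolvent_identity[OF assms, of x x] by (simp add: algebra_simps power2_eq_square)
  then have "Re (ip (mv R x) x - ip (mv R' x) x) = d * sq (mv R' x) + d\<^sup>2 * t"
    by (simp only: Re_complex_of_real)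
  then show ?thesis unfolding t_def by simp
qed


subsection \<open>The barrier steps of Batson, Spielman and Srivastava\<close>

lemma pos_def_shift:
  assumes "pos_def Q" "0 < d" shows "pos_def (shift d Q)"
  unfolding pos_def_def
proof (intro conjI allI impI)
  show "herm (shift d Q)" using assms by (simp add: herm_shift pos_def_herm)
  fix x :: "'i \<Rightarrow> complex" assume *: "\<exists>i\<in>I. x i \<noteq> 0"
  have "0 < Re (ip (mv Q x) x) + d * sq x"
    using sq_pos[OF *] pos_def_nonneg[OF assms(1), of x] assms(2) by (simp add: add_nonneg_pos)
  then show "0 < Re (ip (mv (shift d Q) x) x)" by (simp add: ip_mv_shift ip_self)
qed

lemma sq_mv_unit: "k \<in> I \<Longrightarrow> sq (mv R (unit k)) = (\<Sum>i\<in>I. (cmod (R i k))\<^sup>2)"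
  by (simp add: sq_def mv_unit)

text \<open>Think of \<open>Q\<close> as the gap between an upper barrier and the accumulated
  matrix. Raising the barrier by \<open>d\<close> lowers the potential by \<open>D\<close>;
  subtracting s v v* raises it by s K / (1 - s b), where b is the form of \<open>R'\<close> at
  \<open>v\<close> and K the weighted square sum of \<open>mv R' v\<close>. The step is affordable
  once s (b + K / D) <= 1. The third claim bounds the mean of K / D when \<open>v\<close> has
  covariance diag g.\<close>

lemma upper_barrier:
  assumes Q: "pos_def Q" "is_inv Q R" and R': "is_inv (shift d Q) R'" and d: "0 < d"
    and weights: "\<forall>k\<in>I. 0 \<le> g k \<and> g k \<le> 1"
  defines "D \<equiv> wtr g R - wtr g R'"
  defines "T \<equiv> (\<Sum>k\<in>I. g k * (\<Sum>j\<in>I. (cmod (R' k j))\<^sup>2))"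
  shows "0 \<le> D" and "d * T \<le> D"
    and "(\<Sum>k\<in>I. \<Sum>j\<in>I. g k * g j * (cmod (R' k j))\<^sup>2) / D \<le> 1 / d"
    and "\<And>v s. 0 < s \<Longrightarrow> s * (Re (ip (mv R' v) v) + (\<Sum>k\<in>I. g k * (cmod (mv R' v k))\<^sup>2) / D) < 1 \<Longrightarrow>
      \<exists>R''. pos_def (rank1 (- s) v (shift d Q)) \<and> is_inv (rank1 (- s) v (shift d Q)) R'' \<and> wtr g R'' \<le> wtr g R"
proof -
  have g: "0 \<le> g k" and g1: "g k \<le> 1" if "k \<in> I" for k using weights that by auto
  note Q' = pos_def_shift[OF Q(1) d] R'
  have hR': "herm R'" by (rule is_inv_herm[OF Q'])
  have swp: "cmod (R' i k) = cmod (R' k i)" if "i \<in> I" "k \<in> I" for i k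
    using hermD[OF hR' that] by simp
  have T0: "0 \<le> T" unfolding T_def using g by (intro sum_nonneg mult_nonneg_nonneg) auto
  have "d * T = (\<Sum>k\<in>I. g k * (d * sq (mv R' (unit k))))"
    unfolding T_def sum_distrib_left
    by (intro sum.cong refl) (simp add: sq_mv_unit sum_distrib_left swp algebra_simps)
  also have "\<dots> \<le> (\<Sum>k\<in>I. g k * (Re (ip (mv R (unit k)) (unit k)) - Re (ip (mv R' (unit k)) (unit k))))"
  proof (intro sum_mono mult_left_mono g)
    fix k
    have "0 \<le> d\<^sup>2 * Re (ip (mv R (mv R' (unit k))) (mv R' (unit k)))"
      using inv_nonneg[OF Q] by simp
    then show "d * sq (mv R' (unit k)) \<le> Re (ip (mv R (unit k)) (unit k)) - Re (ip (mv R' (unit k)) (unit k))"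
      using resolvent_difference[OF Q Q' ip_mv_shift, of "unit k"] by linarith
  qed
  also have "\<dots> = D"
    unfolding D_def wtr_unit by (simp add: right_diff_distrib sum_subtractf)
  finally show dT: "d * T \<le> D" .
  show D0: "0 \<le> D" using T0 d dT by (meson mult_nonneg_nonneg less_imp_le order_trans)
  show "(\<Sum>k\<in>I. \<Sum>j\<in>I. g k * g j * (cmod (R' k j))\<^sup>2) / D \<le> 1 / d"
  proof (cases "D = 0")
    case False
    \<comment> \<open>Here it enters that the covariance is a contraction: dropping the factor
      \<open>g j\<close> turns the mean of K into \<open>T\<close>.\<close>
    have "(\<Sum>k\<in>I. \<Sum>j\<in>I. g k * g j * (cmod (R' k j))\<^sup>2) \<le> (\<Sum>k\<in>I. \<Sum>j\<in>I. g k * (cmod (R' k j))\<^sup>2)"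
      using g g1 by (intro sum_mono mult_right_mono) (auto intro: mult_left_le)
    also have "\<dots> = T" by (simp add: T_def sum_distrib_left)
    also have "\<dots> \<le> D / d" using dT d by (simp add: pos_le_divide_eq mult.commute)
    finally show ?thesis using D0 False d by (simp add: divide_simps mult.commute)
  qed (use d in simp)
  fix v :: "'i \<Rightarrow> complex" and s :: real
  define b where "b = Re (ip (mv R' v) v)"
  define K where "K = (\<Sum>k\<in>I. g k * (cmod (mv R' v k))\<^sup>2)"
  assume s: "0 < s" and "s * (Re (ip (mv R' v) v) + (\<Sum>k\<in>I. g k * (cmod (mv R' v k))\<^sup>2) / D) < 1"
  then have lt: "s * (b + K / D) < 1" by (simp add: b_def K_def)
  have K0: "0 \<le> K" unfolding K_def using g by (intro sum_nonneg) auto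
  have "s * b \<le> s * (b + K / D)" using s K0 D0 by simp
  then have pos: "0 < 1 + (- s) * b" using lt by simp
  have SM: "pos_def (rank1 (- s) v (shift d Q))"
    "is_inv (rank1 (- s) v (shift d Q)) (rank1 (- ((- s) / (1 + (- s) * b))) (mv R' v) R')"
    using Sherman_Morrison[OF Q' pos[unfolded b_def]] by (simp_all add: b_def)
  have "s / (1 - s * b) * K \<le> D"
  proof (cases "D = 0")
    \<comment> \<open>With \<open>D = 0\<close> the quotient K / D is 0 by convention and the
      hypothesis says nothing about K. But then \<open>T = 0\<close>, so every row of
      \<open>R'\<close> vanishes or has weight zero, and K is 0 as well.\<close>
    case True
    then have "d * T \<le> 0" using dT by simp
    then have "T = 0" using d T0 by (simp add: mult_le_0_iff)
    moreover have "0 \<le> g k * (\<Sum>j\<in>I. (cmod (R' k j))\<^sup>2)" if "k \<in> I" for k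
      using g[OF that] by (intro mult_nonneg_nonneg sum_nonneg) auto
    ultimately have z: "g k * (\<Sum>j\<in>I. (cmod (R' k j))\<^sup>2) = 0" if "k \<in> I" for k
      unfolding T_def using fin that by (subst (asm) sum_nonneg_eq_0_iff) auto
    have "g k * (cmod (mv R' v k))\<^sup>2 \<le> 0" if k: "k \<in> I" for k
    proof -
      have "(cmod (mv R' v k))\<^sup>2 \<le> (\<Sum>j\<in>I. (cmod (R' k j))\<^sup>2) * sq v"
        unfolding mv_def sq_def by (rule cmod_sum_mult_squared_le)
      then have "g k * (cmod (mv R' v k))\<^sup>2 \<le> g k * ((\<Sum>j\<in>I. (cmod (R' k j))\<^sup>2) * sq v)"
        using g[OF k] by (rule mult_left_mono)
      also have "\<dots> = 0" using z[OF k] by (simp add: mult.assoc[symmetric])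
      finally show ?thesis .
    qed
    then have "K \<le> 0" unfolding K_def by (rule sum_nonpos)
    then show ?thesis using K0 True by simp
  next
    case False
    then have D: "0 < D" using D0 by simp
    have "s * K \<le> D * (1 - s * b)"
      using lt D by (simp add: field_simps)
    then show ?thesis using pos by (simp add: pos_divide_le_eq)
  qed
  then have "wtr g (rank1 (- ((- s) / (1 + (- s) * b))) (mv R' v) R') \<le> wtr g R"
    unfolding wtr_rank1 K_def[symmetric] D_def by simp
  then show "\<exists>R''. pos_def (rank1 (- s) v (shift d Q)) \<and> is_inv (rank1 (- s) v (shift d Q)) R'' \<and> wtr g R'' \<le> wtr g R"
    using SM by blast
qed

text \<open>The trace of \<open>R\<close> dominates the inverse of the least eigenvalue of
  \<open>Q\<close>. Without eigenvalues: x_k is the product of \<open>x\<close> and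
  \<open>mv R (unit k)\<close> in the form of \<open>Q\<close>, so Cauchy-Schwarz gives |x_k|^2 <=
  <Q x, x> R_kk, and summation over k gives |x|^2 <= <Q x, x> tr R.\<close>

lemma lower_barrier_pos_def:
  assumes Q: "pos_def Q" "is_inv Q R" and d: "d * wtr (\<lambda>_. 1) R < 1" "0 \<le> d"
  shows "pos_def (shift (- d) Q)"
  unfolding pos_def_def
proof (intro conjI allI impI)
  show "herm (shift (- d) Q)" using Q by (simp add: herm_shift pos_def_herm)
  fix x :: "'i \<Rightarrow> complex" assume "\<exists>i\<in>I. x i \<noteq> 0"
  then have pos: "0 < Re (ip (mv Q x) x)" using pos_defD[OF Q(1)] by blast
  define q where "q = Re (ip (mv Q x) x)"
  have *: "(cmod (x k))\<^sup>2 \<le> q * Re (ip (mv R (unit k)) (unit k))" if "k \<in> I" for k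
  proof -
    have "x k = ip (mv Q x) (mv R (unit k))"
      unfolding ip_mv_herm[OF pos_def_herm[OF Q(1)]] ip_inv_right[OF Q(2)]
      using that by (simp add: ip_unit_right)
    moreover have "Re (ip (mv Q (mv R (unit k))) (mv R (unit k))) = Re (ip (mv R (unit k)) (unit k))"
      by (simp add: ip_inv_left[OF Q(2)] ip_inv_herm[OF Q])
    ultimately show ?thesis
      using pos_def_Cauchy_Schwarz[OF Q(1), of x "mv R (unit k)"] by (simp add: q_def)
  qed
  have "sq x \<le> (\<Sum>k\<in>I. q * Re (ip (mv R (unit k)) (unit k)))"
    unfolding sq_def by (intro sum_mono *)
  also have "\<dots> = q * wtr (\<lambda>_. 1) R" by (simp add: wtr_unit sum_distrib_left)
  finally have "d * sq x \<le> d * (q * wtr (\<lambda>_. 1) R)" using d(2) by (rule mult_left_mono)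
  also have "\<dots> = q * (d * wtr (\<lambda>_. 1) R)" by simp
  also have "\<dots> < q * 1" using d pos by (intro mult_strict_left_mono) (auto simp: q_def)
  finally show "0 < Re (ip (mv (shift (- d) Q) x) x)" by (simp add: ip_mv_shift ip_self q_def)
qed

text \<open>Now \<open>Q\<close> is the gap above a lower barrier, which rises by \<open>d\<close>.
  This costs \<open>D\<close> in potential, and adding s v v* regains s |R' v|^2 / (1 + s b), with b
  the form of \<open>R'\<close> at \<open>v\<close>. The regain suffices exactly if 1 / s <= |R'
  v|^2 / D - b. The second claim bounds the mean of the right-hand side over isotropic
  \<open>v\<close> from below by a quantity that involves only the old potential.\<close>

lemma lower_barrier:
  assumes Q: "pos_def Q" "is_inv Q R" and R': "is_inv (shift (- d) Q) R'"
    and d: "0 < d" "d * wtr (\<lambda>_. 1) R < 1" and ne: "I \<noteq> {}"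
  defines "D \<equiv> wtr (\<lambda>_. 1) R' - wtr (\<lambda>_. 1) R"
  shows "0 < D"
    and "1 / d - wtr (\<lambda>_. 1) R \<le> (\<Sum>k\<in>I. \<Sum>j\<in>I. (cmod (R' k j))\<^sup>2) / D - wtr (\<lambda>_. 1) R'"
    and "\<And>v s. 0 < s \<Longrightarrow> 1 / s \<le> sq (mv R' v) / D - Re (ip (mv R' v) v) \<Longrightarrow>
      \<exists>R''. pos_def (rank1 s v (shift (- d) Q)) \<and> is_inv (rank1 s v (shift (- d) Q)) R''
        \<and> wtr (\<lambda>_. 1) R'' \<le> wtr (\<lambda>_. 1) R"
proof -
  have Q': "pos_def (shift (- d) Q)" "is_inv (shift (- d) Q) R'"
    using lower_barrier_pos_def[OF Q d(2)] d(1) R' by auto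
  have sh: "ip (mv Q x) y = ip (mv (shift (- d) Q) x) y + of_real d * ip x y" for x y
    by (simp add: ip_mv_shift)
  \<comment> \<open>In trace notation T1 = tr (R R'), T2 = tr (R'^2), T3 = tr (R' R R'). The
    resolvent identity gives D = d T1 and T2 = T1 + d T3; what is wanted, T2 / D >= 1 / d + D,
    thereby reduces to d T1^2 <= T3.\<close>
  define T1 where "T1 = (\<Sum>k\<in>I. Re (ip (mv R' (unit k)) (mv R (unit k))))"
  define T2 where "T2 = (\<Sum>k\<in>I. sq (mv R' (unit k)))"
  define T3 where "T3 = (\<Sum>k\<in>I. Re (ip (mv R (mv R' (unit k))) (mv R' (unit k))))"
  define P where "P = wtr (\<lambda>_. 1) R"
  have res: "ip (mv R' x) y = ip (mv R x) y + of_real d * ip (mv R x) (mv R' y)" for x y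
    by (rule resolvent_identity[OF Q' Q sh])
  have D1: "D = d * T1"
  proof -
    have "Re (ip (mv R' x) x) = Re (ip (mv R x) x) + d * Re (ip (mv R' x) (mv R x))" for x
      using res[of x x] Re_ip_commute[of "mv R x"] by simp
    then show ?thesis
      unfolding D_def wtr_unit T1_def by (simp add: sum.distrib sum_distrib_left)
  qed
  show D: "0 < D"
  proof -
    have "0 < (\<Sum>k\<in>I. d * sq (mv R (unit k)))"
    proof (rule sum_pos[OF fin ne])
      fix k assume "k \<in> I"
      then have "0 < sq (mv R (unit k))" by (intro mv_inv_pos[OF Q(2)]) (auto simp: unit_def)
      then show "0 < d * sq (mv R (unit k))" using d by simp
    qed
    also have "\<dots> \<le> (\<Sum>k\<in>I. Re (ip (mv R' (unit k)) (unit k)) - Re (ip (mv R (unit k)) (unit k)))"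
    proof (intro sum_mono)
      fix k
      have "0 \<le> d\<^sup>2 * Re (ip (mv R' (mv R (unit k))) (mv R (unit k)))"
        using inv_nonneg[OF Q'] by simp
      then show "d * sq (mv R (unit k)) \<le> Re (ip (mv R' (unit k)) (unit k)) - Re (ip (mv R (unit k)) (unit k))"
        using resolvent_difference[OF Q' Q sh, of "unit k"] by linarith
    qed
    also have "\<dots> = D" by (simp add: D_def wtr_unit sum_subtractf)
    finally show ?thesis .
  qed
  have T12: "T2 = T1 + d * T3"
  proof -
    have "sq (mv R' x) = Re (ip (mv R' x) (mv R x)) + d * Re (ip (mv R (mv R' x)) (mv R' x))" for x
    proof -
      have "ip (mv R' x) (mv R' x) = ip x (mv R' (mv R' x))" by (simp add: ip_inv_herm[OF Q'])
      also have "\<dots> = cnj (ip (mv R' (mv R' x)) x)" by (simp add: cnj_ip)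
      also have "ip (mv R' (mv R' x)) x = ip (mv R (mv R' x)) x + of_real d * ip (mv R (mv R' x)) (mv R' x)"
        by (rule res)
      also have "ip (mv R (mv R' x)) x = ip (mv R' x) (mv R x)" by (rule ip_inv_herm[OF Q])
      finally have "Re (ip (mv R' x) (mv R' x)) = Re (ip (mv R' x) (mv R x)) + d * Re (ip (mv R (mv R' x)) (mv R' x))"
        by simp
      then show ?thesis by (simp add: ip_self)
    qed
    then show ?thesis by (simp add: T1_def T2_def T3_def sum.distrib sum_distrib_left)
  qed
  \<comment> \<open>Cauchy-Schwarz for traces, T1^2 <= P T3, kept as a nonnegative quadratic in
    \<open>t\<close> so that nothing is divided by \<open>P\<close>. The choice t = d T1 together
    with d P < 1 then yields d T1^2 <= T3.\<close>
  have CS: "0 \<le> T3 - 2 * t * T1 + t\<^sup>2 * P" for t :: real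
  proof -
    have "Re (ip (mv R (\<lambda>i. y i - of_real t * x i)) (\<lambda>i. y i - of_real t * x i))
      = Re (ip (mv R y) y) - 2 * t * Re (ip y (mv R x)) + t\<^sup>2 * Re (ip (mv R x) x)" for x y
    proof -
      have "Re (ip (mv R y) x) = Re (ip y (mv R x))" "Re (ip (mv R x) y) = Re (ip y (mv R x))"
        using ip_inv_herm[OF Q, of y x] Re_ip_commute[of "mv R x" y] by simp_all
      then show ?thesis
        unfolding mv_diff mv_scale ip_linear by (simp add: algebra_simps power2_eq_square)
    qed
    from this[of "mv R' (unit _)" "unit _"]
    have "T3 - 2 * t * T1 + t\<^sup>2 * P = (\<Sum>k\<in>I. Re (ip (mv R (\<lambda>i. mv R' (unit k) i - of_real t * unit k i))
        (\<lambda>i. mv R' (unit k) i - of_real t * unit k i)))"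
      by (simp add: T3_def T1_def P_def wtr_unit sum.distrib sum_subtractf sum_distrib_left)
    also have "\<dots> \<ge> 0" by (intro sum_nonneg inv_nonneg[OF Q])
    finally show ?thesis .
  qed
  have P0: "0 \<le> P" unfolding P_def wtr_unit by (intro sum_nonneg) (simp add: inv_nonneg[OF Q])
  have T3: "d * T1\<^sup>2 \<le> T3"
  proof -
    have "(d * T1)\<^sup>2 * P = d * T1\<^sup>2 * (d * P)" by (simp add: power2_eq_square)
    also have "\<dots> \<le> d * T1\<^sup>2 * 1" using d by (intro mult_left_mono) (auto simp: P_def)
    finally show ?thesis using CS[of "d * T1"] by (simp add: power2_eq_square)
  qed
  have T2: "T2 = (\<Sum>k\<in>I. \<Sum>j\<in>I. (cmod (R' k j))\<^sup>2)"
    unfolding T2_def by (subst sum.swap) (simp add: sq_mv_unit)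
  moreover have "1 / d + D \<le> T2 / D"
  proof -
    have "(1 / d + D) * D = T1 + d * (d * T1\<^sup>2)" unfolding D1 using d by (simp add: field_simps power2_eq_square)
    also have "\<dots> \<le> T2" unfolding T12 using T3 d by simp
    finally show ?thesis using D by (simp add: pos_le_divide_eq)
  qed
  moreover have "D = wtr (\<lambda>_. 1) R' - wtr (\<lambda>_. 1) R" by (simp only: D_def)
  ultimately show "1 / d - wtr (\<lambda>_. 1) R \<le> (\<Sum>k\<in>I. \<Sum>j\<in>I. (cmod (R' k j))\<^sup>2) / D - wtr (\<lambda>_. 1) R'"
    unfolding T2[symmetric] by linarith
  fix v :: "'i \<Rightarrow> complex" and s :: real
  define b where "b = Re (ip (mv R' v) v)"
  assume s: "0 < s" and "1 / s \<le> sq (mv R' v) / D - Re (ip (mv R' v) v)"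
  then have le: "1 / s \<le> sq (mv R' v) / D - b" by (simp add: b_def)
  have b0: "0 \<le> b" unfolding b_def by (rule inv_nonneg[OF Q'])
  have pos: "0 < 1 + s * b" using s b0 by (simp add: add_pos_nonneg)
  note SM = Sherman_Morrison[OF Q' pos[unfolded b_def], folded b_def]
  have "D * (1 + s * b) \<le> s * sq (mv R' v)"
    using le s D by (simp add: field_simps)
  then have "D \<le> s / (1 + s * b) * sq (mv R' v)" using pos by (simp add: pos_le_divide_eq)
  then have "wtr (\<lambda>_. 1) (rank1 (- (s / (1 + s * b))) (mv R' v) R') \<le> wtr (\<lambda>_. 1) R"
    unfolding wtr_rank1 D_def sq_def by simp
  then show "\<exists>R''. pos_def (rank1 s v (shift (- d) Q)) \<and> is_inv (rank1 s v (shift (- d) Q)) R''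
        \<and> wtr (\<lambda>_. 1) R'' \<le> wtr (\<lambda>_. 1) R"
    using SM by blast
qed

end

section \<open>Quadratic forms averaged over a measure\<close>

lemma integrable_mult_cnj:
  fixes f g :: "'a \<Rightarrow> complex"
  assumes "f \<in> borel_measurable M" "integrable M (\<lambda>x. (cmod (f x))\<^sup>2)"
    and "g \<in> borel_measurable M" "integrable M (\<lambda>x. (cmod (g x))\<^sup>2)"
  shows "integrable M (\<lambda>x. f x * cnj (g x))"
proof (rule Bochner_Integration.integrable_bound)
  show "integrable M (\<lambda>x. (cmod (f x))\<^sup>2 + (cmod (g x))\<^sup>2)" using assms by simp
  have "continuous_on UNIV cnj" by (intro continuous_intros)
  then have "(\<lambda>x. cnj (g x)) \<in> borel_measurable M"
    using assms(3) by (rule borel_measurable_continuous_on)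
  then show "(\<lambda>x. f x * cnj (g x)) \<in> borel_measurable M" using assms(1) by measurable
  have "cmod (f x * cnj (g x)) \<le> (cmod (f x))\<^sup>2 + (cmod (g x))\<^sup>2" for x
    using sum_squares_bound[of "cmod (f x)" "cmod (g x)"] mult_nonneg_nonneg[OF norm_ge_zero[of "f x"] norm_ge_zero[of "g x"]]
    unfolding norm_mult complex_mod_cnj by linarith
  then show "AE x in M. norm (f x * cnj (g x)) \<le> norm ((cmod (f x))\<^sup>2 + (cmod (g x))\<^sup>2)"
    by (auto intro!: AE_I2)
qed

context finite_index begin

lemma wtr_scalar: "wtr g (shift d (\<lambda>_ _. 0)) = d * (\<Sum>k\<in>I. g k)"
  by (simp add: wtr_def shift_def sum_distrib_left mult.commute)

lemma pos_def_scalar: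
  assumes "0 < d" shows "pos_def (shift d (\<lambda>_ _. 0))"
  unfolding pos_def_def
proof (intro conjI allI impI)
  show "herm (shift d (\<lambda>_ _. 0))" by (rule herm_shift) (simp add: herm_def)
  fix x :: "'i \<Rightarrow> complex" assume "\<exists>i\<in>I. x i \<noteq> 0"
  then have "0 < d * sq x" using assms sq_pos by simp
  moreover have "ip (mv (\<lambda>_ _. 0) x) x = 0" by (simp add: ip_def mv_def)
  ultimately show "0 < Re (ip (mv (shift d (\<lambda>_ _. 0)) x) x)"
    by (simp add: ip_mv_shift ip_self)
qed

lemma is_inv_scalar:
  assumes "d \<noteq> 0" shows "is_inv (shift d (\<lambda>_ _. 0)) (shift (1 / d) (\<lambda>_ _. 0))"
  unfolding is_inv_def
proof (intro allI ballI)
  fix x :: "'i \<Rightarrow> complex" and i assume "i \<in> I"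
  then show "mv (shift d (\<lambda>_ _. 0)) (mv (shift (1 / d) (\<lambda>_ _. 0)) x) i = x i"
    using assms by (simp add: mv_shift mv_def[of "\<lambda>_ _. 0"])
qed

lemma integral_ip_mv:
  fixes v :: "'a \<Rightarrow> 'i \<Rightarrow> complex"
  assumes int: "\<And>i j. i \<in> I \<Longrightarrow> j \<in> I \<Longrightarrow> integrable M (\<lambda>x. v x i * cnj (v x j))"
    and orth: "\<And>i j. i \<in> I \<Longrightarrow> j \<in> I \<Longrightarrow>
      (LINT x|M. v x i * cnj (v x j)) = (if i = j then of_real (g i) else 0)"
  shows "integrable M (\<lambda>x. Re (ip (mv R (v x)) (v x)))"
    and "(LINT x|M. Re (ip (mv R (v x)) (v x))) = wtr g R"
proof -
  have eq: "ip (mv R (v x)) (v x) = (\<Sum>i\<in>I. \<Sum>j\<in>I. R i j * (v x j * cnj (v x i)))" for x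
    by (simp add: ip_def mv_def sum_distrib_right mult.assoc)
  have i: "integrable M (\<lambda>x. ip (mv R (v x)) (v x))"
    unfolding eq by (intro Bochner_Integration.integrable_sum integrable_mult_right int)
  then show "integrable M (\<lambda>x. Re (ip (mv R (v x)) (v x)))" by simp
  have "(LINT x|M. ip (mv R (v x)) (v x))
      = (\<Sum>i\<in>I. \<Sum>j\<in>I. R i j * (if j = i then of_real (g j) else 0))"
    unfolding eq
    by (simp add: Bochner_Integration.integral_sum Bochner_Integration.integrable_sum int orth)
  also have "\<dots> = (\<Sum>i\<in>I. R i i * of_real (g i))"
    using fin by (intro sum.cong refl) (simp add: if_distrib cong: if_cong)
  finally have "(LINT x|M. Re (ip (mv R (v x)) (v x))) = Re (\<Sum>i\<in>I. R i i * of_real (g i))"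
    using integral_Re[OF i] by simp
  then show "(LINT x|M. Re (ip (mv R (v x)) (v x))) = wtr g R"
    by (simp add: wtr_def mult.commute)
qed

text \<open>The squared modulus of row \<open>k\<close> of \<open>R\<close> applied to
  \<open>v\<close> is again a quadratic form, with the rank-one matrix \<open>S\<close> built from
  that row.\<close>

lemma integral_mv_squared:
  fixes v :: "'a \<Rightarrow> 'i \<Rightarrow> complex"
  assumes int: "\<And>i j. i \<in> I \<Longrightarrow> j \<in> I \<Longrightarrow> integrable M (\<lambda>x. v x i * cnj (v x j))"
    and orth: "\<And>i j. i \<in> I \<Longrightarrow> j \<in> I \<Longrightarrow>
      (LINT x|M. v x i * cnj (v x j)) = (if i = j then of_real (g i) else 0)"
  shows "integrable M (\<lambda>x. (cmod (mv R (v x) k))\<^sup>2)"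
    and "(LINT x|M. (cmod (mv R (v x) k))\<^sup>2) = (\<Sum>j\<in>I. g j * (cmod (R k j))\<^sup>2)"
proof -
  define S where "S = (\<lambda>i j. cnj (R k i) * R k j)"
  have "(cmod (mv R (v x) k))\<^sup>2 = Re (ip (mv S (v x)) (v x))" for x
  proof -
    have "complex_of_real ((cmod (mv R (v x) k))\<^sup>2) = ip (mv S (v x)) (v x)"
      unfolding complex_norm_square ip_def mv_def S_def cnj_sum sum_distrib_left sum_distrib_right
      by (simp add: mult_ac)
    then have "Re (complex_of_real ((cmod (mv R (v x) k))\<^sup>2)) = Re (ip (mv S (v x)) (v x))" by simp
    then show ?thesis by (simp only: Re_complex_of_real)
  qed
  moreover have "wtr g S = (\<Sum>j\<in>I. g j * (cmod (R k j))\<^sup>2)"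
    unfolding wtr_def S_def
  proof (intro sum.cong refl)
    fix j
    have "cnj (R k j) * R k j = of_real ((cmod (R k j))\<^sup>2)" unfolding complex_norm_square by simp
    then show "g j * Re (cnj (R k j) * R k j) = g j * (cmod (R k j))\<^sup>2" by (simp only: Re_complex_of_real)
  qed
  ultimately show "integrable M (\<lambda>x. (cmod (mv R (v x) k))\<^sup>2)"
    and "(LINT x|M. (cmod (mv R (v x) k))\<^sup>2) = (\<Sum>j\<in>I. g j * (cmod (R k j))\<^sup>2)"
    using integral_ip_mv[where v = v and g = g and R = S and M = M, OF int orth] by simp_all
qed

end

text \<open>First moment method. The almost everywhere property \<open>P\<close> is carried along
  because the selected point must also avoid a null set.\<close>

lemma exists_less_if_integral_less:
  fixes f g :: "'a \<Rightarrow> real"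
  assumes "integrable M f" "integrable M g" "(LINT x|M. f x) < (LINT x|M. g x)" "AE x in M. P x"
  shows "\<exists>x\<in>space M. P x \<and> f x < g x"
proof (rule ccontr)
  assume n: "\<not> ?thesis"
  from assms(4) AE_space have "AE x in M. g x \<le> f x"
    by eventually_elim (use n in force)
  then have "(LINT x|M. g x) \<le> (LINT x|M. f x)" using assms(1,2) by (intro integral_mono_AE) auto
  then show False using assms(3) by simp
qed

subsection \<open>Sparsification of a measure\<close>

text \<open>
  Dual-set sparsification in the sense of Batson, Spielman and Srivastava, with the average over a
  finite set of vectors replaced by the integral over \<open>M\<close>: each step picks a point at which the
  admissible step sizes of the two barriers are compatible.
\<close>

theorem dual_sparsification:
  fixes M :: "'a measure" and p :: "'i \<Rightarrow> 'a \<Rightarrow> complex" and q :: "'j \<Rightarrow> 'a \<Rightarrow> complex"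
  assumes I: "finite I" "I \<noteq> {}" and J: "finite J"
    and p: "\<And>i j. i \<in> I \<Longrightarrow> j \<in> I \<Longrightarrow> integrable M (\<lambda>x. p i x * cnj (p j x))"
      "\<And>i j. i \<in> I \<Longrightarrow> j \<in> I \<Longrightarrow> (LINT x|M. p i x * cnj (p j x)) = (if i = j then 1 else 0)"
    and q: "\<And>i j. i \<in> J \<Longrightarrow> j \<in> J \<Longrightarrow> integrable M (\<lambda>x. q i x * cnj (q j x))"
      "\<And>i j. i \<in> J \<Longrightarrow> j \<in> J \<Longrightarrow> (LINT x|M. q i x * cnj (q j x)) = (if i = j then of_real (g i) else 0)"
    and g: "\<And>j. j \<in> J \<Longrightarrow> 0 \<le> g j" "\<And>j. j \<in> J \<Longrightarrow> g j \<le> 1" "(\<Sum>j\<in>J. g j) \<le> real (card I)"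
    and t: "integrable M t" "\<And>x. P x \<Longrightarrow> 0 \<le> t x" "(LINT x|M. t x) \<le> 1 / 8"
    and P: "AE x in M. P x"
  shows "\<exists>(x :: nat \<Rightarrow> 'a) (s :: nat \<Rightarrow> real).
    (\<forall>i<3 * card I. x i \<in> space M \<and> P (x i) \<and> 0 < s i) \<and>
    (\<forall>a. real (card I) * (\<Sum>k\<in>I. (cmod (a k))\<^sup>2)
      \<le> (\<Sum>i<3 * card I. s i * (cmod (\<Sum>k\<in>I. a k * p k (x i)))\<^sup>2)) \<and>
    (\<forall>a. (\<Sum>i<3 * card I. s i * (cmod (\<Sum>k\<in>J. a k * q k (x i)))\<^sup>2)
      \<le> 32 * real (card I) * (\<Sum>k\<in>J. (cmod (a k))\<^sup>2)) \<and>
    (\<Sum>i<3 * card I. s i * t (x i)) \<le> 3 * real (card I)"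
proof -
  interpret A: finite_index I by standard (rule I)
  interpret B: finite_index J by standard (rule J)
  define n where "n = real (card I)"
  have n: "0 < n" using I by (simp add: n_def card_gt_0_iff)
  \<comment> \<open>Conjugation makes \<open>A.ip a (u x)\<close> the value at \<open>x\<close> of
    the function with coefficients \<open>a\<close>.\<close>
  define u where "u x = (\<lambda>k. cnj (p k x))" for x
  define v where "v x = (\<lambda>k. cnj (q k x))" for x
  have ipu: "A.ip a (u x) = (\<Sum>k\<in>I. a k * p k x)" for a x by (simp add: A.ip_def u_def)
  have ipv: "B.ip a (v x) = (\<Sum>k\<in>J. a k * q k x)" for a x by (simp add: B.ip_def v_def)
  have ui: "integrable M (\<lambda>x. u x i * cnj (u x j))" if "i \<in> I" "j \<in> I" for i j
    using p(1)[OF that(2,1)] by (simp add: u_def mult.commute)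
  have uo: "(LINT x|M. u x i * cnj (u x j)) = (if i = j then of_real 1 else 0)" if "i \<in> I" "j \<in> I" for i j
    using p(2)[OF that(2,1)] by (simp add: u_def mult.commute)
  have vi: "integrable M (\<lambda>x. v x i * cnj (v x j))" if "i \<in> J" "j \<in> J" for i j
    using q(1)[OF that(2,1)] by (simp add: v_def mult.commute)
  have vo: "(LINT x|M. v x i * cnj (v x j)) = (if i = j then of_real (g i) else 0)" if "i \<in> J" "j \<in> J" for i j
    using q(2)[OF that(2,1)] by (simp add: v_def mult.commute)
  \<comment> \<open>After \<open>k\<close> steps the barriers stand at k - 2 n and 8 n + 8 k; for k
    = 3 n these are n and 32 n, the constants of the conclusion. The matrices are recorded only
    through their quadratic forms, which is all that the conclusion reads off.\<close>
  define lo where "lo x s k QL \<longleftrightarrow> (\<forall>a. Re (A.ip (A.mv QL a) a)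
      = (\<Sum>i<k. s i * (cmod (A.ip a (u (x i))))\<^sup>2) - (real k - 2 * n) * A.sq a)" for x s k QL
  define up where "up x s k QU \<longleftrightarrow> (\<forall>a. Re (B.ip (B.mv QU a) a)
      = (8 * n + 8 * real k) * B.sq a - (\<Sum>i<k. s i * (cmod (B.ip a (v (x i))))\<^sup>2))" for x s k QU
  \<comment> \<open>The potentials start at n / (2 n) = 1/2 and, since the weights sum to at most n,
    at most n / (8 n) = 1/8. No step increases them.\<close>
  have main: "\<exists>x s QL RL QU RU. (\<forall>i<k. x i \<in> space M \<and> P (x i) \<and> 0 < s i) \<and>
      A.pos_def QL \<and> A.is_inv QL RL \<and> A.wtr (\<lambda>_. 1) RL \<le> 1 / 2 \<and> lo x s k QL \<and>
      B.pos_def QU \<and> B.is_inv QU RU \<and> B.wtr g RU \<le> 1 / 8 \<and> up x s k QU \<and>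
      (\<Sum>i<k. s i * t (x i)) \<le> real k" for k
  proof (induction k)
    case 0
    let ?QL = "A.shift (2 * n) (\<lambda>_ _. 0)" and ?RL = "A.shift (1 / (2 * n)) (\<lambda>_ _. 0)"
    let ?QU = "B.shift (8 * n) (\<lambda>_ _. 0)" and ?RU = "B.shift (1 / (8 * n)) (\<lambda>_ _. 0)"
    have "A.wtr (\<lambda>_. 1) ?RL \<le> 1 / 2"
      unfolding A.wtr_scalar using n by (simp add: n_def[symmetric])
    moreover have "B.wtr g ?RU \<le> 1 / 8"
      unfolding B.wtr_scalar using g(3) n by (simp add: n_def[symmetric] field_simps)
    moreover have "lo (\<lambda>_. undefined) (\<lambda>_. 0) 0 ?QL"
      by (simp add: lo_def A.ip_mv_shift A.ip_self) (simp add: A.ip_def A.mv_def)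
    moreover have "up (\<lambda>_. undefined) (\<lambda>_. 0) 0 ?QU"
      by (simp add: up_def B.ip_mv_shift B.ip_self) (simp add: B.ip_def B.mv_def)
    ultimately show ?case
      using A.pos_def_scalar[of "2 * n"] A.is_inv_scalar[of "2 * n"]
        B.pos_def_scalar[of "8 * n"] B.is_inv_scalar[of "8 * n"] n
      by (intro exI[of _ "\<lambda>_. undefined"] exI[of _ "\<lambda>_. 0"] exI[of _ ?QL] exI[of _ ?RL]
          exI[of _ ?QU] exI[of _ ?RU]) simp
  next
    case (Suc k)
    then obtain x s QL RL QU RU where xs: "\<forall>i<k. x i \<in> space M \<and> P (x i) \<and> 0 < s i"
      and L: "A.pos_def QL" "A.is_inv QL RL" "A.wtr (\<lambda>_. 1) RL \<le> 1 / 2" "lo x s k QL"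
      and U: "B.pos_def QU" "B.is_inv QU RU" "B.wtr g RU \<le> 1 / 8" "up x s k QU"
      and T: "(\<Sum>i<k. s i * t (x i)) \<le> real k" by auto
    let ?QL = "A.shift (- 1) QL" and ?QU = "B.shift 8 QU"
    have L1: "1 * A.wtr (\<lambda>_. 1) RL < 1" using L(3) by simp
    have pL: "A.pos_def ?QL" by (rule A.lower_barrier_pos_def[OF L(1,2) L1]) simp
    have pU: "B.pos_def ?QU" by (rule B.pos_def_shift[OF U(1)]) simp
    obtain RL' where RL': "A.is_inv ?QL RL'" using A.pos_def_inverse_exists[OF pL] by blast
    obtain RU' where RU': "B.is_inv ?QU RU'" using B.pos_def_inverse_exists[OF pU] by blast
    define DL where "DL = A.wtr (\<lambda>_. 1) RL' - A.wtr (\<lambda>_. 1) RL"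
    define DU where "DU = B.wtr g RU - B.wtr g RU'"
    note lower = A.lower_barrier[OF L(1,2) RL' zero_less_one L1 I(2), folded DL_def]
    have "(0::real) < 8" "\<forall>k\<in>J. 0 \<le> g k \<and> g k \<le> 1" using g by auto
    note upper = B.upper_barrier[OF U(1,2) RU' this, folded DU_def]
    define fL where "fL y = A.sq (A.mv RL' (u y)) / DL - Re (A.ip (A.mv RL' (u y)) (u y))" for y
    define fU where "fU y = Re (B.ip (B.mv RU' (v y)) (v y)) + (\<Sum>k\<in>J. g k * (cmod (B.mv RU' (v y) k))\<^sup>2) / DU" for y
    have iL: "integrable M fL"
      unfolding fL_def A.sq_def
      by (intro Bochner_Integration.integrable_diff integrable_divide_zero Bochner_Integration.integrable_sum
          A.integral_ip_mv(1)[OF ui uo] A.integral_mv_squared(1)[OF ui uo]) auto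
    have iU: "integrable M fU"
      unfolding fU_def
      by (intro Bochner_Integration.integrable_add integrable_divide_zero Bochner_Integration.integrable_sum
          integrable_mult_right B.integral_ip_mv(1)[OF vi vo] B.integral_mv_squared(1)[OF vi vo]) auto
    have "(LINT y|M. fL y) = (\<Sum>k\<in>I. \<Sum>j\<in>I. (cmod (RL' k j))\<^sup>2) / DL - A.wtr (\<lambda>_. 1) RL'"
      unfolding fL_def A.sq_def
      by (subst Bochner_Integration.integral_diff)
        (simp_all add: A.integral_ip_mv[OF ui uo] A.integral_mv_squared[OF ui uo]
          Bochner_Integration.integral_sum Bochner_Integration.integrable_sum)
    then have EL: "1 / 2 \<le> (LINT y|M. fL y)" using lower(2) L(3) unfolding div_by_1 by linarith
    have "(LINT y|M. fU y) = B.wtr g RU' + (\<Sum>k\<in>J. \<Sum>j\<in>J. g k * g j * (cmod (RU' k j))\<^sup>2) / DU"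
      unfolding fU_def
      by (subst Bochner_Integration.integral_add)
        (simp_all add: B.integral_ip_mv[OF vi vo] B.integral_mv_squared[OF vi vo] sum_distrib_left mult.assoc
          Bochner_Integration.integral_sum Bochner_Integration.integrable_sum)
    also have "\<dots> \<le> 1 / 8 + 1 / 8"
      using upper(1,3) U(3) DU_def by (intro add_mono) linarith+
    finally have EU: "(LINT y|M. fU y) \<le> 1 / 8 + 1 / 8" .
    \<comment> \<open>The gap behind all constants: on average the upper barrier asks for at most
      1/8 + 1/8 and \<open>t\<close> for at most 1/8, while the lower barrier offers at least 1 -
      1/2.\<close>
    have "(LINT y|M. fU y + t y) < (LINT y|M. fL y)"
      using EU EL t(3) by (subst Bochner_Integration.integral_add[OF iU t(1)]) linarith
    then obtain y where y: "y \<in> space M" "P y" "fU y + t y < fL y"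
      using exists_less_if_integral_less[OF Bochner_Integration.integrable_add[OF iU t(1)] iL _ P] by blast
    have fU0: "0 \<le> fU y"
      unfolding fU_def using B.inv_nonneg[OF pU RU'] upper(1) g(1)
      by (intro add_nonneg_nonneg divide_nonneg_nonneg sum_nonneg mult_nonneg_nonneg) auto
    \<comment> \<open>The smallest weight that the lower barrier admits. As \<open>fL y\<close>
      exceeds \<open>fU y + t y\<close>, it respects the upper barrier and adds at most 1 to the sum
      of the s_i t (x_i).\<close>
    define r where "r = 1 / fL y"
    have fL0: "0 < fL y" using y(3) fU0 t(2)[OF y(2)] by linarith
    have r: "0 < r" using fL0 by (simp add: r_def)
    have "r * fU y < 1" "r * t y \<le> 1"
      using y(3) t(2)[OF y(2)] fU0 fL0 by (simp_all add: r_def)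
    obtain RL'' where RL'': "A.pos_def (A.rank1 r (u y) ?QL)" "A.is_inv (A.rank1 r (u y) ?QL) RL''"
      "A.wtr (\<lambda>_. 1) RL'' \<le> A.wtr (\<lambda>_. 1) RL"
      using lower(3)[OF r, of "u y"] by (auto simp: r_def fL_def)
    obtain RU'' where RU'': "B.pos_def (B.rank1 (- r) (v y) ?QU)" "B.is_inv (B.rank1 (- r) (v y) ?QU) RU''"
      "B.wtr g RU'' \<le> B.wtr g RU"
      using upper(4)[OF r, of "v y"] \<open>r * fU y < 1\<close> by (auto simp: fU_def)
    let ?x = "x(k := y)" and ?s = "s(k := r)"
    have "lo ?x ?s (Suc k) (A.rank1 r (u y) ?QL)"
      using L(4) by (simp add: lo_def A.Re_ip_mv_rank1 A.ip_mv_shift A.ip_self algebra_simps)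
    moreover have "up ?x ?s (Suc k) (B.rank1 (- r) (v y) ?QU)"
      using U(4) by (simp add: up_def B.Re_ip_mv_rank1 B.ip_mv_shift B.ip_self algebra_simps)
    moreover have "(\<Sum>i<Suc k. ?s i * t (?x i)) \<le> real (Suc k)"
      using T \<open>r * t y \<le> 1\<close> by simp
    moreover have "\<forall>i<Suc k. ?x i \<in> space M \<and> P (?x i) \<and> 0 < ?s i"
      using xs y r by (simp add: less_Suc_eq)
    moreover have "A.wtr (\<lambda>_. 1) RL'' \<le> 1 / 2" "B.wtr g RU'' \<le> 1 / 8"
      using RL''(3) RU''(3) L(3) U(3) by linarith+
    ultimately show ?case using RL''(1,2) RU''(1,2) by blast
  qed
  obtain x s QL RL QU RU where xs: "\<forall>i<3 * card I. x i \<in> space M \<and> P (x i) \<and> 0 < s i"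
    and L: "A.pos_def QL" "lo x s (3 * card I) QL" and U: "B.pos_def QU" "up x s (3 * card I) QU"
    and T: "(\<Sum>i<3 * card I. s i * t (x i)) \<le> real (3 * card I)"
    using main[of "3 * card I"] by auto
  have "n * (\<Sum>k\<in>I. (cmod (a k))\<^sup>2) \<le> (\<Sum>i<3 * card I. s i * (cmod (\<Sum>k\<in>I. a k * p k (x i)))\<^sup>2)" for a
    using A.pos_def_nonneg[OF L(1), of a] L(2)
    by (simp add: lo_def ipu A.sq_def n_def)
  moreover have "(\<Sum>i<3 * card I. s i * (cmod (\<Sum>k\<in>J. a k * q k (x i)))\<^sup>2) \<le> 32 * n * (\<Sum>k\<in>J. (cmod (a k))\<^sup>2)" for a
    using B.pos_def_nonneg[OF U(1), of a] U(2)
    by (simp add: up_def ipv B.sq_def n_def)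
  ultimately show ?thesis using xs T unfolding n_def by (intro exI[of _ x] exI[of _ s]) simp
qed

subsection \<open>Square-integrable functions and orthonormal systems\<close>

lemma L2D:
  assumes "f \<in> L2 M"
  shows "f \<in> funs_on (space M)" "f \<in> borel_measurable M" "integrable M (\<lambda>x. (cmod (f x))\<^sup>2)"
  using assms by (auto simp: L2_def)

lemma cscale_apply: "cscale c f x = c * f x"
  by (simp add: cscale_def)

lemma L2_add:
  assumes "f \<in> L2 M" "g \<in> L2 M" shows "f + g \<in> L2 M"
proof -
  have "integrable M (\<lambda>x. (cmod (f x + g x))\<^sup>2)"
  proof (rule Bochner_Integration.integrable_bound)
    show "integrable M (\<lambda>x. 2 * (cmod (f x))\<^sup>2 + 2 * (cmod (g x))\<^sup>2)"
      using L2D[OF assms(1)] L2D[OF assms(2)] by simp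
    show "(\<lambda>x. (cmod (f x + g x))\<^sup>2) \<in> borel_measurable M"
      using L2D(2)[OF assms(1)] L2D(2)[OF assms(2)] by measurable
    have "(cmod (f x + g x))\<^sup>2 \<le> 2 * (cmod (f x))\<^sup>2 + 2 * (cmod (g x))\<^sup>2" for x
    proof -
      have "(cmod (f x + g x))\<^sup>2 \<le> (cmod (f x) + cmod (g x))\<^sup>2"
        by (intro power_mono norm_triangle_ineq) auto
      also have "\<dots> \<le> 2 * (cmod (f x))\<^sup>2 + 2 * (cmod (g x))\<^sup>2"
        using sum_squares_bound[of "cmod (f x)" "cmod (g x)"] by (simp add: power2_sum)
      finally show ?thesis .
    qed
    then show "AE x in M. norm ((cmod (f x + g x))\<^sup>2) \<le> norm (2 * (cmod (f x))\<^sup>2 + 2 * (cmod (g x))\<^sup>2)"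
      by (auto intro!: AE_I2)
  qed
  then show ?thesis
    using L2D[OF assms(1)] L2D[OF assms(2)] by (auto simp: L2_def funs_on_def plus_fun_def)
qed

lemma L2_scale: "f \<in> L2 M \<Longrightarrow> cscale c f \<in> L2 M"
  by (auto simp: L2_def funs_on_def cscale_def norm_mult power_mult_distrib)

lemma L2_zero: "0 \<in> L2 M"
  by (auto simp: L2_def funs_on_def zero_fun_def)

lemma L2_subspace: "cfun.subspace (L2 M)"
  by (simp add: cfun.subspace_def L2_add L2_scale L2_zero)

lemmas L2_diff = cfun.subspace_diff[OF L2_subspace]
  and L2_sum = cfun.subspace_sum[OF L2_subspace]

lemma L2_norm_nonneg: "0 \<le> L2_norm M f"
  by (simp add: L2_norm_def)

lemma L2_norm_squared: "(L2_norm M f)\<^sup>2 = (LINT x|M. (cmod (f x))\<^sup>2)"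
  by (simp add: L2_norm_def)

lemma L2_norm_eq_zero_AE:
  assumes "f \<in> L2 M" "L2_norm M f = 0" shows "AE x in M. f x = 0"
proof -
  have "(LINT x|M. (cmod (f x))\<^sup>2) = 0" using assms(2) L2_norm_squared[of M f] by simp
  then have "AE x in M. (cmod (f x))\<^sup>2 = 0"
    using integral_nonneg_eq_0_iff_AE[OF L2D(3)[OF assms(1)]] by simp
  then show ?thesis by simp
qed

lemma L2_norm_add_squared_le:
  assumes "f \<in> L2 M" "g \<in> L2 M"
  shows "(L2_norm M (f + g))\<^sup>2 \<le> 2 * (L2_norm M f)\<^sup>2 + 2 * (L2_norm M g)\<^sup>2"
proof -
  have "(LINT x|M. (cmod ((f + g) x))\<^sup>2) \<le> (LINT x|M. 2 * (cmod (f x))\<^sup>2 + 2 * (cmod (g x))\<^sup>2)"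
  proof (rule integral_mono)
    show "integrable M (\<lambda>x. (cmod ((f + g) x))\<^sup>2)" by (rule L2D(3)[OF L2_add[OF assms]])
    show "integrable M (\<lambda>x. 2 * (cmod (f x))\<^sup>2 + 2 * (cmod (g x))\<^sup>2)"
      using L2D[OF assms(1)] L2D[OF assms(2)] by simp
    fix x
    have "(cmod (f x + g x))\<^sup>2 \<le> (cmod (f x) + cmod (g x))\<^sup>2"
      by (intro power_mono norm_triangle_ineq) auto
    also have "\<dots> \<le> 2 * (cmod (f x))\<^sup>2 + 2 * (cmod (g x))\<^sup>2"
      using sum_squares_bound[of "cmod (f x)" "cmod (g x)"] by (simp add: power2_sum)
    finally show "(cmod ((f + g) x))\<^sup>2 \<le> 2 * (cmod (f x))\<^sup>2 + 2 * (cmod (g x))\<^sup>2" by simp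
  qed
  then show ?thesis
    using L2D(3)[OF assms(1)] L2D(3)[OF assms(2)] by (simp add: L2_norm_squared)
qed

lemma L2_integrable_inner: "f \<in> L2 M \<Longrightarrow> g \<in> L2 M \<Longrightarrow> integrable M (\<lambda>x. f x * cnj (g x))"
  by (intro integrable_mult_cnj L2D)

lemma L2_inner_self: "L2_inner M f f = of_real ((L2_norm M f)\<^sup>2)"
  unfolding L2_inner_def L2_norm_squared integral_complex_of_real[symmetric] complex_norm_square ..

lemma cnj_L2_inner: "cnj (L2_inner M f g) = L2_inner M g f"
  unfolding L2_inner_def by (subst Bochner_Integration.integral_cnj[symmetric]) (simp add: mult.commute)

lemma L2_inner_add_left:
  "f \<in> L2 M \<Longrightarrow> g \<in> L2 M \<Longrightarrow> h \<in> L2 M \<Longrightarrow> L2_inner M (f + g) h = L2_inner M f h + L2_inner M g h"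
  using L2_integrable_inner[of f M h] L2_integrable_inner[of g M h]
  by (simp add: L2_inner_def distrib_right)

lemma L2_inner_diff_left:
  "f \<in> L2 M \<Longrightarrow> g \<in> L2 M \<Longrightarrow> h \<in> L2 M \<Longrightarrow> L2_inner M (f - g) h = L2_inner M f h - L2_inner M g h"
  using L2_integrable_inner[of f M h] L2_integrable_inner[of g M h]
  by (simp add: L2_inner_def left_diff_distrib)

lemma L2_inner_scale_left: "L2_inner M (cscale c f) h = c * L2_inner M f h"
  by (simp add: L2_inner_def cscale_def mult.assoc)

lemma L2_inner_diff_right:
  "f \<in> L2 M \<Longrightarrow> g \<in> L2 M \<Longrightarrow> h \<in> L2 M \<Longrightarrow> L2_inner M h (f - g) = L2_inner M h f - L2_inner M h g"
  by (simp add: cnj_L2_inner[of M _ h, symmetric] L2_inner_diff_left)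

lemma L2_inner_sum_left:
  "(\<And>i. i \<in> A \<Longrightarrow> f i \<in> L2 M) \<Longrightarrow> h \<in> L2 M \<Longrightarrow>
    L2_inner M (\<Sum>i\<in>A. cscale (c i) (f i)) h = (\<Sum>i\<in>A. c i * L2_inner M (f i) h)"
proof (induction A rule: infinite_finite_induct)
  case (insert a A)
  then have "L2_inner M (cscale (c a) (f a) + (\<Sum>i\<in>A. cscale (c i) (f i))) h
      = c a * L2_inner M (f a) h + (\<Sum>i\<in>A. c i * L2_inner M (f i) h)"
    by (subst L2_inner_add_left) (auto simp: L2_inner_scale_left intro!: L2_scale L2_sum)
  then show ?case unfolding sum.insert[OF insert(1,2)] .
qed (simp_all add: L2_inner_def)

section \<open>Coefficients, projections and Bessel's inequality\<close>

locale L2_system =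
  fixes M :: "'a measure" and b :: "nat \<Rightarrow> 'a \<Rightarrow> complex"
  assumes orthonormal: "orthonormal_system M b"
begin

lemma b_L2: "b k \<in> L2 M"
  using orthonormal by (simp add: orthonormal_system_def)

lemma b_inner: "L2_inner M (b j) (b k) = (if j = k then 1 else 0)"
  using orthonormal by (simp add: orthonormal_system_def)

definition cf :: "('a \<Rightarrow> complex) \<Rightarrow> nat \<Rightarrow> complex" where
  "cf f k = L2_inner M f (b k)"

text \<open>\<open>comb {..<N} (cf f)\<close> is the orthogonal projection of \<open>f\<close> onto
  the span of the first \<open>N\<close> functions, as a genuine function that can be evaluated at
  sampling points.\<close>

definition comb :: "nat set \<Rightarrow> (nat \<Rightarrow> complex) \<Rightarrow> 'a \<Rightarrow> complex" where
  "comb A a = (\<Sum>k\<in>A. cscale (a k) (b k))"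

lemma comb_apply: "comb A a x = (\<Sum>k\<in>A. a k * b k x)"
  by (simp add: comb_def sum_apply_fun cscale_apply)

lemma comb_L2: "comb A a \<in> L2 M"
  unfolding comb_def by (intro L2_sum L2_scale b_L2)

lemma cf_comb: "finite A \<Longrightarrow> cf (comb A a) k = (if k \<in> A then a k else 0)"
  unfolding cf_def comb_def by (simp add: L2_inner_sum_left b_L2 b_inner if_distrib cong: if_cong)

lemma cf_diff: "f \<in> L2 M \<Longrightarrow> g \<in> L2 M \<Longrightarrow> cf (f - g) k = cf f k - cf g k"
  by (simp add: cf_def L2_inner_diff_left b_L2)

lemma L2_inner_comb:
  assumes "h \<in> L2 M" shows "L2_inner M (comb A a) h = (\<Sum>k\<in>A. a k * cnj (cf h k))"
  unfolding comb_def cf_def by (simp add: L2_inner_sum_left b_L2 assms cnj_L2_inner)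

lemma comb_norm: "finite A \<Longrightarrow> (L2_norm M (comb A a))\<^sup>2 = (\<Sum>k\<in>A. (cmod (a k))\<^sup>2)"
proof -
  assume A: "finite A"
  have "complex_of_real ((L2_norm M (comb A a))\<^sup>2) = (\<Sum>k\<in>A. a k * cnj (a k))"
    unfolding L2_inner_self[symmetric] L2_inner_comb[OF comb_L2] using A by (simp add: cf_comb)
  also have "\<dots> = of_real (\<Sum>k\<in>A. (cmod (a k))\<^sup>2)" by (simp add: complex_norm_square[symmetric])
  finally show ?thesis by (simp only: of_real_eq_iff)
qed

lemma Pythagoras:
  assumes "finite A" "h \<in> L2 M"
  shows "(L2_norm M (h - comb A (cf h)))\<^sup>2 = (L2_norm M h)\<^sup>2 - (\<Sum>k\<in>A. (cmod (cf h k))\<^sup>2)"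
proof -
  define s where "s = (\<Sum>k\<in>A. (cmod (cf h k))\<^sup>2)"
  have 1: "L2_inner M (comb A (cf h)) h = of_real s"
    unfolding L2_inner_comb[OF assms(2)] s_def by (simp add: complex_norm_square[symmetric])
  then have 2: "L2_inner M h (comb A (cf h)) = of_real s"
    by (subst cnj_L2_inner[symmetric]) simp
  have 3: "L2_inner M (comb A (cf h)) (comb A (cf h)) = of_real s"
    unfolding L2_inner_self comb_norm[OF assms(1)] s_def ..
  have "complex_of_real ((L2_norm M (h - comb A (cf h)))\<^sup>2) = of_real ((L2_norm M h)\<^sup>2 - s)"
    unfolding L2_inner_self[symmetric]
    by (simp add: L2_inner_diff_left L2_inner_diff_right comb_L2 assms L2_diff 1 2 3) (simp add: L2_inner_self)
  then show ?thesis unfolding s_def by (simp only: of_real_eq_iff)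
qed

lemma Bessel:
  assumes "finite A" "h \<in> L2 M"
  shows "(\<Sum>k\<in>A. (cmod (cf h k))\<^sup>2) \<le> (L2_norm M h)\<^sup>2"
  using Pythagoras[OF assms] by (metis diff_ge_0_iff_ge zero_le_power2)

lemma span_eq_comb:
  assumes "g \<in> cfun.span (b ` {..<N})" shows "g = comb {..<N} (cf g)"
proof -
  have "\<exists>a. g = comb {..<N} a"
    using assms
  proof (induction rule: cfun.span_induct_alt)
    case base
    show ?case by (intro exI[of _ "\<lambda>_. 0"]) (simp add: comb_def fun_eq_iff sum_apply_fun cscale_apply)
  next
    case (step c x y)
    then obtain j a where j: "x = b j" "j < N" "y = comb {..<N} a" by auto
    have "cscale c x + y = comb {..<N} (\<lambda>k. (if k = j then c else 0) + a k)"
      using j(2) by (simp add: fun_eq_iff comb_apply cscale_apply j distrib_right sum.distrib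
          if_distrib[of "\<lambda>c. c * _"] cong: if_cong)
    then show ?case by blast
  qed
  then obtain a where a: "g = comb {..<N} a" by blast
  show ?thesis
    unfolding a comb_def[of _ "cf _"] by (simp add: cf_comb) (simp add: comb_def)
qed

lemma comb_in_span: "A \<subseteq> {..<N} \<Longrightarrow> comb A a \<in> cfun.span (b ` {..<N})"
  unfolding comb_def by (intro cfun.span_sum cfun.span_scale cfun.span_base) auto

text \<open>Subtracting \<open>g\<close> does not change the coefficients of index at least
  \<open>N\<close>, so Bessel's inequality for \<open>f - g\<close> applies.\<close>

lemma coefficients_le_dist:
  assumes f: "f \<in> L2 M" and g: "g \<in> cfun.span (b ` {..<N})" and A: "finite A" "A \<subseteq> {N..}"
  shows "(\<Sum>k\<in>A. (cmod (cf f k))\<^sup>2) \<le> (L2_norm M (f - g))\<^sup>2"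
proof -
  have gL: "g \<in> L2 M" by (subst span_eq_comb[OF g]) (rule comb_L2)
  have "cf (f - g) k = cf f k" if "k \<in> A" for k
  proof -
    have "cf g k = 0" by (subst span_eq_comb[OF g]) (use that A in \<open>auto simp: cf_comb\<close>)
    then show ?thesis by (simp add: cf_diff f gL)
  qed
  then show ?thesis using Bessel[OF A(1) L2_diff[OF f gL]] by simp
qed

text \<open>The projection P fixes \<open>g\<close>, so f - P f = (f - g) - P (f - g), and by
  Pythagoras removing a projection does not increase the norm.\<close>

lemma best_approximation:
  assumes f: "f \<in> L2 M" and g: "g \<in> cfun.span (b ` {..<N})"
  shows "L2_norm M (f - comb {..<N} (cf f)) \<le> L2_norm M (f - g)"
proof -
  have g': "g = comb {..<N} (cf g)" by (rule span_eq_comb[OF g])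
  have gL: "g \<in> L2 M" by (subst g') (rule comb_L2)
  have eq: "f - comb {..<N} (cf f) = (f - g) - comb {..<N} (cf (f - g))"
    using fun_cong[OF g']
    by (simp add: fun_eq_iff comb_apply cf_diff[OF f gL] left_diff_distrib sum_subtractf)
  have "(L2_norm M (f - comb {..<N} (cf f)))\<^sup>2 \<le> (L2_norm M (f - g))\<^sup>2"
    unfolding eq Pythagoras[OF finite_lessThan L2_diff[OF f gL]] by (simp add: sum_nonneg)
  then show ?thesis by (rule power2_le_imp_le) (rule L2_norm_nonneg)
qed

lemma comb_diff: "n \<le> N \<Longrightarrow> comb {..<N} a - comb {..<n} a = comb {n..<N} a"
  by (rule ext) (simp add: comb_apply lessThan_atLeast0 sum_diff_nat_ivl)

end

subsection \<open>Sampling points and least squares\<close>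

text \<open>\<open>W\<close> solves the normal equations with the weighted Gram matrix
  \<open>G\<close> of the samples. The fitted values are the orthogonal projection of the data in
  the weighted sample seminorm, hence not larger than the data, and \<open>lower\<close> turns this
  into a bound on the coefficients. Exactness on the span is what later leaves only the samples of
  the tail as source of error.\<close>

lemma weighted_least_squares:
  fixes B :: "nat \<Rightarrow> 'i \<Rightarrow> complex"
  assumes I: "finite I" and c: "0 < c" and s: "\<And>i. i < r \<Longrightarrow> 0 \<le> s i"
    and lower: "\<And>a. c * (\<Sum>k\<in>I. (cmod (a k))\<^sup>2) \<le> (\<Sum>i<r. s i * (cmod (\<Sum>k\<in>I. a k * B i k))\<^sup>2)"
  shows "\<exists>W. (\<forall>y. c * (\<Sum>k\<in>I. (cmod (\<Sum>i<r. y i * W i k))\<^sup>2) \<le> (\<Sum>i<r. s i * (cmod (y i))\<^sup>2)) \<and>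
    (\<forall>a. \<forall>k\<in>I. (\<Sum>i<r. (\<Sum>j\<in>I. a j * B i j) * W i k) = a k)"
proof -
  interpret finite_index I by standard (rule I)
  define val where "val a i = (\<Sum>k\<in>I. a k * B i k)" for a i
  define G where "G j k = (\<Sum>i<r. of_real (s i) * cnj (B i j) * B i k)" for j k
  have mvG: "mv G a j = (\<Sum>i<r. of_real (s i) * cnj (B i j) * val a i)" for a j
  proof -
    have "mv G a j = (\<Sum>k\<in>I. \<Sum>i<r. of_real (s i) * cnj (B i j) * B i k * a k)"
      by (simp add: mv_def G_def sum_distrib_right)
    also have "\<dots> = (\<Sum>i<r. \<Sum>k\<in>I. of_real (s i) * cnj (B i j) * B i k * a k)" by (rule sum.swap)
    finally show ?thesis by (simp add: val_def sum_distrib_left mult_ac)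
  qed
  have ipG: "ip (\<lambda>j. \<Sum>i<r. of_real (s i) * cnj (B i j) * y i) z
      = (\<Sum>i<r. of_real (s i) * y i * cnj (val z i))" for y z
  proof -
    have "ip (\<lambda>j. \<Sum>i<r. of_real (s i) * cnj (B i j) * y i) z
        = (\<Sum>j\<in>I. \<Sum>i<r. of_real (s i) * cnj (B i j) * y i * cnj (z j))"
      by (simp add: ip_def sum_distrib_right)
    also have "\<dots> = (\<Sum>i<r. \<Sum>j\<in>I. of_real (s i) * cnj (B i j) * y i * cnj (z j))" by (rule sum.swap)
    finally show ?thesis by (simp add: val_def sum_distrib_left mult_ac)
  qed
  have ipGG: "ip (mv G z) z = of_real (\<Sum>i<r. s i * (cmod (val z i))\<^sup>2)" for z
  proof -
    have "mv G z = (\<lambda>j. \<Sum>i<r. of_real (s i) * cnj (B i j) * val z i)" by (rule ext) (rule mvG)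
    then have "ip (mv G z) z = (\<Sum>i<r. of_real (s i) * val z i * cnj (val z i))"
      by (simp only: ipG)
    then show ?thesis by (simp add: mult.assoc complex_norm_square[symmetric])
  qed
  have G: "pos_def G"
    unfolding pos_def_def
  proof (intro conjI allI impI)
    show "herm G" unfolding herm_def G_def by (simp add: mult_ac)
    fix x :: "'i \<Rightarrow> complex" assume "\<exists>i\<in>I. x i \<noteq> 0"
    then have "0 < c * sq x" using sq_pos c by simp
    also have "\<dots> \<le> (\<Sum>i<r. s i * (cmod (val x i))\<^sup>2)" using lower[of x] by (simp add: sq_def val_def)
    finally show "0 < Re (ip (mv G x) x)" unfolding ipGG by simp
  qed
  obtain R where R: "is_inv G R" using pos_def_inverse_exists[OF G] by blast
  define W where "W i = mv R (\<lambda>j. of_real (s i) * cnj (B i j))" for i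
  define cc where "cc y k = (\<Sum>i<r. y i * W i k)" for y k
  have mvcc: "mv G (cc y) j = (\<Sum>i<r. of_real (s i) * cnj (B i j) * y i)" if "j \<in> I" for y j
  proof -
    have "mv G (cc y) j = (\<Sum>k\<in>I. \<Sum>i<r. y i * (G j k * W i k))"
      by (simp add: mv_def cc_def sum_distrib_left mult_ac)
    also have "\<dots> = (\<Sum>i<r. \<Sum>k\<in>I. y i * (G j k * W i k))" by (rule sum.swap)
    also have "\<dots> = (\<Sum>i<r. y i * mv G (W i) j)" by (simp add: mv_def sum_distrib_left)
    also have "\<dots> = (\<Sum>i<r. y i * (of_real (s i) * cnj (B i j)))"
      using R that unfolding is_inv_def W_def by simp
    finally show ?thesis by (simp add: mult_ac)
  qed
  show ?thesis
  proof (intro exI[of _ W] conjI allI ballI)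
    fix y :: "nat \<Rightarrow> complex"
    define E where "E = (\<Sum>i<r. s i * (cmod (val (cc y) i))\<^sup>2)"
    define Y where "Y = (\<Sum>i<r. s i * (cmod (y i))\<^sup>2)"
    have E0: "0 \<le> E" unfolding E_def using s by (intro sum_nonneg) auto
    have Y0: "0 \<le> Y" unfolding Y_def using s by (intro sum_nonneg) auto
    \<comment> \<open>By the normal equations \<open>E\<close> is the weighted product of the data
      with the fitted values, so Cauchy-Schwarz, with each weight split into two square roots, gives
      E^2 <= Y E.\<close>
    have "complex_of_real E = ip (mv G (cc y)) (cc y)" unfolding ipGG E_def ..
    also have "\<dots> = ip (\<lambda>j. \<Sum>i<r. of_real (s i) * cnj (B i j) * y i) (cc y)"
      by (rule ip_cong) (simp_all add: mvcc)
    also have "\<dots> = (\<Sum>i<r. (of_real (sqrt (s i)) * y i) * (of_real (sqrt (s i)) * cnj (val (cc y) i)))"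
      unfolding ipG
    proof (intro sum.cong refl)
      fix i assume "i \<in> {..<r}"
      then have "complex_of_real (s i) = of_real (sqrt (s i)) * of_real (sqrt (s i))"
        using s by (simp add: of_real_mult[symmetric] del: of_real_mult)
      then show "of_real (s i) * y i * cnj (val (cc y) i)
        = (of_real (sqrt (s i)) * y i) * (of_real (sqrt (s i)) * cnj (val (cc y) i))"
        by (simp only: mult_ac)
    qed
    finally have "E\<^sup>2 = (cmod (\<Sum>i<r. (of_real (sqrt (s i)) * y i) * (of_real (sqrt (s i)) * cnj (val (cc y) i))))\<^sup>2"
      using E0 by (metis norm_of_real abs_of_nonneg)
    also have "\<dots> \<le> (\<Sum>i<r. (cmod (of_real (sqrt (s i)) * y i))\<^sup>2) * (\<Sum>i<r. (cmod (of_real (sqrt (s i)) * cnj (val (cc y) i)))\<^sup>2)"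
      by (rule cmod_sum_mult_squared_le)
    also have "\<dots> = Y * E"
      unfolding Y_def E_def using s by (intro arg_cong2[where f = "(*)"] sum.cong refl) (simp_all add: norm_mult power_mult_distrib)
    finally have "E * E \<le> Y * E" by (simp add: power2_eq_square)
    then have "E \<le> Y" using E0 Y0 by (cases "E = 0") auto
    moreover have "c * (\<Sum>k\<in>I. (cmod (cc y k))\<^sup>2) \<le> E"
      using lower[of "cc y"] by (simp add: E_def val_def)
    ultimately show "c * (\<Sum>k\<in>I. (cmod (\<Sum>i<r. y i * W i k))\<^sup>2) \<le> (\<Sum>i<r. s i * (cmod (y i))\<^sup>2)"
      by (simp add: cc_def Y_def)
  next
    fix a :: "'i \<Rightarrow> complex" and k assume k: "k \<in> I"
    have "mv G (\<lambda>k. cc (val a) k - a k) j = 0" if "j \<in> I" for j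
      unfolding mv_diff using mvcc[OF that] mvG by simp
    from pos_def_eq_zero[OF G this k] show "(\<Sum>i<r. (\<Sum>j\<in>I. a j * B i j) * W i k) = a k"
      by (simp add: cc_def val_def)
  qed
qed

section \<open>Tails of orthogonal expansions at almost every point\<close>

lemma AE_summable_if_summable_integral:
  fixes f :: "nat \<Rightarrow> 'a \<Rightarrow> real"
  assumes f: "\<And>k. integrable M (f k)" "\<And>k x. 0 \<le> f k x" and sm: "summable (\<lambda>k. LINT x|M. f k x)"
  shows "AE x in M. summable (\<lambda>k. f k x)"
proof -
  have "(\<integral>\<^sup>+x. (\<Sum>k. ennreal (f k x)) \<partial>M) = (\<Sum>k. \<integral>\<^sup>+x. ennreal (f k x) \<partial>M)"
    using f(1) by (intro nn_integral_suminf) auto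
  also have "\<dots> = (\<Sum>k. ennreal (LINT x|M. f k x))"
    using f by (intro suminf_cong nn_integral_eq_integral) auto
  also have "\<dots> = ennreal (\<Sum>k. LINT x|M. f k x)"
    using f sm by (intro suminf_ennreal2) auto
  finally have "AE x in M. (\<Sum>k. ennreal (f k x)) \<noteq> \<infinity>"
    using f(1) by (intro nn_integral_PInf_AE) auto
  then show ?thesis
    by eventually_elim (auto intro!: summable_suminf_not_top f(2))
qed

context L2_system begin

lemma b_squared: "integrable M (\<lambda>x. (cmod (b k x))\<^sup>2)" "(LINT x|M. (cmod (b k x))\<^sup>2) = 1"
proof -
  show "integrable M (\<lambda>x. (cmod (b k x))\<^sup>2)" by (rule L2D(3)[OF b_L2])
  have "complex_of_real ((L2_norm M (b k))\<^sup>2) = 1"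
    unfolding L2_inner_self[symmetric] by (simp add: b_inner)
  then show "(LINT x|M. (cmod (b k x))\<^sup>2) = 1" by (simp only: L2_norm_squared of_real_eq_1_iff)
qed

text \<open>Division by zero is harmless: an index with \<open>w k = 0\<close> has
  \<open>a k = 0\<close> and drops out on both sides.\<close>

lemma weighted_Cauchy_Schwarz:
  assumes w: "\<And>k. k \<in> A \<Longrightarrow> 0 \<le> w k" "\<And>k. k \<in> A \<Longrightarrow> w k = 0 \<Longrightarrow> a k = 0"
  shows "(cmod (comb A a x))\<^sup>2 \<le> (\<Sum>k\<in>A. (cmod (a k))\<^sup>2 / w k) * (\<Sum>k\<in>A. w k * (cmod (b k x))\<^sup>2)"
proof -
  have "comb A a x = (\<Sum>k\<in>A. (a k / of_real (sqrt (w k))) * (of_real (sqrt (w k)) * b k x))"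
    unfolding comb_apply using w by (intro sum.cong refl) auto
  also have "(cmod \<dots>)\<^sup>2 \<le> (\<Sum>k\<in>A. (cmod (a k / of_real (sqrt (w k))))\<^sup>2) * (\<Sum>k\<in>A. (cmod (of_real (sqrt (w k)) * b k x))\<^sup>2)"
    by (rule cmod_sum_mult_squared_le)
  also have "\<dots> = (\<Sum>k\<in>A. (cmod (a k))\<^sup>2 / w k) * (\<Sum>k\<in>A. w k * (cmod (b k x))\<^sup>2)"
    using w(1) by (intro arg_cong2[where f = "(*)"] sum.cong refl)
      (simp_all add: norm_mult norm_divide power_mult_distrib power_divide)
  finally show ?thesis .
qed

text \<open>Remainders that tend to zero in L2 do so almost everywhere along a subsequence. At such
  a point the part of the expansion between \<open>K\<close> and a later cut is bounded by weighted
  Cauchy-Schwarz, uniformly in the cut, and the remainder beyond the cut disappears in the limit.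
  The null set depends on \<open>f\<close>; the bound does so only through \<open>S\<close>.\<close>

lemma AE_tail_bound:
  assumes f: "f \<in> L2 M" and N: "\<And>l. l \<le> N l"
    and conv: "(\<lambda>l. L2_norm M (f - comb {..<N l} (cf f))) \<longlonglongrightarrow> 0"
    and w: "\<And>k. 0 \<le> w k" "\<And>k. K \<le> k \<Longrightarrow> w k = 0 \<Longrightarrow> cf f k = 0"
    and S: "\<And>L. (\<Sum>k\<in>{K..<L}. (cmod (cf f k))\<^sup>2 / w k) \<le> S"
  shows "AE x in M. summable (\<lambda>k. w (k + K) * (cmod (b (k + K) x))\<^sup>2) \<longrightarrow>
    (cmod ((f - comb {..<K} (cf f)) x))\<^sup>2 \<le> S * (\<Sum>k. w (k + K) * (cmod (b (k + K) x))\<^sup>2)"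
proof -
  define u where "u l x = (cmod ((f - comb {..<N l} (cf f)) x))\<^sup>2" for l x
  have "integrable M (u l)" for l
    unfolding u_def by (intro L2D(3) L2_diff f comb_L2)
  moreover have "(\<lambda>l. LINT x|M. norm (u l x)) \<longlonglongrightarrow> 0"
  proof -
    have "(\<lambda>l. (L2_norm M (f - comb {..<N l} (cf f)))\<^sup>2) \<longlonglongrightarrow> 0\<^sup>2"
      by (intro tendsto_power conv)
    then show ?thesis by (simp add: L2_norm_squared u_def)
  qed
  ultimately obtain r :: "nat \<Rightarrow> nat" where r: "strict_mono r" "AE x in M. (\<lambda>l. u (r l) x) \<longlonglongrightarrow> 0"
    using tendsto_L1_AE_subseq[of M u] by blast
  from r(2) show ?thesis
  proof eventually_elim
    case (elim x)
    show ?case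
    proof
      assume sm: "summable (\<lambda>k. w (k + K) * (cmod (b (k + K) x))\<^sup>2)"
      define t where "t = (\<Sum>k. w (k + K) * (cmod (b (k + K) x))\<^sup>2)"
      have t0: "0 \<le> t" unfolding t_def by (intro suminf_nonneg sm) (simp add: w)
      have S0: "0 \<le> S" using S[of 0] by simp
      have "(\<lambda>l. sqrt (u (r l) x)) \<longlonglongrightarrow> sqrt 0" by (intro tendsto_real_sqrt elim)
      then have lim: "(\<lambda>l. sqrt (u (r l) x) + sqrt (S * t)) \<longlonglongrightarrow> 0 + sqrt (S * t)"
        by (intro tendsto_add) simp_all
      have "cmod ((f - comb {..<K} (cf f)) x) \<le> sqrt (u (r l) x) + sqrt (S * t)" if l: "K \<le> l" for l
      proof -
        define L where "L = N (r l)"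
        have KL: "K \<le> L" unfolding L_def using l N[of "r l"] seq_suble[OF r(1), of l] by linarith
        have "(f - comb {..<K} (cf f)) x = (f - comb {..<L} (cf f)) x + comb {K..<L} (cf f) x"
          unfolding comb_diff[OF KL, symmetric] by simp
        then have "cmod ((f - comb {..<K} (cf f)) x) \<le> cmod ((f - comb {..<L} (cf f)) x) + cmod (comb {K..<L} (cf f) x)"
          by (simp only: norm_triangle_ineq)
        moreover have "cmod ((f - comb {..<L} (cf f)) x) = sqrt (u (r l) x)"
          by (simp add: u_def L_def)
        moreover have "(cmod (comb {K..<L} (cf f) x))\<^sup>2 \<le> S * t"
        proof -
          have "(\<Sum>k\<in>{K..<L}. w k * (cmod (b k x))\<^sup>2) = (\<Sum>k<L - K. w (k + K) * (cmod (b (k + K) x))\<^sup>2)"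
            using sum.shift_bounds_nat_ivl[of "\<lambda>k. w k * (cmod (b k x))\<^sup>2" 0 K "L - K"] KL
            by (simp add: lessThan_atLeast0)
          also have "\<dots> \<le> t" unfolding t_def using sm by (intro sum_le_suminf) (auto simp: w)
          finally have "(\<Sum>k\<in>{K..<L}. w k * (cmod (b k x))\<^sup>2) \<le> t" .
          moreover have "(cmod (comb {K..<L} (cf f) x))\<^sup>2
            \<le> (\<Sum>k\<in>{K..<L}. (cmod (cf f k))\<^sup>2 / w k) * (\<Sum>k\<in>{K..<L}. w k * (cmod (b k x))\<^sup>2)"
            by (rule weighted_Cauchy_Schwarz) (auto simp: w)
          ultimately show ?thesis
            using mult_mono[OF S[of L] _ S0] by (meson order_trans sum_nonneg mult_nonneg_nonneg w(1) zero_le_power2)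
        qed
        then have "cmod (comb {K..<L} (cf f) x) \<le> sqrt (S * t)"
          by (rule real_le_rsqrt)
        ultimately show ?thesis by linarith
      qed
      then have "\<forall>\<^sub>F l in sequentially. cmod ((f - comb {..<K} (cf f)) x) \<le> sqrt (u (r l) x) + sqrt (S * t)"
        by (auto simp: eventually_sequentially)
      then have "cmod ((f - comb {..<K} (cf f)) x) \<le> sqrt (S * t)"
        using tendsto_lowerbound[OF lim] by simp
      then have "(cmod ((f - comb {..<K} (cf f)) x))\<^sup>2 \<le> (sqrt (S * t))\<^sup>2" by (intro power_mono) auto
      then show "(cmod ((f - comb {..<K} (cf f)) x))\<^sup>2 \<le> S * (\<Sum>k. w (k + K) * (cmod (b (k + K) x))\<^sup>2)"
        using S0 t0 by (simp add: t_def)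
    qed
  qed
qed

text \<open>Indices from \<open>n\<close> up to a cut go to the upper barrier with b_k scaled by
  sqrt (w k), so that their covariance is diag w. Later indices enter only through a function
  \<open>t\<close>, which by \<open>AE_tail_bound\<close> controls the squared remainders of all
  members of \<open>F\<close> at once; countability of \<open>F\<close> provides one common null
  set.\<close>

lemma sampling_points:
  assumes n: "1 \<le> n" and N: "\<And>l. l \<le> N l"
    and w: "\<And>k. 0 \<le> w k" "\<And>k. w k \<le> 1" "\<And>L. (\<Sum>k\<in>{n..<L}. w k) \<le> real n"
    and F: "countable F" "F \<subseteq> L2 M"
    and conv: "\<And>f. f \<in> F \<Longrightarrow> (\<lambda>l. L2_norm M (f - comb {..<N l} (cf f))) \<longlonglongrightarrow> 0"
    and wF: "\<And>f k. f \<in> F \<Longrightarrow> n \<le> k \<Longrightarrow> w k = 0 \<Longrightarrow> cf f k = 0"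
    and S: "\<And>f L. f \<in> F \<Longrightarrow> (\<Sum>k\<in>{n..<L}. (cmod (cf f k))\<^sup>2 / w k) \<le> S"
  shows "\<exists>x s. (\<forall>i<3 * n. x i \<in> space M \<and> 0 < s i) \<and>
    (\<forall>a. real n * (\<Sum>k<n. (cmod (a k))\<^sup>2) \<le> (\<Sum>i<3 * n. s i * (cmod (\<Sum>k<n. a k * b k (x i)))\<^sup>2)) \<and>
    (\<forall>f\<in>F. (\<Sum>i<3 * n. s i * (cmod ((f - comb {..<n} (cf f)) (x i)))\<^sup>2) \<le> 70 * real n * S)"
proof -
  have "summable (\<lambda>k. w (k + n))"
  proof (rule summableI_nonneg_bounded[where x = "real n"])
    fix L
    have "(\<Sum>k<L. w (k + n)) = (\<Sum>k\<in>{n..<L + n}. w k)"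
      using sum.shift_bounds_nat_ivl[of w 0 n L] by (simp add: lessThan_atLeast0)
    then show "(\<Sum>k<L. w (k + n)) \<le> real n" using w(3) by simp
  qed (simp add: w)
  then have sw: "summable w" by (rule iffD1[OF summable_iff_shift])
  obtain K0 where K0: "\<And>K. K0 \<le> K \<Longrightarrow> norm (\<Sum>k. w (k + K)) < 1 / 8"
    using suminf_exist_split[OF _ sw, of "1 / 8"] by auto
  \<comment> \<open>The infinite tail \<open>k \<ge> K\<close> has so little mass that its trace can be added to the barriers.\<close>
  define K where "K = max K0 n"
  have nK: "n \<le> K" by (simp add: K_def)
  have swK: "summable (\<lambda>k. w (k + K))" using sw by (rule iffD2[OF summable_iff_shift])
  have tail: "(\<Sum>k. w (k + K)) \<le> 1 / 8" using K0[of K] by (simp add: K_def)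
  define h where "h k x = w (k + K) * (cmod (b (k + K) x))\<^sup>2" for k x
  define t where "t x = (\<Sum>k. h k x)" for x
  have hi: "integrable M (h k)" "(LINT x|M. h k x) = w (k + K)" for k
    unfolding h_def by (simp_all add: b_squared)
  have h0: "0 \<le> h k x" for k x by (simp add: h_def w)
  have sh: "AE x in M. summable (\<lambda>k. h k x)"
    by (rule AE_summable_if_summable_integral) (simp_all add: hi h0 sw)
  have ti: "integrable M t" "(LINT x|M. t x) \<le> 1 / 8"
    using integrable_suminf[of M h] integral_suminf[of M h] sh tail sw
    by (simp_all add: t_def[abs_def] hi h0)
  \<comment> \<open>Summability is part of \<open>P\<close> because otherwise the value of
    \<open>t\<close> would carry no information, not even its sign.\<close>
  define P where "P x \<longleftrightarrow> summable (\<lambda>k. h k x) \<and>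
    (\<forall>f\<in>F. (cmod ((f - comb {..<K} (cf f)) x))\<^sup>2 \<le> S * t x)" for x
  have "AE x in M. summable (\<lambda>k. h k x) \<longrightarrow> (cmod ((f - comb {..<K} (cf f)) x))\<^sup>2 \<le> S * t x" if f: "f \<in> F" for f
    unfolding h_def t_def
  proof (rule AE_tail_bound[where N = N])
    show "f \<in> L2 M" using f F by auto
    fix L
    have "(\<Sum>k\<in>{K..<L}. (cmod (cf f k))\<^sup>2 / w k) \<le> (\<Sum>k\<in>{n..<L}. (cmod (cf f k))\<^sup>2 / w k)"
      using nK by (intro sum_mono2) (auto simp: w)
    then show "(\<Sum>k\<in>{K..<L}. (cmod (cf f k))\<^sup>2 / w k) \<le> S" using S[OF f, of L] by linarith
  qed (use f nK in \<open>auto simp: N w wF conv\<close>)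
  then have "AE x in M. \<forall>f\<in>F. summable (\<lambda>k. h k x) \<longrightarrow> (cmod ((f - comb {..<K} (cf f)) x))\<^sup>2 \<le> S * t x"
    unfolding AE_ball_countable[OF F(1)] by blast
  with sh have P: "AE x in M. P x" by eventually_elim (auto simp: P_def)
  define q where "q k x = of_real (sqrt (w k)) * b k x" for k x
  have bi: "integrable M (\<lambda>x. b i x * cnj (b j x))" for i j
    by (rule L2_integrable_inner[OF b_L2 b_L2])
  have bo: "(LINT x|M. b i x * cnj (b j x)) = (if i = j then 1 else 0)" for i j
    using b_inner[of i j] by (simp add: L2_inner_def)
  have qq: "q i x * cnj (q j x) = of_real (sqrt (w i) * sqrt (w j)) * (b i x * cnj (b j x))" for i j x
    by (simp add: q_def mult_ac)
  have qi: "integrable M (\<lambda>x. q i x * cnj (q j x))" for i j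
    unfolding qq by (intro integrable_mult_right bi)
  have qo: "(LINT x|M. q i x * cnj (q j x)) = (if i = j then of_real (w i) else 0)" for i j
    unfolding qq using w(1)[of i] w(1)[of j]
    by (simp add: bo of_real_mult[symmetric] del: of_real_mult)
  have "\<exists>(x :: nat \<Rightarrow> 'a) (s :: nat \<Rightarrow> real).
    (\<forall>i<3 * card {..<n}. x i \<in> space M \<and> P (x i) \<and> 0 < s i) \<and>
    (\<forall>a. real (card {..<n}) * (\<Sum>k\<in>{..<n}. (cmod (a k))\<^sup>2)
      \<le> (\<Sum>i<3 * card {..<n}. s i * (cmod (\<Sum>k\<in>{..<n}. a k * b k (x i)))\<^sup>2)) \<and>
    (\<forall>a. (\<Sum>i<3 * card {..<n}. s i * (cmod (\<Sum>k\<in>{n..<K}. a k * q k (x i)))\<^sup>2)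
      \<le> 32 * real (card {..<n}) * (\<Sum>k\<in>{n..<K}. (cmod (a k))\<^sup>2)) \<and>
    (\<Sum>i<3 * card {..<n}. s i * t (x i)) \<le> 3 * real (card {..<n})"
  proof (rule dual_sparsification[OF _ _ _ bi bo qi qo w(1,2) _ ti(1) _ ti(2) P])
    show "(\<Sum>k\<in>{n..<K}. w k) \<le> real (card {..<n})" using w(3) by simp
    show "\<And>x. P x \<Longrightarrow> 0 \<le> t x" unfolding t_def by (intro suminf_nonneg h0) (simp add: P_def)
    show "{..<n} \<noteq> {}" using n by (auto simp: lessThan_empty_iff)
  qed auto
  then obtain x :: "nat \<Rightarrow> 'a" and s :: "nat \<Rightarrow> real"
    where xs: "\<forall>i<3 * n. x i \<in> space M \<and> P (x i) \<and> 0 < s i"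
    and lo: "\<forall>a. real n * (\<Sum>k<n. (cmod (a k))\<^sup>2) \<le> (\<Sum>i<3 * n. s i * (cmod (\<Sum>k<n. a k * b k (x i)))\<^sup>2)"
    and up: "\<And>a. (\<Sum>i<3 * n. s i * (cmod (\<Sum>k\<in>{n..<K}. a k * q k (x i)))\<^sup>2) \<le> 32 * real n * (\<Sum>k\<in>{n..<K}. (cmod (a k))\<^sup>2)"
    and tt: "(\<Sum>i<3 * n. s i * t (x i)) \<le> 3 * real n"
    by auto
  have "(\<Sum>i<3 * n. s i * (cmod ((f - comb {..<n} (cf f)) (x i)))\<^sup>2) \<le> 70 * real n * S" if f: "f \<in> F" for f
  proof -
    have S0: "0 \<le> S" using S[OF f, of 0] by simp
    define e where "e i = cmod ((f - comb {..<K} (cf f)) (x i))" for i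
    define d where "d i = cmod (comb {n..<K} (cf f) (x i))" for i
    have "(cmod ((f - comb {..<n} (cf f)) (x i)))\<^sup>2 \<le> 2 * (e i)\<^sup>2 + 2 * (d i)\<^sup>2" for i
    proof -
      have "(f - comb {..<n} (cf f)) (x i) = (f - comb {..<K} (cf f)) (x i) + comb {n..<K} (cf f) (x i)"
        unfolding comb_diff[OF nK, symmetric] by simp
      then have "cmod ((f - comb {..<n} (cf f)) (x i)) \<le> e i + d i"
        unfolding e_def d_def by (simp only: norm_triangle_ineq)
      then have "(cmod ((f - comb {..<n} (cf f)) (x i)))\<^sup>2 \<le> (e i + d i)\<^sup>2" by (intro power_mono) auto
      also have "\<dots> \<le> 2 * (e i)\<^sup>2 + 2 * (d i)\<^sup>2"
        using sum_squares_bound[of "e i" "d i"] by (simp add: power2_sum)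
      finally show ?thesis .
    qed
    then have "(\<Sum>i<3 * n. s i * (cmod ((f - comb {..<n} (cf f)) (x i)))\<^sup>2)
      \<le> (\<Sum>i<3 * n. s i * (2 * (e i)\<^sup>2 + 2 * (d i)\<^sup>2))"
      using xs by (intro sum_mono mult_left_mono) (auto simp: less_imp_le)
    \<comment> \<open>The constant is 70 = 2 * 3 + 2 * 32: three from the budget of
      \<open>t\<close>, 32 from the upper barrier, both doubled by splitting the square at
      \<open>K\<close>.\<close>
    also have "\<dots> = 2 * (\<Sum>i<3 * n. s i * (e i)\<^sup>2) + 2 * (\<Sum>i<3 * n. s i * (d i)\<^sup>2)"
      by (simp add: algebra_simps sum.distrib sum_distrib_left)
    also have "(\<Sum>i<3 * n. s i * (e i)\<^sup>2) \<le> S * (3 * real n)"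
    proof -
      have "(\<Sum>i<3 * n. s i * (e i)\<^sup>2) \<le> (\<Sum>i<3 * n. s i * (S * t (x i)))"
        using xs f by (intro sum_mono mult_left_mono) (auto simp: e_def P_def less_imp_le)
      also have "\<dots> = S * (\<Sum>i<3 * n. s i * t (x i))" by (simp add: sum_distrib_left mult_ac)
      also have "\<dots> \<le> S * (3 * real n)" using tt S0 by (intro mult_left_mono) auto
      finally show ?thesis .
    qed
    also have "(\<Sum>i<3 * n. s i * (d i)\<^sup>2) \<le> 32 * real n * S"
    proof -
      \<comment> \<open>Coefficients with respect to the scaled functions \<open>q k\<close>; where
        \<open>w k = 0\<close> the original coefficient vanishes by \<open>wF\<close>.\<close>
      define a where "a k = cf f k / of_real (sqrt (w k))" for k
      have "comb {n..<K} (cf f) y = (\<Sum>k\<in>{n..<K}. a k * q k y)" for y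
        unfolding comb_apply a_def q_def using wF[OF f] by (intro sum.cong refl) auto
      then have "(\<Sum>i<3 * n. s i * (d i)\<^sup>2) \<le> 32 * real n * (\<Sum>k\<in>{n..<K}. (cmod (a k))\<^sup>2)"
        using up[of a] by (simp add: d_def)
      also have "(\<Sum>k\<in>{n..<K}. (cmod (a k))\<^sup>2) = (\<Sum>k\<in>{n..<K}. (cmod (cf f k))\<^sup>2 / w k)"
        by (simp add: a_def norm_divide power_divide w(1))
      also have "32 * real n * (\<Sum>k\<in>{n..<K}. (cmod (cf f k))\<^sup>2 / w k) \<le> 32 * real n * S"
        using S[OF f] by (intro mult_left_mono) auto
      finally show ?thesis .
    qed
    finally show ?thesis by (simp add: mult_ac)
  qed
  then show ?thesis using xs lo by (intro exI[of _ x] exI[of _ s]) auto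
qed

end

section \<open>From a countable dense subset to the whole class\<close>

text \<open>The functions close to \<open>f\<close> in L2 and at finitely many given points contain
  an open neighbourhood of \<open>f\<close>, as evaluations and embedding are continuous, and a
  dense set meets it. Radii 1 / (j + 1) give the sequence; it depends on the points, which are fixed
  beforehand.\<close>

lemma assumption_A_dense:
  assumes "assumption_A M F" "F \<subseteq> L2 M"
  shows "\<exists>F0. countable F0 \<and> F0 \<subseteq> F \<and>
    (\<forall>f\<in>F. \<forall>(r :: nat) x. (\<forall>i<r. x i \<in> space M) \<longrightarrow>
      (\<exists>g. (\<forall>j::nat. g j \<in> F0) \<and> (\<lambda>j. L2_norm M (g j - f)) \<longlonglongrightarrow> 0 \<and>
        (\<forall>i<r. (\<lambda>j. g j (x i)) \<longlonglongrightarrow> f (x i))))"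
proof -
  obtain T where T: "topspace T = F" "separable_space T"
    "\<And>x. x \<in> space M \<Longrightarrow> continuous_map T euclidean (\<lambda>f. f x)"
    "continuous_map T (L2_topology M) (\<lambda>f. f)"
    using assms(1) by (auto simp: assumption_A_def)
  obtain F0 where F0: "countable F0" "F0 \<subseteq> F" "T closure_of F0 = F"
    using T(1,2) unfolding separable_space_def by auto
  have nbh: "\<exists>U. openin T U \<and> f \<in> U \<and> (\<forall>g\<in>U. L2_norm M (g - f) < e \<and> (\<forall>i<r. cmod (g (x i) - f (x i)) < e))"
    if f: "f \<in> F" and e: "0 < e" and x: "\<forall>i<r. x i \<in> space M" for f x and e :: real and r :: nat
    using x
  proof (induction r)
    case 0
    define B where "B = {g \<in> L2 M. L2_norm M (g - f) < e}"
    have "openin (L2_topology M) B"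
      unfolding L2_topology_def B_def using f e assms(2) by (intro topology_generated_by_Basis) blast
    then have "openin T {g \<in> topspace T. g \<in> B}" using T(4) by (rule openin_continuous_map_preimage[rotated])
    moreover have "L2_norm M (f - f) = 0" by (simp add: L2_norm_def)
    ultimately have "f \<in> {g \<in> topspace T. g \<in> B}" using f e assms(2) T(1) unfolding B_def by auto
    moreover have "\<forall>g\<in>{g \<in> topspace T. g \<in> B}. L2_norm M (g - f) < e" unfolding B_def by blast
    ultimately show ?case using \<open>openin T {g \<in> topspace T. g \<in> B}\<close> by blast
  next
    case (Suc r)
    then have "\<forall>i<r. x i \<in> space M" by simp
    from Suc.IH[OF this] obtain U where U: "openin T U" "f \<in> U"
      "\<forall>g\<in>U. L2_norm M (g - f) < e \<and> (\<forall>i<r. cmod (g (x i) - f (x i)) < e)" by blast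
    define W where "W = {g \<in> topspace T. g (x r) \<in> ball (f (x r)) e}"
    have "openin T W"
      unfolding W_def using Suc.prems by (intro openin_continuous_map_preimage[OF T(3)]) auto
    then have "openin T (U \<inter> W)" using U by blast
    moreover have "f \<in> U \<inter> W" using U f e T(1) by (simp add: W_def)
    moreover have "\<forall>g\<in>U \<inter> W. L2_norm M (g - f) < e \<and> (\<forall>i<Suc r. cmod (g (x i) - f (x i)) < e)"
    proof
      fix g assume g: "g \<in> U \<inter> W"
      then have "cmod (g (x r) - f (x r)) < e" by (simp add: W_def dist_norm norm_minus_commute)
      then show "L2_norm M (g - f) < e \<and> (\<forall>i<Suc r. cmod (g (x i) - f (x i)) < e)"
        using U(3) g less_Suc_eq by blast
    qed
    ultimately show ?case by blast
  qed
  have "\<exists>g. (\<forall>j::nat. g j \<in> F0) \<and> (\<lambda>j. L2_norm M (g j - f)) \<longlonglongrightarrow> 0 \<and>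
        (\<forall>i<r. (\<lambda>j. g j (x i)) \<longlonglongrightarrow> f (x i))"
    if f: "f \<in> F" and x: "\<forall>i<r. x i \<in> space M" for f x and r :: nat
  proof -
    have "\<exists>g\<in>F0. L2_norm M (g - f) < 1 / real (Suc j) \<and> (\<forall>i<r. cmod (g (x i) - f (x i)) < 1 / real (Suc j))" for j
    proof -
      have "0 < 1 / real (Suc j)" by simp
      from nbh[OF f this x] obtain U where U: "openin T U" "f \<in> U"
        "\<forall>g\<in>U. L2_norm M (g - f) < 1 / real (Suc j) \<and> (\<forall>i<r. cmod (g (x i) - f (x i)) < 1 / real (Suc j))" by blast
      have "f \<in> T closure_of F0" using F0 f by simp
      then obtain g where "g \<in> F0" "g \<in> U" using U unfolding in_closure_of by blast
      then show ?thesis using U(3) by blast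
    qed
    then have "\<forall>j. \<exists>g. g \<in> F0 \<and> L2_norm M (g - f) < 1 / real (Suc j) \<and> (\<forall>i<r. cmod (g (x i) - f (x i)) < 1 / real (Suc j))"
      by blast
    from choice[OF this] obtain g where g: "\<And>j. g j \<in> F0" "\<And>j. L2_norm M (g j - f) < 1 / real (Suc j)"
      "\<And>j i. i < r \<Longrightarrow> cmod (g j (x i) - f (x i)) < 1 / real (Suc j)"
      by (metis (no_types, lifting))
    have z: "(\<lambda>j. 1 / real (Suc j)) \<longlonglongrightarrow> 0" using LIMSEQ_inverse_real_of_nat by (simp add: inverse_eq_divide)
    have "(\<lambda>j. L2_norm M (g j - f)) \<longlonglongrightarrow> 0"
    proof (rule tendsto_sandwich[OF _ _ tendsto_const z])
      show "\<forall>\<^sub>F j in sequentially. L2_norm M (g j - f) \<le> 1 / real (Suc j)"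
        by (intro always_eventually allI less_imp_le g(2))
    qed (simp add: L2_norm_nonneg)
    moreover have "(\<lambda>j. g j (x i)) \<longlonglongrightarrow> f (x i)" if "i < r" for i
    proof (rule LIM_zero_cancel, rule Lim_null_comparison[OF _ z])
      show "\<forall>\<^sub>F j in sequentially. norm (g j (x i) - f (x i)) \<le> 1 / real (Suc j)"
        by (intro always_eventually allI less_imp_le g(3)[OF that])
    qed
    ultimately show ?thesis using g(1) by blast
  qed
  with F0(1,2) show ?thesis by (intro exI[of _ F0] conjI ballI allI impI) simp_all
qed

context L2_system begin

text \<open>Least squares is exact on the span of the first \<open>n\<close> functions, so its
  coefficient error on \<open>f\<close> is its output on the samples of f - P f. The factor n of the
  lower bound cancels the n in the sampling estimate, which leaves 70 S.\<close>

lemma stable_reconstruction: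
  assumes n: "1 \<le> n" and N: "\<And>l. l \<le> N l"
    and w: "\<And>k. 0 \<le> w k" "\<And>k. w k \<le> 1" "\<And>L. (\<Sum>k\<in>{n..<L}. w k) \<le> real n"
    and F: "assumption_A M F" "F \<subseteq> L2 M"
    and conv: "\<And>f. f \<in> F \<Longrightarrow> (\<lambda>l. L2_norm M (f - comb {..<N l} (cf f))) \<longlonglongrightarrow> 0"
    and wF: "\<And>f k. f \<in> F \<Longrightarrow> n \<le> k \<Longrightarrow> w k = 0 \<Longrightarrow> cf f k = 0"
    and S: "\<And>f L. f \<in> F \<Longrightarrow> (\<Sum>k\<in>{n..<L}. (cmod (cf f k))\<^sup>2 / w k) \<le> S"
  shows "\<exists>x W. (\<forall>i<3 * n. x i \<in> space M) \<and>
    (\<forall>f\<in>F. (\<Sum>k<n. (cmod ((\<Sum>i<3 * n. f (x i) * W i k) - cf f k))\<^sup>2) \<le> 70 * S)"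
proof -
  obtain F0 where F0: "countable F0" "F0 \<subseteq> F"
    and dense: "\<forall>f\<in>F. \<forall>(r :: nat) x. (\<forall>i<r. x i \<in> space M) \<longrightarrow>
      (\<exists>g. (\<forall>j::nat. g j \<in> F0) \<and> (\<lambda>j. L2_norm M (g j - f)) \<longlonglongrightarrow> 0 \<and>
        (\<forall>i<r. (\<lambda>j. g j (x i)) \<longlonglongrightarrow> f (x i)))"
    using assumption_A_dense[OF F] by (elim exE conjE) (rule that)
  have "\<exists>x s. (\<forall>i<3 * n. x i \<in> space M \<and> 0 < s i) \<and>
    (\<forall>a. real n * (\<Sum>k<n. (cmod (a k))\<^sup>2) \<le> (\<Sum>i<3 * n. s i * (cmod (\<Sum>k<n. a k * b k (x i)))\<^sup>2)) \<and>
    (\<forall>f\<in>F0. (\<Sum>i<3 * n. s i * (cmod ((f - comb {..<n} (cf f)) (x i)))\<^sup>2) \<le> 70 * real n * S)"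
    by (rule sampling_points[OF n N w F0(1)]) (use F0 F conv wF S in auto)
  then obtain x s where xs: "\<forall>i<3 * n. x i \<in> space M \<and> 0 < s i"
    and lo': "\<forall>a. real n * (\<Sum>k<n. (cmod (a k))\<^sup>2) \<le> (\<Sum>i<3 * n. s i * (cmod (\<Sum>k<n. a k * b k (x i)))\<^sup>2)"
    and up: "\<forall>f\<in>F0. (\<Sum>i<3 * n. s i * (cmod ((f - comb {..<n} (cf f)) (x i)))\<^sup>2) \<le> 70 * real n * S"
    by (elim exE conjE) (rule that)
  have x: "\<forall>i<3 * n. x i \<in> space M" and s: "\<And>i. i < 3 * n \<Longrightarrow> 0 < s i" using xs by auto
  note lo = lo'[rule_format]
  \<comment> \<open>Only finitely many points and coefficients occur, and both converge along the
    approximating sequence, so the estimate carries over from \<open>F0\<close> to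
    \<open>F\<close>.\<close>
  have up': "(\<Sum>i<3 * n. s i * (cmod ((f - comb {..<n} (cf f)) (x i)))\<^sup>2) \<le> 70 * real n * S" if f: "f \<in> F" for f
  proof -
    have "\<exists>g. (\<forall>j::nat. g j \<in> F0) \<and> (\<lambda>j. L2_norm M (g j - f)) \<longlonglongrightarrow> 0 \<and>
        (\<forall>i<3 * n. (\<lambda>j. g j (x i)) \<longlonglongrightarrow> f (x i))"
      using dense f x by simp
    then obtain g where g': "\<forall>j::nat. g j \<in> F0" "(\<lambda>j. L2_norm M (g j - f)) \<longlonglongrightarrow> 0"
      "\<forall>i<3 * n. (\<lambda>j. g j (x i)) \<longlonglongrightarrow> f (x i)"
      by (elim exE conjE) (rule that)
    note g = g'(1)[rule_format] g'(2) g'(3)[rule_format]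
    have "(\<lambda>j. cf (g j) k) \<longlonglongrightarrow> cf f k" for k
    proof (rule LIM_zero_cancel, rule Lim_null_comparison[OF always_eventually g(2)], rule allI)
      fix j
      have gf: "g j \<in> L2 M" "f \<in> L2 M" using g(1) F0 F f by auto
      have "(cmod (cf (g j - f) k))\<^sup>2 \<le> (L2_norm M (g j - f))\<^sup>2"
        using Bessel[of "{k}", OF _ L2_diff[OF gf]] by simp
      then have "cmod (cf (g j - f) k) \<le> L2_norm M (g j - f)"
        by (rule power2_le_imp_le) (rule L2_norm_nonneg)
      then show "norm (cf (g j) k - cf f k) \<le> L2_norm M (g j - f)" by (simp add: cf_diff gf)
    qed
    then have "(\<lambda>j. \<Sum>i<3 * n. s i * (cmod ((g j - comb {..<n} (cf (g j))) (x i)))\<^sup>2)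
      \<longlonglongrightarrow> (\<Sum>i<3 * n. s i * (cmod ((f - comb {..<n} (cf f)) (x i)))\<^sup>2)"
      using g(3) by (auto simp: comb_apply intro!: tendsto_intros)
    then show ?thesis using bspec[OF up g(1)] by (intro LIMSEQ_le_const2) blast+
  qed
  have n0: "0 < real n" using n by simp
  obtain W where W: "\<And>y. real n * (\<Sum>k<n. (cmod (\<Sum>i<3 * n. y i * W i k))\<^sup>2) \<le> (\<Sum>i<3 * n. s i * (cmod (y i))\<^sup>2)"
    "\<And>a k. k < n \<Longrightarrow> (\<Sum>i<3 * n. (\<Sum>j<n. a j * b j (x i)) * W i k) = a k"
    using weighted_least_squares[where r = "3 * n" and s = s and B = "\<lambda>i k. b k (x i)" and c = "real n",
        OF finite_lessThan n0 less_imp_le[OF s] lo] by auto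
  have "(\<Sum>k<n. (cmod ((\<Sum>i<3 * n. f (x i) * W i k) - cf f k))\<^sup>2) \<le> 70 * S" if f: "f \<in> F" for f
  proof -
    have "(\<Sum>i<3 * n. (f - comb {..<n} (cf f)) (x i) * W i k) = (\<Sum>i<3 * n. f (x i) * W i k) - cf f k" if "k < n" for k
      using W(2)[OF that, of "cf f"] by (simp add: comb_apply left_diff_distrib sum_subtractf)
    then have "real n * (\<Sum>k<n. (cmod ((\<Sum>i<3 * n. f (x i) * W i k) - cf f k))\<^sup>2)
      \<le> (\<Sum>i<3 * n. s i * (cmod ((f - comb {..<n} (cf f)) (x i)))\<^sup>2)"
      using W(1)[of "\<lambda>i. (f - comb {..<n} (cf f)) (x i)"] by simp
    also have "\<dots> \<le> real n * (70 * S)" using up'[OF f] by (simp add: mult_ac)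
    finally show ?thesis using n0 by simp
  qed
  then show ?thesis using x by blast
qed

text \<open>\<open>\<delta> l\<close> has two tasks: as a bound on coefficients it controls the
  weighted coefficient sums, and as a bound on projection errors it gives, with the summability, the
  L2 convergence on which the almost everywhere argument rests.\<close>

lemma dyadic_reconstruction:
  fixes \<delta> :: "nat \<Rightarrow> real"
  assumes n: "1 \<le> n" and F: "assumption_A M F" "F \<subseteq> L2 M"
    and d0: "\<And>l. 0 \<le> \<delta> l" and sm: "summable (\<lambda>l. sqrt (2 ^ l) * \<delta> l)"
    and coeff: "\<And>f l A. f \<in> F \<Longrightarrow> finite A \<Longrightarrow> A \<subseteq> {2 ^ l * n..} \<Longrightarrow> (\<Sum>k\<in>A. (cmod (cf f k))\<^sup>2) \<le> (\<delta> l)\<^sup>2"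
    and err: "\<And>f l. f \<in> F \<Longrightarrow> L2_norm M (f - comb {..<2 ^ l * n} (cf f)) \<le> \<delta> l"
  shows "\<exists>x W. (\<forall>i<3 * n. x i \<in> space M) \<and>
    (\<forall>f\<in>F. (\<Sum>k<n. (cmod ((\<Sum>i<3 * n. f (x i) * W i k) - cf f k))\<^sup>2) \<le> 70 * (\<Sum>l. sqrt (2 ^ l) * \<delta> l)\<^sup>2)"
proof -
  define S where "S = (\<Sum>l. sqrt (2 ^ l) * \<delta> l)"
  define N where "N l = 2 ^ l * n" for l :: nat
  \<comment> \<open>The number of the block containing \<open>k\<close>. Indices below
    \<open>n\<close> also get block 0, which is why \<open>w\<close> treats them separately.\<close>
  define blk where "blk k = (LEAST l. k < N (Suc l))" for k
  \<comment> \<open>On a block of \<open>2 ^ l * n\<close> indices this \<open>w\<close> balances the two constraints: the trace is at most \<open>n\<close>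
    and the weighted coefficient sum at most \<open>S\<^sup>2\<close>, without a factor depending on \<open>l\<close>.\<close>
  define w where "w k = (if k < n then 0 else \<delta> (blk k) / (sqrt (2 ^ blk k) * S))" for k
  have S0: "0 \<le> S" unfolding S_def by (intro suminf_nonneg sm) (simp add: d0)
  have part: "(\<Sum>l<L. sqrt (2 ^ l) * \<delta> l) \<le> S" for L
    unfolding S_def by (intro sum_le_suminf sm) (simp_all add: d0)
  have term_le: "sqrt (2 ^ l) * \<delta> l \<le> S" for l
    using sum_le_suminf[OF sm, of "{l}"] d0 by (simp add: S_def)
  have Nl: "l \<le> N l" for l
  proof -
    have "l * 1 \<le> 2 ^ l * n" using n less_exp[of l] by (intro mult_le_mono) simp_all
    then show ?thesis by (simp add: N_def)
  qed
  have Nmono: "N l \<le> N l'" if "l \<le> l'" for l l' using that by (simp add: N_def)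
  have blk: "blk k = l" if "k \<in> {N l..<N (Suc l)}" for k l
    unfolding blk_def
  proof (rule Least_equality)
    fix l' assume "k < N (Suc l')"
    then have "\<not> N (Suc l') \<le> N l" using that by simp
    then have "\<not> Suc l' \<le> l" using Nmono by blast
    then show "l \<le> l'" by simp
  qed (use that in simp)
  have nN: "n \<le> N l" for l by (simp add: N_def)
  have wblk: "w k = \<delta> l / (sqrt (2 ^ l) * S)" if "k \<in> {N l..<N (Suc l)}" for k l
    using blk[OF that] that nN[of l] by (simp add: w_def)
  have w0: "0 \<le> w k" for k by (simp add: w_def d0 S0)
  have w1: "w k \<le> 1" for k
  proof -
    have "\<delta> l / (sqrt (2 ^ l) * S) \<le> 1" for l
    proof (cases "S = 0")
      case False
      then have S: "0 < S" using S0 by simp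
      have "1 \<le> sqrt ((2::real) ^ l)" by simp
      then have "\<delta> l \<le> sqrt (2 ^ l) * \<delta> l" "S \<le> sqrt (2 ^ l) * S"
        using d0[of l] S by (simp_all add: mult_le_cancel_right1)
      then have "\<delta> l \<le> sqrt (2 ^ l) * S" using term_le[of l] by linarith
      then show ?thesis using S by (simp add: pos_divide_le_eq)
    qed simp
    then show ?thesis by (simp add: w_def)
  qed
  have blocks: "(\<Sum>k\<in>{n..<L}. a k) \<le> (\<Sum>l<L. \<Sum>k\<in>{N l..<N (Suc l)}. a k)" if "\<And>k. 0 \<le> a k" for a :: "nat \<Rightarrow> real" and L
  proof -
    have "(\<Sum>k\<in>{n..<N L}. a k) = (\<Sum>l<L. \<Sum>k\<in>{N l..<N (Suc l)}. a k)"
    proof (induction L)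
      case (Suc L)
      have "(\<Sum>k\<in>{n..<N (Suc L)}. a k) = (\<Sum>k\<in>{n..<N L}. a k) + (\<Sum>k\<in>{N L..<N (Suc L)}. a k)"
        by (rule sum.atLeastLessThan_concat[symmetric]) (auto simp: nN Nmono)
      then show ?case using Suc by simp
    qed (simp add: N_def)
    moreover have "(\<Sum>k\<in>{n..<L}. a k) \<le> (\<Sum>k\<in>{n..<N L}. a k)"
      using Nl[of L] that by (intro sum_mono2) auto
    ultimately show ?thesis by simp
  qed
  have wsum: "(\<Sum>k\<in>{n..<L}. w k) \<le> real n" for L
  proof -
    have "(\<Sum>k\<in>{n..<L}. w k) \<le> (\<Sum>l<L. \<Sum>k\<in>{N l..<N (Suc l)}. w k)" by (rule blocks) (rule w0)
    also have "\<dots> = (\<Sum>l<L. real n / S * (sqrt (2 ^ l) * \<delta> l))"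
    proof (intro sum.cong refl)
      fix l
      define r where "r = sqrt ((2::real) ^ l)"
      have r: "0 < r" "real (2 ^ l * n) = r * r * real n" by (simp_all add: r_def)
      have "(\<Sum>k\<in>{N l..<N (Suc l)}. w k) = real (2 ^ l * n) * (\<delta> l / (r * S))"
      proof -
        have "(\<Sum>k\<in>{N l..<N (Suc l)}. w k) = (\<Sum>k\<in>{N l..<N (Suc l)}. \<delta> l / (r * S))"
          unfolding r_def by (intro sum.cong refl wblk)
        then show ?thesis by (simp add: N_def)
      qed
      also have "\<dots> = real n / S * (r * \<delta> l)" unfolding r(2) using r(1) by simp
      finally show "(\<Sum>k\<in>{N l..<N (Suc l)}. w k) = real n / S * (sqrt (2 ^ l) * \<delta> l)"
        by (simp add: r_def)
    qed
    also have "\<dots> = real n / S * (\<Sum>l<L. sqrt (2 ^ l) * \<delta> l)" by (simp add: sum_distrib_left)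
    also have "\<dots> \<le> real n / S * S" using part S0 by (intro mult_left_mono) auto
    also have "\<dots> \<le> real n" by simp
    finally show ?thesis .
  qed
  have cblk: "(\<Sum>k\<in>{N l..<N (Suc l)}. (cmod (cf f k))\<^sup>2) \<le> (\<delta> l)\<^sup>2" if "f \<in> F" for f l
    using that by (intro coeff) (auto simp: N_def)
  have Sf: "(\<Sum>k\<in>{n..<L}. (cmod (cf f k))\<^sup>2 / w k) \<le> S\<^sup>2" if f: "f \<in> F" for f L
  proof -
    have "(\<Sum>k\<in>{n..<L}. (cmod (cf f k))\<^sup>2 / w k) \<le> (\<Sum>l<L. \<Sum>k\<in>{N l..<N (Suc l)}. (cmod (cf f k))\<^sup>2 / w k)"
      by (rule blocks) (simp add: w0)
    also have "\<dots> \<le> (\<Sum>l<L. S * (sqrt (2 ^ l) * \<delta> l))"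
    proof (intro sum_mono)
      fix l
      have "(\<Sum>k\<in>{N l..<N (Suc l)}. (cmod (cf f k))\<^sup>2 / w k)
        = (\<Sum>k\<in>{N l..<N (Suc l)}. (cmod (cf f k))\<^sup>2) * (sqrt (2 ^ l) * S / \<delta> l)"
        unfolding sum_distrib_right
      proof (intro sum.cong refl)
        fix k assume "k \<in> {N l..<N (Suc l)}"
        then show "(cmod (cf f k))\<^sup>2 / w k = (cmod (cf f k))\<^sup>2 * (sqrt (2 ^ l) * S / \<delta> l)"
          by (subst wblk[of _ l]) simp_all
      qed
      also have "\<dots> \<le> (\<delta> l)\<^sup>2 * (sqrt (2 ^ l) * S / \<delta> l)"
        using S0 d0 by (intro mult_right_mono cblk f) auto
      also have "\<dots> = S * (sqrt (2 ^ l) * \<delta> l)" by (simp add: power2_eq_square)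
      finally show "(\<Sum>k\<in>{N l..<N (Suc l)}. (cmod (cf f k))\<^sup>2 / w k) \<le> S * (sqrt (2 ^ l) * \<delta> l)" .
    qed
    also have "\<dots> = S * (\<Sum>l<L. sqrt (2 ^ l) * \<delta> l)" by (simp add: sum_distrib_left)
    also have "\<dots> \<le> S * S" using part S0 by (intro mult_left_mono) auto
    finally show ?thesis by (simp add: power2_eq_square)
  qed
  have wF: "cf f k = 0" if f: "f \<in> F" and k: "n \<le> k" "w k = 0" for f k
  proof -
    have "\<delta> (blk k) = 0"
    proof (cases "S = 0")
      \<comment> \<open>If \<open>S = 0\<close>, the division convention makes \<open>w\<close>
        vanish everywhere, but then all \<open>\<delta> l\<close> are zero too.\<close>
      case True
      show ?thesis
      proof -
        have "0 < sqrt ((2::real) ^ blk k)" by simp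
        moreover have "sqrt (2 ^ blk k) * \<delta> (blk k) \<le> 0" using term_le[of "blk k"] True by simp
        ultimately have "\<delta> (blk k) \<le> 0" by (meson mult_pos_pos not_le)
        then show ?thesis using d0[of "blk k"] by linarith
      qed
    qed (use k in \<open>simp add: w_def\<close>)
    moreover have "N (blk k) \<le> k"
    proof (cases "blk k")
      case (Suc l)
      then have "\<not> k < N (Suc l)" unfolding blk_def by (intro not_less_Least) simp
      then show ?thesis using Suc by simp
    qed (use k in \<open>simp add: N_def\<close>)
    ultimately show ?thesis using coeff[OF f, of "{k}" "blk k"] by (simp add: N_def)
  qed
  have conv: "(\<lambda>l. L2_norm M (f - comb {..<N l} (cf f))) \<longlonglongrightarrow> 0" if f: "f \<in> F" for f
  proof (rule tendsto_sandwich[OF _ _ tendsto_const summable_LIMSEQ_zero[OF sm]])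
    have "L2_norm M (f - comb {..<N l} (cf f)) \<le> sqrt (2 ^ l) * \<delta> l" for l
    proof -
      have "1 * \<delta> l \<le> sqrt (2 ^ l) * \<delta> l" using d0[of l] by (intro mult_right_mono) simp_all
      then show ?thesis using err[OF f, of l] unfolding N_def by linarith
    qed
    then show "\<forall>\<^sub>F l in sequentially. L2_norm M (f - comb {..<N l} (cf f)) \<le> sqrt (2 ^ l) * \<delta> l" by simp
  qed (simp add: L2_norm_nonneg)
  show ?thesis
    unfolding S_def[symmetric]
    by (rule stable_reconstruction[where N = N and w = w])
      (rule n Nl w0 w1 wsum F conv wF Sf; assumption?)+
qed

end

subsection \<open>Errors in the seminorm of \<open>Y\<close>\<close>

lemma seminorm_zero:
  assumes "seminormed_fun_space D Y nY" shows "nY 0 = 0" "0 \<in> Y"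
proof -
  show "0 \<in> Y" using assms by (simp add: seminormed_fun_space_def cfun.subspace_0)
  then have "nY (cscale 0 0) = cmod 0 * nY 0" using assms unfolding seminormed_fun_space_def by blast
  moreover have "cscale 0 0 = (0 :: 'a \<Rightarrow> complex)" by (simp add: fun_eq_iff cscale_apply)
  ultimately show "nY 0 = 0" by simp
qed

lemma seminorm_add:
  "seminormed_fun_space D Y nY \<Longrightarrow> f \<in> Y \<Longrightarrow> g \<in> Y \<Longrightarrow> nY (f + g) \<le> nY f + nY g"
  unfolding seminormed_fun_space_def by blast

lemma seminorm_nonneg: "seminormed_fun_space D Y nY \<Longrightarrow> f \<in> Y \<Longrightarrow> 0 \<le> nY f"
  unfolding seminormed_fun_space_def by blast

lemma seminorm_subspace: "seminormed_fun_space D Y nY \<Longrightarrow> cfun.subspace Y"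
  unfolding seminormed_fun_space_def by blast

lemma seminorm_minus_commute:
  assumes "seminormed_fun_space D Y nY" "f \<in> Y" "g \<in> Y" shows "nY (f - g) = nY (g - f)"
proof -
  have "g - f \<in> Y" using assms by (intro cfun.subspace_diff seminorm_subspace)
  then have "nY (cscale (- 1) (g - f)) = cmod (- 1) * nY (g - f)"
    using assms(1) unfolding seminormed_fun_space_def by blast
  moreover have "cscale (- 1) (g - f) = f - g" by (simp add: fun_eq_iff cscale_apply)
  ultimately show ?thesis by simp
qed

lemma L2_norm_minus_commute: "L2_norm M (f - g) = L2_norm M (g - f)"
  by (simp add: L2_norm_def norm_minus_commute)

context L2_system begin

text \<open>
  The partial sums are Cauchy in \<open>Y \<inter> L2\<close>; their limit agrees with \<open>f\<close> almost everywhere and hence,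
  by Assumption B, up to a function of seminorm zero.
\<close>

lemma seminorm_tail_le:
  fixes N :: "nat \<Rightarrow> nat" and \<beta> :: "nat \<Rightarrow> real"
  assumes Y: "seminormed_fun_space (space M) Y nY" "assumption_B M Y nY"
    and f: "f \<in> Y" "f \<in> L2 M" and comb_Y: "\<And>A a. finite A \<Longrightarrow> comb A a \<in> Y"
    and N: "mono N" and conv: "(\<lambda>l. L2_norm M (f - comb {..<N l} (cf f))) \<longlonglongrightarrow> 0"
    and b: "\<And>l. nY (comb {N l..<N (Suc l)} (cf f)) \<le> \<beta> l" and sm: "summable \<beta>"
  shows "nY (f - comb {..<N 0} (cf f)) \<le> (\<Sum>l. \<beta> l)"
proof -
  define P where "P l = comb {..<N l} (cf f)" for l
  have PY: "P l \<in> Y" for l unfolding P_def by (simp add: comb_Y)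
  have PL: "P l \<in> L2 M" for l unfolding P_def by (rule comb_L2)
  have subY: "g - h \<in> Y" if "g \<in> Y" "h \<in> Y" for g h
    using that by (intro cfun.subspace_diff seminorm_subspace[OF Y(1)])
  have b0: "0 \<le> \<beta> l" for l
    using b[of l] seminorm_nonneg[OF Y(1) comb_Y[of "{N l..<N (Suc l)}" "cf f"]] by simp
  have step: "nY (P (l + k) - P l) \<le> (\<Sum>j\<in>{l..<l + k}. \<beta> j)" for l k
  proof (induction k)
    case 0
    have eq: "P (l + 0) - P l = 0" by (simp add: fun_eq_iff)
    show ?case unfolding eq seminorm_zero(1)[OF Y(1)] by simp
  next
    case (Suc k)
    have "P (l + Suc k) - P (l + k) = comb {N (l + k)..<N (Suc (l + k))} (cf f)"
      unfolding P_def using comb_diff[of "N (l + k)" "N (Suc (l + k))"] N by (simp add: monoD)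
    then have 1: "nY (P (l + Suc k) - P (l + k)) \<le> \<beta> (l + k)" using b by simp
    have "P (l + Suc k) - P l = (P (l + Suc k) - P (l + k)) + (P (l + k) - P l)" by simp
    then have "nY (P (l + Suc k) - P l) \<le> nY (P (l + Suc k) - P (l + k)) + nY (P (l + k) - P l)"
      using seminorm_add[OF Y(1) subY[OF PY PY] subY[OF PY PY]] by metis
    moreover have "(\<Sum>j\<in>{l..<l + Suc k}. \<beta> j) = (\<Sum>j\<in>{l..<l + k}. \<beta> j) + \<beta> (l + k)" by simp
    ultimately show ?case using 1 Suc.IH by linarith
  qed
  \<comment> \<open>A difference of partial sums uses only coefficients from \<open>N l\<close> on,
    so the remainder of \<open>f\<close> bounds it uniformly in \<open>k\<close>.\<close>
  have L2step: "L2_norm M (P (l + k) - P l) \<le> L2_norm M (f - P l)" for l k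
  proof -
    have le: "N l \<le> N (l + k)" using N by (simp add: monoD)
    have "(L2_norm M (P (l + k) - P l))\<^sup>2 = (\<Sum>k\<in>{N l..<N (l + k)}. (cmod (cf f k))\<^sup>2)"
      unfolding P_def comb_diff[OF le] by (rule comb_norm) simp
    also have "\<dots> \<le> (L2_norm M (f - P l))\<^sup>2"
      unfolding P_def by (rule coefficients_le_dist[OF f(2) comb_in_span]) auto
    finally show ?thesis by (rule power2_le_imp_le) (rule L2_norm_nonneg)
  qed
  define p where "p g = nY g + L2_norm M g" for g
  have "\<exists>K. \<forall>i\<ge>K. \<forall>j\<ge>K. p (P i - P j) < e" if e: "0 < e" for e
  proof -
    obtain K1 where K1: "\<And>m n. K1 \<le> m \<Longrightarrow> norm (\<Sum>j\<in>{m..<n}. \<beta> j) < e / 2"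
      using summable_Cauchy[THEN iffD1, OF sm, rule_format, of "e / 2"] e by auto
    obtain K2 where K2: "\<And>l. K2 \<le> l \<Longrightarrow> L2_norm M (f - P l) < e / 2"
      using order_tendstoD(2)[OF conv, of "e / 2"] e by (auto simp: eventually_sequentially P_def)
    have main: "p (P (l + k) - P l) < e" if "max K1 K2 \<le> l" for l k
    proof -
      have "nY (P (l + k) - P l) < e / 2" using step[of l k] K1[of l "l + k"] that by auto
      moreover have "L2_norm M (P (l + k) - P l) < e / 2" using L2step[of l k] K2[of l] that by auto
      ultimately show ?thesis by (simp add: p_def)
    qed
    have "p (P i - P j) < e" if "max K1 K2 \<le> i" "max K1 K2 \<le> j" for i j
    proof (cases "j \<le> i")
      case True
      then show ?thesis using main[OF that(2), of "i - j"] by simp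
    next
      case False
      have "p (P i - P j) = p (P j - P i)"
        unfolding p_def using seminorm_minus_commute[OF Y(1) PY PY] L2_norm_minus_commute by metis
      then show ?thesis using main[OF that(1), of "j - i"] False by simp
    qed
    then show ?thesis by blast
  qed
  moreover have "\<forall>l. P l \<in> Y \<inter> L2 M" using PY PL by blast
  moreover have "seminorm_complete (Y \<inter> L2 M) p"
    using Y(2) unfolding assumption_B_def p_def by blast
  ultimately obtain h where h: "h \<in> Y" "h \<in> L2 M" "(\<lambda>l. p (P l - h)) \<longlonglongrightarrow> 0"
    unfolding seminorm_complete_def by blast
  have nn: "0 \<le> nY (P l - h)" for l by (rule seminorm_nonneg[OF Y(1) subY[OF PY h(1)]])
  have hY: "(\<lambda>l. nY (P l - h)) \<longlonglongrightarrow> 0"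
    by (rule tendsto_sandwich[OF _ _ tendsto_const h(3)]) (simp_all add: p_def nn L2_norm_nonneg)
  have hL: "(\<lambda>l. L2_norm M (P l - h)) \<longlonglongrightarrow> 0"
    by (rule tendsto_sandwich[OF _ _ tendsto_const h(3)]) (simp_all add: p_def nn L2_norm_nonneg)
  have "(L2_norm M (f - h))\<^sup>2 \<le> 2 * (L2_norm M (f - P l))\<^sup>2 + 2 * (L2_norm M (P l - h))\<^sup>2" for l
    using L2_norm_add_squared_le[OF L2_diff[OF f(2) PL[of l]] L2_diff[OF PL[of l] h(2)]] by simp
  moreover have "(\<lambda>l. 2 * (L2_norm M (f - P l))\<^sup>2 + 2 * (L2_norm M (P l - h))\<^sup>2) \<longlonglongrightarrow> 2 * 0\<^sup>2 + 2 * 0\<^sup>2"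
    using conv hL unfolding P_def by (intro tendsto_intros)
  ultimately have "(L2_norm M (f - h))\<^sup>2 \<le> 0"
    by (intro LIMSEQ_le_const[of _ "2 * 0\<^sup>2 + 2 * 0\<^sup>2 :: real", simplified]) auto
  then have "L2_norm M (f - h) = 0" by simp
  \<comment> \<open>Phrased with the zero function because Assumption B compares two members of
    \<open>Y\<close>.\<close>
  then have "AE x in M. (f - h) x = (0 :: 'a \<Rightarrow> complex) x"
    using L2_norm_eq_zero_AE[OF L2_diff[OF f(2) h(2)]] by simp
  then have fh: "nY (f - h) = 0"
    using Y(2) subY[OF f(1) h(1)] seminorm_zero[OF Y(1)] unfolding assumption_B_def by metis
  have "nY (f - P 0) \<le> nY (P l - h) + (\<Sum>l. \<beta> l)" for l
  proof -
    have "f - P 0 = (f - h) + ((h - P l) + (P l - P 0))" by simp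
    then have "nY (f - P 0) \<le> nY (f - h) + nY ((h - P l) + (P l - P 0))"
      using seminorm_add[OF Y(1) subY[OF f(1) h(1)]] cfun.subspace_add[OF seminorm_subspace[OF Y(1)] subY[OF h(1) PY] subY[OF PY PY]]
      by metis
    also have "\<dots> \<le> nY (f - h) + (nY (h - P l) + nY (P l - P 0))"
      by (intro add_left_mono seminorm_add[OF Y(1)] subY h(1) PY)
    also have "nY (h - P l) = nY (P l - h)" by (rule seminorm_minus_commute[OF Y(1) h(1) PY])
    also have "nY (P l - P 0) \<le> (\<Sum>j\<in>{0..<l}. \<beta> j)" using step[of 0 l] by simp
    also have "\<dots> \<le> (\<Sum>l. \<beta> l)" by (intro sum_le_suminf sm) (auto simp: b0)
    finally show ?thesis using fh by linarith
  qed
  moreover have "(\<lambda>l. nY (P l - h) + (\<Sum>l. \<beta> l)) \<longlonglongrightarrow> 0 + (\<Sum>l. \<beta> l)"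
    by (intro tendsto_add hY tendsto_const)
  ultimately have "nY (f - P 0) \<le> 0 + (\<Sum>l. \<beta> l)"
    by (intro LIMSEQ_le_const) auto
  then show ?thesis by (simp add: P_def)
qed

text \<open>In product form, so that \<open>Lambda\<close> may be infinite. If the L2 norm is zero,
  orthonormality makes all coefficients vanish: the combination is then the zero function itself,
  not merely zero almost everywhere.\<close>

lemma seminorm_le_Lambda:
  assumes Y: "seminormed_fun_space (space M) Y nY"
    and A: "finite A" "A \<subseteq> {..<N}" and V: "V = cfun.span (b ` {..<N})"
  shows "ennreal (nY (comb A a)) \<le> Lambda M nY V * ennreal (L2_norm M (comb A a))"
proof (cases "L2_norm M (comb A a) = 0")
  case True
  then have "(\<Sum>k\<in>A. (cmod (a k))\<^sup>2) = 0" using comb_norm[OF A(1), of a] by simp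
  then have "\<forall>k\<in>A. a k = 0" using A(1) by (simp add: sum_nonneg_eq_0_iff)
  then have "comb A a = 0" by (simp add: fun_eq_iff comb_apply)
  then show ?thesis using seminorm_zero[OF Y] by simp
next
  case False
  then have pos: "0 < L2_norm M (comb A a)" using L2_norm_nonneg[of M "comb A a"] by simp
  have "comb A a \<noteq> 0" using False by (auto simp: L2_norm_def)
  moreover have "comb A a \<in> V" unfolding V by (rule comb_in_span[OF A(2)])
  ultimately have "ennreal (nY (comb A a) / L2_norm M (comb A a)) \<le> Lambda M nY V"
    unfolding Lambda_def by (intro SUP_upper) auto
  then have "ennreal (nY (comb A a) / L2_norm M (comb A a)) * ennreal (L2_norm M (comb A a))
    \<le> Lambda M nY V * ennreal (L2_norm M (comb A a))" by (intro mult_right_mono) auto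
  moreover have "ennreal (nY (comb A a) / L2_norm M (comb A a)) * ennreal (L2_norm M (comb A a)) = ennreal (nY (comb A a))"
    using pos by (subst ennreal_mult''[symmetric]) auto
  ultimately show ?thesis by simp
qed

lemma projection_error_le_dist:
  assumes "f \<in> F" "F \<subseteq> L2 M" "V = cfun.span (b ` {..<N})"
  shows "ennreal (L2_norm M (f - comb {..<N} (cf f))) \<le> L2_dist M F V"
proof -
  have "ennreal (L2_norm M (f - comb {..<N} (cf f))) \<le> (INF g\<in>V. ennreal (L2_norm M (f - g)))"
    using assms by (intro INF_greatest ennreal_leI best_approximation) auto
  also have "\<dots> \<le> L2_dist M F V" unfolding L2_dist_def using assms(1) by (rule SUP_upper)
  finally show ?thesis .
qed

end

section \<open>Comparison of dyadic sums with the series\<close>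

lemma L2_dist_antimono: "V \<subseteq> W \<Longrightarrow> L2_dist M F W \<le> L2_dist M F V"
  unfolding L2_dist_def by (intro SUP_mono') (auto intro: INF_superset_mono)

lemma Lambda_mono: "V \<subseteq> W \<Longrightarrow> Lambda M nY V \<le> Lambda M nY W"
  unfolding Lambda_def by (intro SUP_subset_mono) auto

text \<open>The block 2^l m < k <= 2^(l+1) m has exactly 2^l m members, and these blocks are
  disjoint and lie beyond \<open>m\<close>.\<close>

lemma dyadic_sum_le_infsum:
  fixes a c :: "nat \<Rightarrow> ennreal"
  assumes ac: "\<And>l k. 2 ^ l * m < k \<Longrightarrow> k \<le> 2 ^ Suc l * m \<Longrightarrow> c l \<le> a k"
  shows "(\<Sum>l. of_nat (2 ^ l * m) * c l) \<le> infsum a {m<..}"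
proof (rule suminf_le_const)
  fix L
  have "(\<Sum>l<L. of_nat (2 ^ l * m) * c l) \<le> sum a {m<..2 ^ L * m}"
  proof (induction L)
    case (Suc L)
    have "(\<Sum>k\<in>{2 ^ L * m<..2 ^ Suc L * m}. c L) \<le> sum a {2 ^ L * m<..2 ^ Suc L * m}"
      using ac by (intro sum_mono) auto
    then have "of_nat (2 ^ L * m) * c L \<le> sum a {2 ^ L * m<..2 ^ Suc L * m}" by (simp add: mult_ac)
    moreover have "sum a {m<..2 ^ Suc L * m} = sum a {m<..2 ^ L * m} + sum a {2 ^ L * m<..2 ^ Suc L * m}"
      by (subst sum.union_disjoint[symmetric]) (auto intro!: sum.cong simp: le_less_trans[of m "2 ^ L * m"])
    ultimately show ?case using Suc by (simp add: add_mono)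
  qed simp
  also have "\<dots> = infsum a {m<..2 ^ L * m}" by simp
  also have "\<dots> \<le> infsum a {m<..}"
    by (rule infsum_mono_neutral) (auto intro: nonneg_summable_on_complete)
  finally show "(\<Sum>l<L. of_nat (2 ^ l * m) * c l) \<le> infsum a {m<..}" .
qed simp

lemma divide_ennreal_eq_mult: "0 < s \<Longrightarrow> x / ennreal s = x * ennreal (1 / s)"
  by (simp add: divide_ennreal_def inverse_ennreal inverse_eq_divide)

lemma lin_sampling_number_le:
  assumes "\<And>i. i < n \<Longrightarrow> x i \<in> D" "\<And>i. i < n \<Longrightarrow> \<phi> i \<in> Y"
    and "\<And>f. f \<in> F \<Longrightarrow> ennreal (nY (f - (\<Sum>i<n. cscale (f (x i)) (\<phi> i)))) \<le> B"
  shows "lin_sampling_number D n F Y nY \<le> B"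
proof -
  have "(SUP f\<in>F. ennreal (nY (f - (\<Sum>i<n. cscale (f (x i)) (\<phi> i))))) \<le> B"
    using assms(3) by (rule SUP_least)
  then show ?thesis
    unfolding lin_sampling_number_def
    using assms(1,2) by (intro INF_lower2[of x] INF_lower2[of \<phi>]) auto
qed

section \<open>Assembly of the error bound\<close>

lemma sampling_number_bound:
  fixes M :: "'a measure"
  assumes F: "F \<subseteq> L2 M" "assumption_A M F" and Y: "seminormed_fun_space (space M) Y nY" "assumption_B M Y nY"
    and FY: "F \<subseteq> Y" and V: "nested_subspaces M V" and VY: "\<And>m. 1 \<le> m \<Longrightarrow> V m \<subseteq> Y \<inter> L2 M"
    and nd: "(\<exists>k\<ge>1. Lambda M nY (V k) > 0) \<or> (\<lambda>k. L2_dist M F (V k)) \<longlonglongrightarrow> 0"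
    and m: "1 \<le> m"
  shows "lin_sampling_number (space M) (6 * m) F Y nY
    \<le> 20 * (\<Sum>\<^sub>\<infinity>k\<in>{m<..}.
               L2_dist M F (V k) / ennreal (sqrt (real k)) *
               max (Lambda M nY (V (4 * k)) / ennreal (sqrt (real k)))
                   (Lambda M nY (V (4 * m)) / ennreal (sqrt (real m))))"
proof -
  obtain b where b: "orthonormal_system M b" and Vspan: "\<And>m. 1 \<le> m \<Longrightarrow> V m = cfun.span (b ` {..<m})"
    using V unfolding nested_subspaces_def by blast
  interpret L2_system M b by standard (rule b)
  define d where "d k = L2_dist M F (V k)" for k
  define Lm where "Lm k = Lambda M nY (V k)" for k
  define a where "a k = d k / ennreal (sqrt (real k)) *
     max (Lm (4 * k) / ennreal (sqrt (real k))) (Lm (4 * m) / ennreal (sqrt (real m)))" for k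
  define T where "T = infsum a {m<..}"
  define n where "n = 2 * m"
  define N where "N l = 2 ^ l * n" for l :: nat
  have n: "1 \<le> n" using m by (simp add: n_def)
  have N1: "1 \<le> N l" for l using n by (simp add: N_def)
  have Nl: "l \<le> N l" for l
  proof -
    have "l * 1 \<le> 2 ^ l * n" using n less_exp[of l] by (intro mult_le_mono) simp_all
    then show ?thesis by (simp add: N_def)
  qed
  have N0: "N 0 = n" by (simp add: N_def)
  have Nmono: "mono N" unfolding N_def by (intro monoI mult_le_mono power_increasing) auto
  have Vmono: "V j \<subseteq> V k" if "1 \<le> j" "j \<le> k" for j k
    using that by (simp add: Vspan) (intro cfun.span_mono image_mono, simp)
  have dmono: "d k \<le> d j" if "1 \<le> j" "j \<le> k" for j k
    unfolding d_def by (intro L2_dist_antimono Vmono that)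
  have Lmono: "Lm j \<le> Lm k" if "1 \<le> j" "j \<le> k" for j k
    unfolding Lm_def by (intro Lambda_mono Vmono that)
  have comb_Y: "comb A c \<in> Y" if "finite A" for A c
  proof -
    have "A \<subseteq> {..<Suc (Max A)}" using that by (auto simp: less_Suc_eq_le)
    from comb_in_span[OF this] have "comb A c \<in> V (Suc (Max A))" by (simp add: Vspan)
    then show ?thesis using VY[of "Suc (Max A)"] by auto
  qed
  have rN: "real (N l) = 2 * (2 ^ l * real m)" for l by (simp add: N_def n_def)
  \<comment> \<open>This sum pays for f - P f in the seminorm of \<open>Y\<close>. Block l has 2^l m
    indices, each with a factor at least 1 / N l = 1 / (2 * 2^l m); hence the 2.\<close>
  have sumA: "(\<Sum>l. Lm (N (Suc l)) * d (N l)) \<le> 2 * T"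
  proof -
    define c where "c l = d (N l) * ennreal (1 / sqrt (real (N l))) * (Lm (2 * N l) * ennreal (1 / sqrt (real (N l))))" for l
    have "c l \<le> a k" if k: "2 ^ l * m < k" "k \<le> 2 ^ Suc l * m" for l k
    proof -
      have k1: "1 \<le> k" "k \<le> N l" "2 * N l \<le> 4 * k" "1 \<le> 2 * N l" using k N1[of l] by (auto simp: N_def n_def)
      have sk: "0 < sqrt (real k)" using k1 by simp
      have le: "1 / sqrt (real (N l)) \<le> 1 / sqrt (real k)" using k1 by (intro divide_left_mono) auto
      have "c l \<le> d k * ennreal (1 / sqrt (real k)) * (Lm (4 * k) * ennreal (1 / sqrt (real k)))"
        unfolding c_def by (intro mult_mono ennreal_leI le dmono Lmono k1) auto
      also have "\<dots> \<le> a k"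
        unfolding a_def divide_ennreal_eq_mult[OF sk] by (intro mult_left_mono max.cobounded1) auto
      finally show ?thesis .
    qed
    then have "(\<Sum>l. of_nat (2 ^ l * m) * c l) \<le> T" unfolding T_def by (rule dyadic_sum_le_infsum)
    moreover have "Lm (N (Suc l)) * d (N l) = 2 * (of_nat (2 ^ l * m) * c l)" for l
    proof -
      define s where "s = sqrt (real (N l))"
      have s: "0 < s" "s * s = real (N l)" unfolding s_def using N1[of l] by simp_all
      define q where "q = 2 ^ l * real m"
      have q: "0 \<le> q" "s * s = 2 * q" unfolding s(2) rN q_def by simp_all
      have "(of_nat (2 ^ l * m) :: ennreal) = ennreal q"
        by (simp add: q_def ennreal_of_nat_eq_real_of_nat[symmetric] ennreal_mult ennreal_power[symmetric])
      moreover have "2 * N l = N (Suc l)" by (simp add: N_def)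
      moreover have "2 * (ennreal q * (x * ennreal (1 / s) * (y * ennreal (1 / s)))) = y * x" for x y
      proof -
        have "2 * (ennreal q * (x * ennreal (1 / s) * (y * ennreal (1 / s)))) = y * x * (ennreal 2 * ennreal q * ennreal (1 / s) * ennreal (1 / s))"
          by (simp add: mult_ac)
        also have "ennreal 2 * ennreal q * ennreal (1 / s) * ennreal (1 / s) = ennreal (2 * q * (1 / s) * (1 / s))"
          using q s by (simp only: ennreal_mult'' ennreal_mult zero_le_divide_1_iff less_imp_le zero_le_numeral mult_nonneg_nonneg)
        also have "2 * q * (1 / s) * (1 / s) = 1" unfolding q(2)[symmetric] using s(1) by simp
        finally show ?thesis by simp
      qed
      ultimately show ?thesis unfolding c_def s_def[symmetric] by simp
    qed
    ultimately show ?thesis by (simp add: ennreal_suminf_cmult mult_left_mono)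
  qed
  \<comment> \<open>This sum pays for the least squares error; infinite values are still allowed.
    The computation gives the factor sqrt 2, which is rounded up to 2.\<close>
  have sumB: "Lm (4 * m) * (\<Sum>l. ennreal (sqrt (2 ^ l)) * d (N l)) \<le> 2 * T"
  proof -
    define c where "c l = d (N l) * ennreal (1 / sqrt (real (N l))) * (Lm (4 * m) * ennreal (1 / sqrt (real m)))" for l
    have sm: "0 < sqrt (real m)" using m by simp
    have "c l \<le> a k" if k: "2 ^ l * m < k" "k \<le> 2 ^ Suc l * m" for l k
    proof -
      have k1: "1 \<le> k" "k \<le> N l" using k by (auto simp: N_def n_def)
      have sk: "0 < sqrt (real k)" using k1 by simp
      have le: "1 / sqrt (real (N l)) \<le> 1 / sqrt (real k)" using k1 by (intro divide_left_mono) auto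
      have "c l \<le> d k * ennreal (1 / sqrt (real k)) * (Lm (4 * m) * ennreal (1 / sqrt (real m)))"
        unfolding c_def by (intro mult_mono ennreal_leI le dmono k1) auto
      also have "\<dots> \<le> a k"
        unfolding a_def divide_ennreal_eq_mult[OF sk] divide_ennreal_eq_mult[OF sm]
        by (intro mult_left_mono max.cobounded2) auto
      finally show ?thesis .
    qed
    then have le: "(\<Sum>l. of_nat (2 ^ l * m) * c l) \<le> T" unfolding T_def by (rule dyadic_sum_le_infsum)
    have "Lm (4 * m) * (ennreal (sqrt (2 ^ l)) * d (N l)) \<le> 2 * (of_nat (2 ^ l * m) * c l)" for l
    proof -
      define r where "r = sqrt ((2::real) ^ l)"
      define t where "t = sqrt (real m)"
      have r: "0 < r" "r * r = 2 ^ l" by (simp_all add: r_def)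
      have t: "0 < t" "t * t = real m" using m by (simp_all add: t_def)
      define s where "s = sqrt (real (N l))"
      have s: "s = sqrt 2 * r * t" unfolding s_def rN r_def t_def by (simp add: real_sqrt_mult)
      have s0: "0 < s" unfolding s using r t by simp
      define q where "q = r * r * (t * t)"
      have q0: "0 \<le> q" by (simp add: q_def)
      have "(of_nat (2 ^ l * m) :: ennreal) = ennreal q"
        unfolding q_def r t
        by (simp add: ennreal_of_nat_eq_real_of_nat[symmetric] ennreal_mult ennreal_power[symmetric])
      moreover have "2 * (ennreal q * (x * ennreal (1 / s) * (y * ennreal (1 / t)))) = y * (ennreal (2 * q * (1 / s) * (1 / t)) * x)" for x y
      proof -
        have "ennreal (2 * q * (1 / s) * (1 / t)) = ennreal 2 * ennreal q * ennreal (1 / s) * ennreal (1 / t)"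
          using q0 s0 t(1) by (simp only: ennreal_mult'' ennreal_mult zero_le_divide_1_iff less_imp_le zero_le_numeral mult_nonneg_nonneg)
        then show ?thesis by (simp add: mult_ac)
      qed
      moreover have "r \<le> 2 * q * (1 / s) * (1 / t)"
      proof -
        have "2 * q * (1 / s) * (1 / t) = r * (2 / sqrt 2)"
          unfolding q_def s using r(1) t(1) by (simp add: field_simps)
        moreover have "1 \<le> 2 / sqrt 2" using real_sqrt_le_mono[of 2 4] by (simp add: real_le_rsqrt)
        ultimately show ?thesis using mult_left_mono[of 1 "2 / sqrt 2" r] r(1) by linarith
      qed
      ultimately show ?thesis
        unfolding c_def s_def[symmetric] t_def[symmetric] r_def[symmetric]
        by (auto intro!: mult_left_mono mult_right_mono ennreal_leI)
    qed
    then have "(\<Sum>l. Lm (4 * m) * (ennreal (sqrt (2 ^ l)) * d (N l))) \<le> (\<Sum>l. 2 * (of_nat (2 ^ l * m) * c l))"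
      by (intro suminf_le) auto
    then have "Lm (4 * m) * (\<Sum>l. ennreal (sqrt (2 ^ l)) * d (N l)) \<le> 2 * (\<Sum>l. of_nat (2 ^ l * m) * c l)"
      by (simp only: ennreal_suminf_cmult)
    also have "\<dots> \<le> 2 * T" using le by (intro mult_left_mono) auto
    finally show ?thesis .
  qed
  have goal: "lin_sampling_number (space M) (6 * m) F Y nY \<le> 20 * T"
  proof (cases "T = top")
    case True then show ?thesis by (simp add: ennreal_mult_top)
  next
    case False
    then have T2: "2 * T < top" by (simp add: ennreal_mult_less_top less_top)
    define \<beta> where "\<beta> l = enn2real (Lm (N (Suc l)) * d (N l))" for l
    have fin: "Lm (N (Suc l)) * d (N l) < top" for l
    proof -
      have "Lm (N (Suc l)) * d (N l) \<le> (\<Sum>l. Lm (N (Suc l)) * d (N l))"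
        using sum_le_suminf[OF _ finite.insertI[OF finite.emptyI], of "\<lambda>l. Lm (N (Suc l)) * d (N l)" l] by simp
      then show ?thesis using sumA T2 by (meson le_less_trans)
    qed
    then have \<beta>: "ennreal (\<beta> l) = Lm (N (Suc l)) * d (N l)" for l by (simp add: \<beta>_def)
    have \<beta>0: "0 \<le> \<beta> l" for l by (simp add: \<beta>_def)
    have sumfin: "(\<Sum>l. ennreal (\<beta> l)) \<le> 2 * T" unfolding \<beta> by (rule sumA)
    then have "(\<Sum>l. ennreal (\<beta> l)) \<noteq> top" using T2 by (metis leD)
    then have sm\<beta>: "summable \<beta>" using \<beta>0 by (intro summable_suminf_not_top)
    have sum\<beta>: "ennreal (\<Sum>l. \<beta> l) \<le> 2 * T" using sumfin by (simp add: suminf_ennreal2[OF \<beta>0 sm\<beta>])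
    have err: "ennreal (L2_norm M (f - comb {..<N l} (cf f))) \<le> d (N l)" if "f \<in> F" for f l
      unfolding d_def by (rule projection_error_le_dist[OF that F(1) Vspan[OF N1]])
    \<comment> \<open>Finiteness of \<open>T\<close> controls only products of \<open>Lm\<close> and
      \<open>d\<close>. A positive \<open>Lm k\<close> bounds all later ones from below, so the
      summable \<open>\<beta>\<close> forces the remainders to zero; otherwise the second
      alternative of \<open>nd\<close> supplies the convergence.\<close>
    have conv: "(\<lambda>l. L2_norm M (f - comb {..<N l} (cf f))) \<longlonglongrightarrow> 0" if f: "f \<in> F" for f
      using nd
    proof
      assume "\<exists>k\<ge>1. Lambda M nY (V k) > 0"
      then obtain k where k: "1 \<le> k" "0 < Lm k" by (auto simp: Lm_def)
      \<comment> \<open>\<open>Lm k\<close> may be infinite, hence a positive real below it.\<close>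
      obtain r where r: "0 < r" "ennreal r \<le> Lm k"
      proof (cases "Lm k")
        case (real r)
        then show thesis using k that[of r] by simp
      next
        case top
        then show thesis using that[of 1] by simp
      qed
      have "norm (L2_norm M (f - comb {..<N l} (cf f))) \<le> \<beta> l / r" if l: "k \<le> l" for l
      proof -
        have "k \<le> N (Suc l)" using l Nl[of "Suc l"] by linarith
        then have "ennreal r * ennreal (L2_norm M (f - comb {..<N l} (cf f))) \<le> Lm (N (Suc l)) * d (N l)"
          using r(2) Lmono[OF k(1)] by (intro mult_mono err[OF f]) (auto intro: order_trans)
        then have "ennreal (r * L2_norm M (f - comb {..<N l} (cf f))) \<le> ennreal (\<beta> l)"
          using r(1) by (simp add: \<beta> ennreal_mult L2_norm_nonneg)
        then have "r * L2_norm M (f - comb {..<N l} (cf f)) \<le> \<beta> l" using \<beta>0 by (simp add: ennreal_le_iff)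
        then show ?thesis using r(1) by (simp add: pos_le_divide_eq mult.commute L2_norm_nonneg)
      qed
      then have ev: "\<forall>\<^sub>F l in sequentially. norm (L2_norm M (f - comb {..<N l} (cf f))) \<le> \<beta> l / r"
        by (auto simp: eventually_sequentially)
      have "(\<lambda>l. \<beta> l / r) \<longlonglongrightarrow> 0 / r" using r(1) by (intro tendsto_divide summable_LIMSEQ_zero sm\<beta>) auto
      then show ?thesis using Lim_null_comparison[OF ev] by simp
    next
      assume lim: "(\<lambda>k. L2_dist M F (V k)) \<longlonglongrightarrow> 0"
      have "filterlim N at_top sequentially"
        using Nl by (intro filterlim_at_top_mono[OF filterlim_ident]) auto
      from filterlim_compose[OF lim this] have dN: "(\<lambda>l. d (N l)) \<longlonglongrightarrow> 0" by (simp add: d_def)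
      show ?thesis
      proof (rule tendstoI)
        fix e :: real assume e: "0 < e"
        then have "\<forall>\<^sub>F l in sequentially. d (N l) < ennreal e" using order_tendstoD(2)[OF dN, of "ennreal e"] by simp
        then show "\<forall>\<^sub>F l in sequentially. dist (L2_norm M (f - comb {..<N l} (cf f))) 0 < e"
        proof eventually_elim
          case (elim l)
          then have "ennreal (L2_norm M (f - comb {..<N l} (cf f))) < ennreal e" using err[OF f, of l] by (rule le_less_trans[rotated])
          then show ?case by (simp add: ennreal_less_iff L2_norm_nonneg)
        qed
      qed
    qed
    have tail: "ennreal (nY (f - comb {..<n} (cf f))) \<le> 2 * T" if f: "f \<in> F" for f
    proof -
      have fL: "f \<in> L2 M" and fY: "f \<in> Y" using f F FY by auto
      have "nY (comb {N l..<N (Suc l)} (cf f)) \<le> \<beta> l" for l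
      proof -
        have "(L2_norm M (comb {N l..<N (Suc l)} (cf f)))\<^sup>2 \<le> (L2_norm M (f - comb {..<N l} (cf f)))\<^sup>2"
          unfolding comb_norm[OF finite_atLeastLessThan] by (rule coefficients_le_dist[OF fL comb_in_span]) auto
        then have "L2_norm M (comb {N l..<N (Suc l)} (cf f)) \<le> L2_norm M (f - comb {..<N l} (cf f))"
          by (rule power2_le_imp_le) (rule L2_norm_nonneg)
        then have "ennreal (L2_norm M (comb {N l..<N (Suc l)} (cf f))) \<le> d (N l)"
          using err[OF f, of l] by (meson ennreal_leI order_trans)
        then have "Lm (N (Suc l)) * ennreal (L2_norm M (comb {N l..<N (Suc l)} (cf f))) \<le> ennreal (\<beta> l)"
          unfolding \<beta> by (intro mult_left_mono) auto
        moreover have "ennreal (nY (comb {N l..<N (Suc l)} (cf f)))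
          \<le> Lm (N (Suc l)) * ennreal (L2_norm M (comb {N l..<N (Suc l)} (cf f)))"
          unfolding Lm_def by (rule seminorm_le_Lambda[OF Y(1) _ _ Vspan[OF N1]]) auto
        ultimately have "ennreal (nY (comb {N l..<N (Suc l)} (cf f))) \<le> ennreal (\<beta> l)" by (rule order_trans[rotated])
        then show ?thesis using \<beta>0 by (simp add: ennreal_le_iff)
      qed
      from seminorm_tail_le[OF Y fY fL comb_Y Nmono conv[OF f] this sm\<beta>]
      have "nY (f - comb {..<n} (cf f)) \<le> (\<Sum>l. \<beta> l)" unfolding N0 .
      then show ?thesis using sum\<beta> by (meson ennreal_leI order_trans)
    qed
    have subY: "g - h \<in> Y" if "g \<in> Y" "h \<in> Y" for g h
      using that by (intro cfun.subspace_diff seminorm_subspace[OF Y(1)])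
    \<comment> \<open>Arbitrary coefficients \<open>c\<close>, since both cases below use it:
      \<open>c\<close> is zero if \<open>Lm n\<close> vanishes and comes from least squares
      otherwise.\<close>
    have split: "ennreal (nY (f - comb {..<n} c)) \<le> 2 * T + Lm n * ennreal (L2_norm M (comb {..<n} (\<lambda>k. cf f k - c k)))"
      if f: "f \<in> F" for f c
    proof -
      have eq: "f - comb {..<n} c = (f - comb {..<n} (cf f)) + comb {..<n} (\<lambda>k. cf f k - c k)"
        by (simp add: fun_eq_iff comb_apply left_diff_distrib sum_subtractf)
      have 1: "f - comb {..<n} (cf f) \<in> Y" using f FY by (intro subY comb_Y) auto
      have 2: "comb {..<n} (\<lambda>k. cf f k - c k) \<in> Y" by (rule comb_Y) simp
      have "ennreal (nY (f - comb {..<n} c)) \<le> ennreal (nY (f - comb {..<n} (cf f)) + nY (comb {..<n} (\<lambda>k. cf f k - c k)))"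
        unfolding eq by (intro ennreal_leI seminorm_add[OF Y(1) 1 2])
      also have "\<dots> = ennreal (nY (f - comb {..<n} (cf f))) + ennreal (nY (comb {..<n} (\<lambda>k. cf f k - c k)))"
        by (intro ennreal_plus seminorm_nonneg[OF Y(1)] 1 2)
      also have "\<dots> \<le> 2 * T + Lm n * ennreal (L2_norm M (comb {..<n} (\<lambda>k. cf f k - c k)))"
        unfolding Lm_def by (intro add_mono tail[OF f] seminorm_le_Lambda[OF Y(1) _ _ Vspan[OF n]]) auto
      finally show ?thesis .
    qed
    show ?thesis
    proof (cases "Lm n = 0")
      \<comment> \<open>As 0 times infinity is 0, \<open>sumB\<close> may say nothing about the
        distances here. But the seminorm of \<open>Y\<close> vanishes on \<open>V n\<close>, so
        approximation by zero is good enough. It still needs a point to serve as node, which exists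
        because \<open>b 0\<close> has norm 1.\<close>
      case True
      have "\<exists>y. y \<in> space M"
      proof (rule ccontr)
        assume "\<nexists>y. y \<in> space M"
        then have "space M = {}" by auto
        then have "(LINT x|M. (cmod (b 0 x))\<^sup>2) = 0" by (rule Bochner_Integration.integral_empty)
        then show False using b_squared(2)[of 0] by simp
      qed
      then obtain y where y: "y \<in> space M" ..
      show ?thesis
      proof (rule lin_sampling_number_le[where x = "\<lambda>_. y" and \<phi> = "\<lambda>_. 0"])
        fix f assume f: "f \<in> F"
        have "f - (\<Sum>i<6 * m. cscale (f y) 0) = f - comb {..<n} (\<lambda>_. 0)"
          by (simp add: fun_eq_iff comb_apply sum_apply_fun cscale_apply)
        then have "ennreal (nY (f - (\<Sum>i<6 * m. cscale (f y) 0))) \<le> 2 * T"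
          using split[OF f, of "\<lambda>_. 0"] True by simp
        also have "\<dots> \<le> 20 * T" by (intro mult_right_mono) auto
        finally show "ennreal (nY (f - (\<Sum>i<6 * m. cscale (f y) 0))) \<le> 20 * T" .
      qed (use y seminorm_zero[OF Y(1)] in auto)
    next
      case False
      have L4: "Lm n \<le> Lm (4 * m)" using m by (intro Lmono) (auto simp: n_def)
      have sB: "Lm n * (\<Sum>l. ennreal (sqrt (2 ^ l)) * d (N l)) \<le> 2 * T"
        using sumB L4 by (meson mult_right_mono order_trans zero_le)
      \<comment> \<open>A nonzero \<open>Lm n\<close> excludes an infinite sum, so from here on the
        distances can be treated as reals.\<close>
      have sfin: "(\<Sum>l. ennreal (sqrt (2 ^ l)) * d (N l)) \<noteq> top"
      proof
        assume "(\<Sum>l. ennreal (sqrt (2 ^ l)) * d (N l)) = top"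
        then have "Lm n * top \<le> 2 * T" using sB by simp
        then have "top \<le> 2 * T" using False by (simp add: ennreal_mult_top)
        then show False using T2 by (meson leD)
      qed
      have dfin: "d (N l) < top" for l
      proof -
        have "ennreal 1 * d (N l) \<le> ennreal (sqrt (2 ^ l)) * d (N l)" by (intro mult_right_mono ennreal_leI) auto
        also have "\<dots> \<le> (\<Sum>l. ennreal (sqrt (2 ^ l)) * d (N l))"
          using sum_le_suminf[OF _ finite.insertI[OF finite.emptyI], of "\<lambda>l. ennreal (sqrt (2 ^ l)) * d (N l)" l] by simp
        finally show ?thesis using sfin by (simp add: less_top)
      qed
      define \<delta> where "\<delta> l = enn2real (d (N l))" for l
      have \<delta>: "ennreal (\<delta> l) = d (N l)" for l using dfin by (simp add: \<delta>_def)
      have \<delta>0: "0 \<le> \<delta> l" for l by (simp add: \<delta>_def)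
      have summand: "ennreal (sqrt (2 ^ l) * \<delta> l) = ennreal (sqrt (2 ^ l)) * d (N l)" for l
        by (simp add: ennreal_mult \<delta>0 \<delta>)
      have t0: "0 \<le> sqrt (2 ^ l) * \<delta> l" for l using \<delta>0 by simp
      have sm: "summable (\<lambda>l. sqrt (2 ^ l) * \<delta> l)"
        using sfin t0 unfolding summand[symmetric] by (intro summable_suminf_not_top)
      define S where "S = (\<Sum>l. sqrt (2 ^ l) * \<delta> l)"
      have S0: "0 \<le> S" unfolding S_def by (intro suminf_nonneg sm t0)
      have "(\<Sum>l. ennreal (sqrt (2 ^ l)) * d (N l)) = ennreal S"
        unfolding S_def summand[symmetric] by (rule suminf_ennreal2[OF t0 sm])
      then have LS: "Lm n * ennreal S \<le> 2 * T" using sB by simp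
      have errN: "L2_norm M (f - comb {..<2 ^ l * n} (cf f)) \<le> \<delta> l" if "f \<in> F" for f l
        using err[OF that, of l] \<delta>0[of l] unfolding \<delta>[symmetric] by (simp add: ennreal_le_iff N_def)
      have coeff: "(\<Sum>k\<in>A. (cmod (cf f k))\<^sup>2) \<le> (\<delta> l)\<^sup>2"
        if f: "f \<in> F" and A: "finite A" "A \<subseteq> {2 ^ l * n..}" for f l A
      proof -
        have "(\<Sum>k\<in>A. (cmod (cf f k))\<^sup>2) \<le> (L2_norm M (f - comb {..<2 ^ l * n} (cf f)))\<^sup>2"
          by (rule coefficients_le_dist[OF _ comb_in_span A]) (use f F in auto)
        also have "\<dots> \<le> (\<delta> l)\<^sup>2" by (intro power_mono errN f L2_norm_nonneg)
        finally show ?thesis .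
      qed
      have "\<exists>x W. (\<forall>i<3 * n. x i \<in> space M) \<and>
        (\<forall>f\<in>F. (\<Sum>k<n. (cmod ((\<Sum>i<3 * n. f (x i) * W i k) - cf f k))\<^sup>2) \<le> 70 * S\<^sup>2)"
        unfolding S_def by (rule dyadic_reconstruction[OF n F(2,1) \<delta>0 sm]) (rule coeff errN; assumption)+
      then obtain x W where x: "\<forall>i<3 * n. x i \<in> space M"
        and xW: "\<forall>f\<in>F. (\<Sum>k<n. (cmod ((\<Sum>i<3 * n. f (x i) * W i k) - cf f k))\<^sup>2) \<le> 70 * S\<^sup>2"
        by (elim exE conjE) (rule that)
      \<comment> \<open>Three points per dimension of \<open>V n\<close> with n = 2 m: this is the 6
        of the final bound.\<close>
      have n6: "3 * n = 6 * m" by (simp add: n_def)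
      show ?thesis
      proof (rule lin_sampling_number_le[where x = x and \<phi> = "\<lambda>i. comb {..<n} (W i)"])
        fix f assume f: "f \<in> F"
        define c where "c k = (\<Sum>i<3 * n. f (x i) * W i k)" for k
        have eq: "(\<Sum>i<6 * m. cscale (f (x i)) (comb {..<n} (W i))) = comb {..<n} c"
        proof
          fix y
          have "(\<Sum>i<3 * n. \<Sum>k<n. f (x i) * W i k * b k y) = (\<Sum>k<n. \<Sum>i<3 * n. f (x i) * W i k * b k y)"
            by (rule sum.swap)
          then show "(\<Sum>i<6 * m. cscale (f (x i)) (comb {..<n} (W i))) y = comb {..<n} c y"
            by (simp add: n6 sum_apply_fun cscale_apply comb_apply c_def sum_distrib_left sum_distrib_right mult.assoc)
        qed
        have "(L2_norm M (comb {..<n} (\<lambda>k. cf f k - c k)))\<^sup>2 = (\<Sum>k<n. (cmod (c k - cf f k))\<^sup>2)"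
          by (simp add: comb_norm norm_minus_commute)
        also have "\<dots> \<le> 70 * S\<^sup>2" using xW f by (simp add: c_def)
        \<comment> \<open>As 81 exceeds 70, the integer 9 replaces sqrt 70. The tail contributes 2 T
          and the least squares error 9 * 2 T, together 20 T.\<close>
        also have "\<dots> \<le> (9 * S)\<^sup>2" by (simp add: power_mult_distrib)
        finally have "L2_norm M (comb {..<n} (\<lambda>k. cf f k - c k)) \<le> 9 * S"
          by (rule power2_le_imp_le) (use S0 in simp)
        then have "Lm n * ennreal (L2_norm M (comb {..<n} (\<lambda>k. cf f k - c k))) \<le> Lm n * ennreal (9 * S)"
          by (intro mult_left_mono ennreal_leI) auto
        also have "\<dots> = 9 * (Lm n * ennreal S)" using S0 by (simp add: ennreal_mult mult_ac)
        also have "\<dots> \<le> 9 * (2 * T)" using LS by (intro mult_left_mono) auto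
        finally have "ennreal (nY (f - comb {..<n} c)) \<le> 2 * T + 9 * (2 * T)"
          using split[OF f, of c] by (meson add_left_mono order_trans)
        also have "\<dots> = 20 * T"
        proof -
          have "2 * T + 9 * (2 * T) = (2 + 18) * T" unfolding distrib_right by (simp add: mult.assoc[symmetric])
          then show ?thesis by simp
        qed
        finally show "ennreal (nY (f - (\<Sum>i<6 * m. cscale (f (x i)) (comb {..<n} (W i))))) \<le> 20 * T"
          unfolding eq .
      qed (use x n6 comb_Y in auto)
    qed
  qed
  then show ?thesis unfolding T_def a_def[abs_def] d_def Lm_def .
qed

theorem theorem3p35:
  shows "\<exists>c C :: nat. c \<ge> 1 \<and> C \<ge> 1 \<and>
    (\<forall>(M :: 'a measure) F Y nY V.
       F \<subseteq> L2 M \<longrightarrow>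
       assumption_A M F \<longrightarrow>
       seminormed_fun_space (space M) Y nY \<longrightarrow>
       assumption_B M Y nY \<longrightarrow>
       F \<subseteq> Y \<longrightarrow>
       nested_subspaces M V \<longrightarrow>
       (\<forall>m\<ge>1. V m \<subseteq> Y \<inter> L2 M) \<longrightarrow>
       \<comment> \<open>Excludes only the degenerate case in which the seminorm of \<open>Y\<close> vanishes on all \<open>V k\<close>
           (so that the right-hand side is zero) although \<open>F\<close> is not approximated by the \<open>V k\<close>;
           there the inequality can fail.\<close>
       ((\<exists>k\<ge>1. Lambda M nY (V k) > 0) \<or> (\<lambda>k. L2_dist M F (V k)) \<longlonglongrightarrow> 0) \<longrightarrow>
       (\<forall>m\<ge>1.
          lin_sampling_number (space M) (c * m) F Y nY
          \<le> of_nat C * (\<Sum>\<^sub>\<infinity>k\<in>{m<..}.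
               L2_dist M F (V k) / ennreal (sqrt (real k)) *
               max (Lambda M nY (V (4 * k)) / ennreal (sqrt (real k)))
                   (Lambda M nY (V (4 * m)) / ennreal (sqrt (real m))))))"
proof (rule exI[of _ 6], rule exI[of _ 20], intro conjI allI impI)
  fix M :: "'a measure" and F Y nY V and m :: nat
  assume "F \<subseteq> L2 M" "assumption_A M F" "seminormed_fun_space (space M) Y nY"
    "assumption_B M Y nY" "F \<subseteq> Y" "nested_subspaces M V" and VY: "\<forall>m\<ge>1. V m \<subseteq> Y \<inter> L2 M"
    and "(\<exists>k\<ge>1. Lambda M nY (V k) > 0) \<or> (\<lambda>k. L2_dist M F (V k)) \<longlonglongrightarrow> 0" "1 \<le> m"
  from sampling_number_bound[OF this(1-6) VY[rule_format] this(8,9)]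
  show "lin_sampling_number (space M) (6 * m) F Y nY
          \<le> of_nat 20 * (\<Sum>\<^sub>\<infinity>k\<in>{m<..}.
               L2_dist M F (V k) / ennreal (sqrt (real k)) *
               max (Lambda M nY (V (4 * k)) / ennreal (sqrt (real k)))
                   (Lambda M nY (V (4 * m)) / ennreal (sqrt (real m))))"
    by simp
qed simp_all

end
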